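(* Let $\Sigma$ be a closed Riemann surface of genus $g\ge 2$ with canonical bundle $K$ and a fixed square root $K^{1/2}$, let $n\ge 2$ and let $1\le k\le n$ be an integer. Let $$E=K^{\frac{n-1}{2}}\oplus K^{\frac{n-3}{2}}\oplus\cdots\oplus K^{-\frac{n-1}{2}}$$ and, for holomorphic differentials $q_j\in H^0(\Sigma,K^j)$ (one for each $2\le j\le n$ with $j\equiv 0 \bmod k$), let $$\phi=\tilde e_1+\sum_{2\le j\le n,\ j\equiv 0\,(\mathrm{mod}\,k)}q_j\,e_{j-1}:E\to E\otimes K$$ be the corresponding Higgs field in the Hitchin component. Then the Hermitian metric $h$ on $E$ solving the Hitchin equation $F_{A_h}+[\phi,\phi^{*_h}]=0$ splits as a direct sum metric $h=h_1\oplus\cdots\oplus h_k$ (i.e. the summands are mutually $h$-orthogonal) on $E=E_1\oplus\cdots\oplus E_k$, where for $1\le j\le k$ $$E_j=\bigoplus_{l\ge 0,\ j+kl\le n}K^{\frac{n+1-2j}{2}-kl}=K^{\frac{n+1-2j}{2}}\oplus K^{\frac{n+1-2j}{2}-k}\oplus K^{\frac{n+1-2j}{2}-2k}\oplus\cdots.$$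
   Context: Number the summands of $E$ by $i=1,\dots,n$, the $i$-th one being $K^{(n+1-2i)/2}$. A bundle map $E\to E\otimes K$ is written as an $n\times n$ matrix whose $(a,b)$ entry is a section of $K^{b-a+1}$. $\tilde e_1$ is the matrix with $(i+1,i)$ entries equal to $1$ ($1\le i\le n-1$) and zeros elsewhere. For $j\ge 3$, $e_{j-1}$ is the matrix with $(i,i+j-1)$ entries equal to $1$ ($1\le i\le n-j+1$) and zeros elsewhere; $e_1$ is the matrix with $(i,i+1)$ entry $\frac{i(n-i)}{2}$ ($1\le i\le n-1$) and zeros elsewhere, so that $\langle \tilde e_1,e_1,[e_1,\tilde e_1]\rangle\cong\mathfrak{sl}(2,\mathbb C)$. The Higgs bundle $(E,\phi)$ is a stable $SL(n,\mathbb C)$-Higgs bundle, so by the theorem of Hitchin and Simpson there is a unique Hermitian metric $h$ on $E$ (inducing the trivial metric on the trivial bundle $\det E$) with $F_{A_h}+[\phi,\phi^{*_h}]=0$, where $A_h$ is the Chern connection of $h$, $F_{A_h}$ its curvature and $\phi^{*_h}$ the $h$-adjoint. *)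

theory Defs
  imports
    "HOL-Complex_Analysis.Complex_Analysis"
    "HOL-Library.Function_Algebras"
    "Jordan_Normal_Form.Schur_Decomposition"
begin

section \<open>Closed Riemann surfaces\<close>

text \<open>
  A chart is a pair \<open>(U, z)\<close> of a coordinate domain and a coordinate function; only the values of
  \<open>z\<close> on \<open>U\<close> matter. The surface is the whole type. An atlas need not be maximal.
\<close>

type_synonym 'a chart = "'a set \<times> ('a \<Rightarrow> complex)"

definition coord_image :: "'a chart \<Rightarrow> complex set" where
  "coord_image \<alpha> = snd \<alpha> ` fst \<alpha>"

definition chart_inv :: "'a chart \<Rightarrow> complex \<Rightarrow> 'a" where
  "chart_inv \<alpha> = inv_into (fst \<alpha>) (snd \<alpha>)"

definition closed_riemann_surface :: "'a::t2_space chart set \<Rightarrow> bool" where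
  "closed_riemann_surface \<A> \<longleftrightarrow>
     compact (UNIV :: 'a set) \<and> connected (UNIV :: 'a set) \<and>
     (\<Union>\<alpha>\<in>\<A>. fst \<alpha>) = UNIV \<and>
     (\<forall>\<alpha>\<in>\<A>. open (fst \<alpha>) \<and> open (coord_image \<alpha>) \<and>
        homeomorphism (fst \<alpha>) (coord_image \<alpha>) (snd \<alpha>) (chart_inv \<alpha>)) \<and>
     (\<forall>\<alpha>\<in>\<A>. \<forall>\<beta>\<in>\<A>.
        (snd \<beta> \<circ> chart_inv \<alpha>) holomorphic_on (snd \<alpha> ` (fst \<alpha> \<inter> fst \<beta>)))"

text \<open>The derivative \<open>dz\<^sub>\<beta> / dz\<^sub>\<alpha>\<close> at a point \<open>p\<close> of both coordinate domains.\<close>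

definition coord_deriv :: "'a chart \<Rightarrow> 'a chart \<Rightarrow> 'a \<Rightarrow> complex" where
  "coord_deriv \<alpha> \<beta> p = deriv (snd \<beta> \<circ> chart_inv \<alpha>) (snd \<alpha> p)"

text \<open>
  \<open>H\<^sup>0(\<Sigma>, K\<^sup>j)\<close>: a differential is given by its coefficients \<open>q\<^sub>\<alpha>\<close> with
  \<open>q = q\<^sub>\<alpha> dz\<^sub>\<alpha>\<^sup>j\<close>, written as functions of the coordinate. Coefficients are set to zero
  where they carry no information, so that equal sections are equal functions.
\<close>

definition holomorphic_differentials ::
    "'a chart set \<Rightarrow> nat \<Rightarrow> ('a chart \<Rightarrow> complex \<Rightarrow> complex) set" where
  "holomorphic_differentials \<A> j = {q.
     (\<forall>\<alpha>\<in>\<A>. q \<alpha> holomorphic_on coord_image \<alpha>) \<and>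
     (\<forall>\<alpha>\<in>\<A>. \<forall>\<beta>\<in>\<A>. \<forall>p\<in>fst \<alpha> \<inter> fst \<beta>.
        q \<alpha> (snd \<alpha> p) = q \<beta> (snd \<beta> p) * coord_deriv \<alpha> \<beta> p ^ j) \<and>
     (\<forall>\<alpha> z. \<alpha> \<notin> \<A> \<or> z \<notin> coord_image \<alpha> \<longrightarrow> q \<alpha> z = 0)}"

text \<open>The genus is taken to be \<open>dim H\<^sup>0(\<Sigma>, K)\<close>.\<close>

definition genus :: "'a chart set \<Rightarrow> nat" where
  "genus \<A> = vector_space.dim
     (\<lambda>(c::complex) (q :: 'a chart \<Rightarrow> complex \<Rightarrow> complex). (\<lambda>\<alpha> z. c * q \<alpha> z))
     (holomorphic_differentials \<A> 1)"

text \<open>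
  A square root of \<open>K\<close>: holomorphic transition functions \<open>c\<^sub>\<alpha>\<^sub>\<beta>\<close> of local frames
  \<open>\<sigma>\<^sub>\<alpha> = dz\<^sub>\<alpha>\<^bsup>1/2\<^esup>\<close>, with \<open>\<sigma>\<^sub>\<beta> = c\<^sub>\<alpha>\<^sub>\<beta> \<sigma>\<^sub>\<alpha>\<close> and
  \<open>\<sigma>\<^sub>\<alpha>\<^sup>2 = dz\<^sub>\<alpha>\<close>.
  Every square root has this form over a suitable (sufficiently fine) atlas.
\<close>

definition canonical_square_root ::
    "'a chart set \<Rightarrow> ('a chart \<Rightarrow> 'a chart \<Rightarrow> 'a \<Rightarrow> complex) \<Rightarrow> bool" where
  "canonical_square_root \<A> c \<longleftrightarrow>
     (\<forall>\<alpha>\<in>\<A>. \<forall>\<beta>\<in>\<A>.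
        (c \<alpha> \<beta> \<circ> chart_inv \<alpha>) holomorphic_on (snd \<alpha> ` (fst \<alpha> \<inter> fst \<beta>)) \<and>
        (\<forall>p\<in>fst \<alpha> \<inter> fst \<beta>. (c \<alpha> \<beta> p)\<^sup>2 = coord_deriv \<alpha> \<beta> p)) \<and>
     (\<forall>\<alpha>\<in>\<A>. \<forall>\<beta>\<in>\<A>. \<forall>\<gamma>\<in>\<A>. \<forall>p\<in>fst \<alpha> \<inter> fst \<beta> \<inter> fst \<gamma>.
        c \<alpha> \<gamma> p = c \<alpha> \<beta> p * c \<beta> \<gamma> p)"


section \<open>Smooth functions and Wirtinger derivatives\<close>

primrec Ck_on :: "nat \<Rightarrow> (complex \<Rightarrow> complex) \<Rightarrow> complex set \<Rightarrow> bool" where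
  "Ck_on 0 f U \<longleftrightarrow> continuous_on U f"
| "Ck_on (Suc k) f U \<longleftrightarrow> (\<forall>z\<in>U. f differentiable (at z)) \<and>
     (\<forall>v. Ck_on k (\<lambda>z. frechet_derivative f (at z) v) U)"

definition smooth_on :: "(complex \<Rightarrow> complex) \<Rightarrow> complex set \<Rightarrow> bool" where
  "smooth_on f U \<longleftrightarrow> (\<forall>k. Ck_on k f U)"

definition d_z :: "(complex \<Rightarrow> complex) \<Rightarrow> complex \<Rightarrow> complex" where
  "d_z f z = (frechet_derivative f (at z) 1 - \<i> * frechet_derivative f (at z) \<i>) / 2"

definition d_zbar :: "(complex \<Rightarrow> complex) \<Rightarrow> complex \<Rightarrow> complex" where
  "d_zbar f z = (frechet_derivative f (at z) 1 + \<i> * frechet_derivative f (at z) \<i>) / 2"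

definition mat_d_z :: "nat \<Rightarrow> (complex \<Rightarrow> complex mat) \<Rightarrow> complex \<Rightarrow> complex mat" where
  "mat_d_z n M z = Matrix.mat n n (\<lambda>(a, b). d_z (\<lambda>w. M w $$ (a, b)) z)"

definition mat_d_zbar :: "nat \<Rightarrow> (complex \<Rightarrow> complex mat) \<Rightarrow> complex \<Rightarrow> complex mat" where
  "mat_d_zbar n M z = Matrix.mat n n (\<lambda>(a, b). d_zbar (\<lambda>w. M w $$ (a, b)) z)"


section \<open>Hermitian metrics and the Hitchin equation\<close>

text \<open>
  A holomorphic bundle of rank \<open>n\<close> is given by its frame transition matrices
  \<open>g\<^sub>\<alpha>\<^sub>\<beta>\<close>: \<open>e\<^sup>\<beta>\<^sub>b = (\<Sum>a. (g\<^sub>\<alpha>\<^sub>\<beta>)\<^sub>a\<^sub>b e\<^sup>\<alpha>\<^sub>a)\<close>.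
  A Hermitian metric is given by its Gram matrices \<open>H\<^sub>\<alpha>\<close>, functions of the coordinate, with
  \<open>h(v, w) = w\<^sup>* H\<^sub>\<alpha> v\<close> for the coefficient vectors of \<open>v\<close> and \<open>w\<close> in the frame \<open>e\<^sup>\<alpha>\<close>.
\<close>

definition herm_form :: "complex mat \<Rightarrow> complex Matrix.vec \<Rightarrow> complex Matrix.vec \<Rightarrow> complex" where
  "herm_form H v w = (H *\<^sub>v v) \<bullet>c w"

definition hermitian_pos_def :: "nat \<Rightarrow> complex mat \<Rightarrow> bool" where
  "hermitian_pos_def n H \<longleftrightarrow> H \<in> carrier_mat n n \<and> mat_adjoint H = H \<and>
     (\<forall>v\<in>carrier_vec n. v \<noteq> 0\<^sub>v n \<longrightarrow> Re (herm_form H v v) > 0)"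

definition hermitian_metric ::
    "'a chart set \<Rightarrow> nat \<Rightarrow> ('a chart \<Rightarrow> 'a chart \<Rightarrow> 'a \<Rightarrow> complex mat) \<Rightarrow>
     ('a chart \<Rightarrow> complex \<Rightarrow> complex mat) \<Rightarrow> bool" where
  "hermitian_metric \<A> n g h \<longleftrightarrow>
     (\<forall>\<alpha>\<in>\<A>. (\<forall>z\<in>coord_image \<alpha>. hermitian_pos_def n (h \<alpha> z)) \<and>
        (\<forall>a<n. \<forall>b<n. smooth_on (\<lambda>z. h \<alpha> z $$ (a, b)) (coord_image \<alpha>))) \<and>
     (\<forall>\<alpha>\<in>\<A>. \<forall>\<beta>\<in>\<A>. \<forall>p\<in>fst \<alpha> \<inter> fst \<beta>.
        h \<beta> (snd \<beta> p) = mat_adjoint (g \<alpha> \<beta> p) * h \<alpha> (snd \<alpha> p) * g \<alpha> \<beta> p)"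

definition mat_inv :: "complex mat \<Rightarrow> complex mat" where
  "mat_inv M = the (mat_inverse M)"

text \<open>
  In a holomorphic frame the Chern connection is \<open>d + A dz\<close> with \<open>A = H\<^sup>-\<^sup>1 \<partial>\<^sub>z H\<close>. It is of type
  \<open>(1,0)\<close>, so its curvature is \<open>d(A dz) = - \<partial>\<^sub>z\<^sub>b\<^sub>a\<^sub>r A dz \<and> dzbar\<close>.
\<close>

definition chern_connection :: "nat \<Rightarrow> (complex \<Rightarrow> complex mat) \<Rightarrow> complex \<Rightarrow> complex mat" where
  "chern_connection n H z = mat_inv (H z) * mat_d_z n H z"

definition chern_curvature :: "nat \<Rightarrow> (complex \<Rightarrow> complex mat) \<Rightarrow> complex \<Rightarrow> complex mat" where
  "chern_curvature n H z = - mat_d_zbar n (chern_connection n H) z"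

text \<open>The adjoint of \<open>\<Phi>\<close> for the form \<open>w\<^sup>* H v\<close>; thus \<open>(\<Phi> dz)\<^sup>*\<close> is \<open>herm_adjoint H \<Phi> dzbar\<close>.\<close>

definition herm_adjoint :: "complex mat \<Rightarrow> complex mat \<Rightarrow> complex mat" where
  "herm_adjoint H \<Phi> = mat_inv H * mat_adjoint \<Phi> * H"

text \<open>
  \<open>F + [\<phi>, \<phi>\<^sup>*] = 0\<close>, read off as the coefficient of \<open>dz \<and> dzbar\<close> in every chart;
  \<open>[\<phi>, \<phi>\<^sup>*] = \<phi> \<and> \<phi>\<^sup>* + \<phi>\<^sup>* \<and> \<phi>\<close> for one-forms.
\<close>

definition hitchin_equation ::
    "'a chart set \<Rightarrow> nat \<Rightarrow> ('a chart \<Rightarrow> complex \<Rightarrow> complex mat) \<Rightarrow>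
     ('a chart \<Rightarrow> complex \<Rightarrow> complex mat) \<Rightarrow> bool" where
  "hitchin_equation \<A> n \<phi> h \<longleftrightarrow> (\<forall>\<alpha>\<in>\<A>. \<forall>z\<in>coord_image \<alpha>.
     chern_curvature n (h \<alpha>) z +
       (\<phi> \<alpha> z * herm_adjoint (h \<alpha> z) (\<phi> \<alpha> z) - herm_adjoint (h \<alpha> z) (\<phi> \<alpha> z) * \<phi> \<alpha> z) = 0\<^sub>m n n)"


section \<open>The Hitchin component\<close>

text \<open>
  Matrix indices start at 0, so the row and column \<open>a\<close> belong to the summand with number
  \<open>i = a + 1\<close>, which is \<open>K\<^bsup>(n+1-2i)/2\<^esup>\<close> with local frame \<open>\<sigma>\<^sub>\<alpha>\<^bsup>n+1-2i\<^esup>\<close>.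
\<close>

definition hitchin_bundle ::
    "nat \<Rightarrow> ('a chart \<Rightarrow> 'a chart \<Rightarrow> 'a \<Rightarrow> complex) \<Rightarrow> 'a chart \<Rightarrow> 'a chart \<Rightarrow> 'a \<Rightarrow> complex mat" where
  "hitchin_bundle n c \<alpha> \<beta> p = Matrix.mat n n (\<lambda>(a, b).
     if a = b then c \<alpha> \<beta> p powi (int n + 1 - 2 * int (a + 1)) else 0)"

text \<open>
  The exponents above sum to 0, so the frames of \<open>det E\<close> induced by the local frames of \<open>E\<close>
  coincide and trivialise \<open>det E\<close>; its metric is then the function \<open>det H\<^sub>\<alpha>\<close>.
\<close>

definition trivial_on_det ::
    "'a chart set \<Rightarrow> ('a chart \<Rightarrow> complex \<Rightarrow> complex mat) \<Rightarrow> bool" where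
  "trivial_on_det \<A> h \<longleftrightarrow> (\<forall>\<alpha>\<in>\<A>. \<forall>z\<in>coord_image \<alpha>. Determinant.det (h \<alpha> z) = 1)"

definition e1_tilde :: "nat \<Rightarrow> complex mat" where
  "e1_tilde n = Matrix.mat n n (\<lambda>(a, b). if a = b + 1 then 1 else 0)"

definition e_mat :: "nat \<Rightarrow> nat \<Rightarrow> complex mat" where
  "e_mat n m = Matrix.mat n n (\<lambda>(a, b).
     if b = a + m
     then (if m = 1 then of_nat (a + 1) * (of_nat n - of_nat (a + 1)) / 2 else 1)
     else 0)"

text \<open>
  The matrix \<open>\<Phi>\<^sub>\<alpha>\<close> of \<open>\<phi> = \<Phi>\<^sub>\<alpha> dz\<^sub>\<alpha>\<close> in the local frame of \<open>E\<close>. An entry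
  \<open>(a, b)\<close> that is the section \<open>f dz\<^sub>\<alpha>\<^bsup>b-a+1\<^esup>\<close> of \<open>K\<^bsup>b-a+1\<^esup>\<close> contributes \<open>f\<close>.
\<close>

definition hitchin_higgs_field ::
    "nat \<Rightarrow> nat set \<Rightarrow> (nat \<Rightarrow> 'a chart \<Rightarrow> complex \<Rightarrow> complex) \<Rightarrow> 'a chart \<Rightarrow> complex \<Rightarrow> complex mat" where
  "hitchin_higgs_field n J q \<alpha> z = Matrix.mat n n (\<lambda>(a, b).
     e1_tilde n $$ (a, b) + (\<Sum>j\<in>J. q j \<alpha> z * e_mat n (j - 1) $$ (a, b)))"


section \<open>Orthogonal splittings\<close>

text \<open>Numbers of the line bundles \<open>K\<^bsup>(n+1-2j)/2 - kl\<^esup>\<close> that make up \<open>E\<^sub>j\<close>.\<close>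

definition summand_indices :: "nat \<Rightarrow> nat \<Rightarrow> nat \<Rightarrow> nat set" where
  "summand_indices n k j = {j + k * l | l. j + k * l \<le> n}"

text \<open>Coefficient vectors in the fibre of the sum of the line bundles with number in \<open>S\<close>.\<close>

definition summand_fibre :: "nat \<Rightarrow> nat set \<Rightarrow> complex Matrix.vec set" where
  "summand_fibre n S = {v \<in> carrier_vec n. \<forall>a<n. a + 1 \<notin> S \<longrightarrow> v $ a = 0}"

definition splits_orthogonally ::
    "'a chart set \<Rightarrow> nat \<Rightarrow> ('a chart \<Rightarrow> complex \<Rightarrow> complex mat) \<Rightarrow> nat \<Rightarrow> (nat \<Rightarrow> nat set) \<Rightarrow> bool" where
  "splits_orthogonally \<A> n h k S \<longleftrightarrow>
     (\<Union>j\<in>{1..k}. S j) = {1..n} \<and> disjoint_family_on S {1..k} \<and>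
     (\<forall>\<alpha>\<in>\<A>. \<forall>z\<in>coord_image \<alpha>. \<forall>i\<in>{1..k}. \<forall>j\<in>{1..k}. i \<noteq> j \<longrightarrow>
        (\<forall>v\<in>summand_fibre n (S i). \<forall>w\<in>summand_fibre n (S j). herm_form (h \<alpha> z) v w = 0))"

end

theory Submission
  imports Defs
begin

text \<open>
  Let \<open>\<zeta> = exp (2 \<pi> \<i> / k)\<close> and \<open>D = diag (1, \<zeta>, \<zeta>\<^sup>2, \<dots>)\<close>. The entry \<open>(a, b)\<close> of the Higgs field vanishes
  unless \<open>a - b \<equiv> 1\<close> modulo \<open>k\<close>, so \<open>D \<phi> D\<^sup>-\<^sup>1 = \<zeta> \<phi>\<close> and \<open>D\<^sup>* h D\<close> solves the Hitchin equation together
  with \<open>h\<close>. If the two metrics agree, then \<open>h\<close> commutes with \<open>D\<close>, that is, \<open>h\<close> splits.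

  They agree because the solution is unique. For two solutions \<open>h\<close>, \<open>h'\<close> and \<open>s = h\<^sup>-\<^sup>1 h'\<close> the Laplacian
  of \<open>tr s\<close> is a sum of squared norms of \<open>\<partial>\<^sub>z\<^sub>b\<^sub>a\<^sub>r s\<close> and \<open>[s, \<phi>]\<close>; by the maximum principle \<open>tr s\<close> is constant,
  so \<open>s\<close> is holomorphic and commutes with \<open>\<phi>\<close>. Instead of stability one can use the shape of \<open>\<phi>\<close>: the
  entries of \<open>s\<close> below the diagonal are sections of negative powers of \<open>K\<close> and vanish, and
  commuting with the lower Hessenberg matrix \<open>\<phi>\<close> makes the diagonal of \<open>s\<close> constant. The nilpotent part
  of \<open>s\<close> is \<open>h\<close>-self-adjoint, hence zero, so \<open>s\<close> is a scalar, and \<open>h' = D\<^sup>* h D\<close> has the same diagonal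
  as \<open>h\<close>.
\<close>

section \<open>Positive definite matrices\<close>

text \<open>The trace of s is the convenient test function because its z-derivative is the explicit
  expression \<open>tr (s (A' - A))\<close> in the two Chern connections: its Laplacian needs one
  further derivative of the connections, and the Hitchin equation supplies exactly that one. The
  bundle is never an object of its own. Everything is a family of matrix functions on coordinate
  domains; local facts are proved on one open subset of the plane, and charts meet only through the
  agreement of values at common points. On the surface one argument serves twice: a function that is
  locally constant wherever it attains its maximum is constant. For \<open>tr s\<close> the local
  input is a maximum principle of Hopf type, for holomorphic functions it is the maximum modulus
  principle. The genus enters as the dimension of the space of holomorphic differentials. In
  dimension at least two some nonzero differential vanishes at a prescribed point, and this takes
  the place of degrees of line bundles in the vanishing of sections of negative powers of K.\<close>

definition mtrace :: "complex mat \<Rightarrow> complex" where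
  "mtrace M = (\<Sum>i<dim_row M. M $$ (i, i))"

lemma index_mult_mat_sum:
  assumes "M \<in> carrier_mat m n" "N \<in> carrier_mat n l" "i < m" "j < l"
  shows "(M * N) $$ (i, j) = (\<Sum>k<n. M $$ (i, k) * N $$ (k, j))"
  using assms by (auto simp: scalar_prod_def lessThan_atLeast0)

lemma mtrace_mult:
  assumes "M \<in> carrier_mat m n" "N \<in> carrier_mat n m"
  shows "mtrace (M * N) = (\<Sum>i<m. \<Sum>k<n. M $$ (i, k) * N $$ (k, i))"
proof -
  have "mtrace (M * N) = (\<Sum>i<m. (M * N) $$ (i, i))"
    using assms by (simp add: mtrace_def)
  also have "\<dots> = (\<Sum>i<m. \<Sum>k<n. M $$ (i, k) * N $$ (k, i))"
    using assms by (intro sum.cong refl index_mult_mat_sum) auto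
  finally show ?thesis .
qed

lemma square_mult_carrier:
  "M \<in> carrier_mat n n \<Longrightarrow> N \<in> carrier_mat n n \<Longrightarrow> M * N \<in> carrier_mat n n"
  by (rule mult_carrier_mat)

lemma square_mult_assoc:
  fixes L M N :: "'b::semiring_0 mat"
  shows "L \<in> carrier_mat n n \<Longrightarrow> M \<in> carrier_mat n n \<Longrightarrow> N \<in> carrier_mat n n \<Longrightarrow>
    L * M * N = L * (M * N)"
  by (rule assoc_mult_mat)

lemma mtrace_comm:
  assumes "M \<in> carrier_mat m n" "N \<in> carrier_mat n m"
  shows "mtrace (M * N) = mtrace (N * M)"
  unfolding mtrace_mult[OF assms] mtrace_mult[OF assms(2,1)]
  by (subst sum.swap) (simp add: mult.commute)

lemma mtrace_add:
  assumes "M \<in> carrier_mat n n" "N \<in> carrier_mat n n"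
  shows "mtrace (M + N) = mtrace M + mtrace N"
  using assms by (auto simp: mtrace_def sum.distrib)

lemma mtrace_diff:
  assumes "M \<in> carrier_mat n n" "N \<in> carrier_mat n n"
  shows "mtrace (M - N) = mtrace M - mtrace N"
  using assms by (auto simp: mtrace_def sum_subtractf)

section \<open>Adjoints and inverses of complex matrices\<close>

lemma mat_adjoint_carrier [simp]: "M \<in> carrier_mat m n \<Longrightarrow> mat_adjoint M \<in> carrier_mat n m"
  by (intro carrier_matI) (auto simp: mat_adjoint_def)

lemma dim_mat_adjoint [simp]:
  "dim_row (mat_adjoint M) = dim_col M" "dim_col (mat_adjoint M) = dim_row M"
  by (simp_all add: mat_adjoint_def)

lemma mat_adjoint_index [simp]:
  "i < dim_col M \<Longrightarrow> j < dim_row M \<Longrightarrow> mat_adjoint M $$ (i, j) = cnj (M $$ (j, i))"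
  unfolding mat_adjoint_def by (simp add: mat_of_rows_index)

lemma mat_adjoint_adjoint [simp]: "mat_adjoint (mat_adjoint M) = (M :: complex mat)"
  by (rule eq_matI) auto

lemma mat_adjoint_mult:
  assumes "M \<in> carrier_mat m n" "N \<in> carrier_mat n l"
  shows "mat_adjoint (M * N :: complex mat) = mat_adjoint N * mat_adjoint M"
proof (rule eq_matI)
  fix i j assume "i < dim_row (mat_adjoint N * mat_adjoint M)" "j < dim_col (mat_adjoint N * mat_adjoint M)"
  then have ij: "i < l" "j < m" using assms by auto
  have "mat_adjoint (M * N) $$ (i, j) = cnj ((M * N) $$ (j, i))"
    using assms ij by simp
  also have "\<dots> = (\<Sum>k<n. mat_adjoint N $$ (i, k) * mat_adjoint M $$ (k, j))"
    unfolding index_mult_mat_sum[OF assms ij(2,1)] using assms ij by (simp add: mult.commute)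
  also have "\<dots> = (mat_adjoint N * mat_adjoint M) $$ (i, j)"
    using assms ij by (intro index_mult_mat_sum[of _ l n _ m, symmetric]) auto
  finally show "mat_adjoint (M * N) $$ (i, j) = (mat_adjoint N * mat_adjoint M) $$ (i, j)" .
qed (use assms in auto)

lemma mat_adjoint_one [simp]: "mat_adjoint (1\<^sub>m n :: complex mat) = 1\<^sub>m n"
  by (rule eq_matI) auto

lemma mat_adjoint_diff:
  assumes "M \<in> carrier_mat m n" "N \<in> carrier_mat m n"
  shows "mat_adjoint (M - N :: complex mat) = mat_adjoint M - mat_adjoint N"
  using assms by (intro eq_matI) auto

text \<open>\<open>mat_inv\<close> strips an option, so nothing is known about it until
  \<open>mat_inverse\<close> is seen to be \<open>Some\<close>; the determinant condition guarantees
  this.\<close>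

lemma mat_inv_props:
  assumes M: "M \<in> carrier_mat n n" and "Determinant.det M \<noteq> 0"
  shows "mat_inv M \<in> carrier_mat n n" "M * mat_inv M = 1\<^sub>m n" "mat_inv M * M = 1\<^sub>m n"
proof -
  have "mat_inverse M \<noteq> None"
    using mat_inverse(1)[OF M, of "()"] det_non_zero_imp_unit[OF assms, of "()"] by blast
  then obtain B where "mat_inverse M = Some B" by auto
  with mat_inverse(2)[OF M this]
  show "mat_inv M \<in> carrier_mat n n" "M * mat_inv M = 1\<^sub>m n" "mat_inv M * M = 1\<^sub>m n"
    by (auto simp: mat_inv_def)
qed

lemma right_inverse_eq_left_inverse:
  assumes "M \<in> carrier_mat n n" "N \<in> carrier_mat n n" "R \<in> carrier_mat n n"
    and "N * M = 1\<^sub>m n" "M * R = 1\<^sub>m n"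
  shows "N = (R :: 'b::semiring_1 mat)"
proof -
  have "N = N * (M * R)" using assms by simp
  also have "\<dots> = (N * M) * R" using assms assoc_mult_mat[of N n n M n R n] by simp
  finally show ?thesis using assms by simp
qed

lemma det_nonzero_of_inverse:
  assumes "M \<in> carrier_mat n n" "N \<in> carrier_mat n n" "N * M = 1\<^sub>m n"
  shows "Determinant.det (M :: complex mat) \<noteq> 0"
proof
  assume "Determinant.det M = 0"
  then have "Determinant.det (N * M) = 0"
    by (simp add: det_mult[OF assms(2,1)])
  then show False unfolding assms(3) by simp
qed

lemma mat_inv_eqI:
  assumes "M \<in> carrier_mat n n" "N \<in> carrier_mat n n" "N * M = 1\<^sub>m n"
  shows "mat_inv M = N"
  using mat_inv_props[OF assms(1) det_nonzero_of_inverse[OF assms]] assms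
    right_inverse_eq_left_inverse[OF assms(1,2)] by metis

text \<open>Cramer's rule expresses the entries of the inverse rationally in those of
  \<open>M\<close>; this is what makes the inverse of a differentiable matrix function
  differentiable.\<close>

lemma mat_inv_adj_mat:
  assumes M: "M \<in> carrier_mat n n" and "Determinant.det M \<noteq> 0"
  shows "mat_inv M = (1 / Determinant.det M) \<cdot>\<^sub>m adj_mat M"
proof (rule mat_inv_eqI[OF M])
  note a = adj_mat[OF M]
  show "(1 / Determinant.det M) \<cdot>\<^sub>m adj_mat M \<in> carrier_mat n n" using a by simp
  have "(1 / Determinant.det M) \<cdot>\<^sub>m adj_mat M * M = (1 / Determinant.det M) \<cdot>\<^sub>m (adj_mat M * M)"
    using a(1) M by (rule mult_smult_assoc_mat)
  also have "\<dots> = 1\<^sub>m n" using a(3) assms(2) by (intro eq_matI) auto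
  finally show "(1 / Determinant.det M) \<cdot>\<^sub>m adj_mat M * M = 1\<^sub>m n" .
qed

section \<open>Positive definite forms and the norm they induce on endomorphisms\<close>

lemma herm_form_sum:
  assumes "H \<in> carrier_mat n n" "v \<in> carrier_vec n" "w \<in> carrier_vec n"
  shows "herm_form H v w = (\<Sum>i<n. \<Sum>j<n. H $$ (i, j) * v $ j * cnj (w $ i))"
  using assms
  by (auto simp: herm_form_def scalar_prod_def lessThan_atLeast0 sum_distrib_right intro!: sum.cong)

lemma hermitian_pos_defD:
  assumes "hermitian_pos_def n H"
  shows "H \<in> carrier_mat n n" "mat_adjoint H = H"
    "\<And>v. v \<in> carrier_vec n \<Longrightarrow> v \<noteq> 0\<^sub>v n \<Longrightarrow> Re (herm_form H v v) > 0"
  using assms by (auto simp: hermitian_pos_def_def)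

lemma hermitian_pos_def_index:
  assumes "hermitian_pos_def n H" "i < n" "j < n"
  shows "H $$ (i, j) = cnj (H $$ (j, i))"
  using hermitian_pos_defD[OF assms(1)] assms(2,3) mat_adjoint_index[of i H j] by auto

lemma hermitian_pos_def_det:
  assumes "hermitian_pos_def n H"
  shows "Determinant.det H \<noteq> 0"
proof
  assume "Determinant.det H = 0"
  then obtain v where v: "v \<in> carrier_vec n" "v \<noteq> 0\<^sub>v n" "H *\<^sub>v v = 0\<^sub>v n"
    using det_0_iff_vec_prod_zero[OF hermitian_pos_defD(1)[OF assms]] by auto
  then have "herm_form H v v = 0" by (auto simp: herm_form_def)
  with hermitian_pos_defD(3)[OF assms v(1,2)] show False by simp
qed

lemma hermitian_pos_def_inv:
  assumes "hermitian_pos_def n H"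
  shows "mat_inv H \<in> carrier_mat n n" "H * mat_inv H = 1\<^sub>m n" "mat_inv H * H = 1\<^sub>m n"
  using mat_inv_props[OF hermitian_pos_defD(1) hermitian_pos_def_det] assms by auto

lemma hermitian_pos_def_diag:
  assumes "hermitian_pos_def n H" "i < n"
  shows "Re (H $$ (i, i)) > 0"
proof -
  note H = hermitian_pos_defD(1)[OF assms(1)]
  have "herm_form H (unit_vec n i) (unit_vec n i) = (\<Sum>a<n. if a = i then H $$ (i, i) else 0)"
    unfolding herm_form_sum[OF H unit_vec_carrier unit_vec_carrier]
  proof (rule sum.cong[OF refl])
    fix a assume a: "a \<in> {..<n}"
    have "(\<Sum>j<n. H $$ (a, j) * unit_vec n i $ j * cnj (unit_vec n i $ a)) =
        (\<Sum>j<n. if j = i then (if a = i then H $$ (i, i) else 0) else 0)"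
      using a assms(2) by (intro sum.cong) auto
    then show "(\<Sum>j<n. H $$ (a, j) * unit_vec n i $ j * cnj (unit_vec n i $ a)) =
        (if a = i then H $$ (i, i) else 0)"
      using assms(2) by simp
  qed
  then have "herm_form H (unit_vec n i) (unit_vec n i) = H $$ (i, i)"
    using assms(2) by simp
  then show ?thesis
    using hermitian_pos_defD(3)[OF assms(1), of "unit_vec n i"] assms(2) by auto
qed

text \<open>Substituting w = H^-1 v turns the form of H^-1 at v into the conjugate of the form of H
  at w.\<close>

lemma hermitian_pos_def_inverse:
  assumes "hermitian_pos_def n H"
  shows "hermitian_pos_def n (mat_inv H)"
proof -
  note H = hermitian_pos_defD[OF assms] and G = hermitian_pos_def_inv[OF assms]
  let ?G = "mat_inv H"
  have "mat_adjoint ?G * H = mat_adjoint (H * ?G)"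
    using mat_adjoint_mult[OF H(1) G(1)] H(2) by metis
  then have "mat_adjoint ?G * H = 1\<^sub>m n" using G(2) by simp
  then have adj: "mat_adjoint ?G = ?G"
    using mat_inv_eqI[of H n "mat_adjoint ?G"] H(1) G(1) by simp
  moreover have "Re (herm_form ?G v v) > 0" if v: "v \<in> carrier_vec n" "v \<noteq> 0\<^sub>v n" for v
  proof -
    let ?w = "?G *\<^sub>v v"
    have w: "?w \<in> carrier_vec n" using G(1) v(1) by (rule mult_mat_vec_carrier)
    have Hw: "H *\<^sub>v ?w = v"
      using assoc_mult_mat_vec[OF H(1) G(1) v(1)] G(2) v(1) by simp
    have "H *\<^sub>v 0\<^sub>v n = 0\<^sub>v n" using H(1) by (intro eq_vecI) auto
    then have "?w \<noteq> 0\<^sub>v n" using Hw v(2) by auto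
    then have "Re (herm_form H ?w ?w) > 0" using H(3) w by simp
    moreover have "herm_form H ?w ?w = cnj (herm_form ?G v v)"
      using v(1) w G(1) by (simp add: herm_form_def Hw scalar_prod_def mult.commute)
    ultimately show ?thesis by simp
  qed
  ultimately show ?thesis using G by (simp add: hermitian_pos_def_def)
qed

text \<open>Cholesky factorisation by induction on the size: the last index is split off and the
  Schur complement is again positive definite. Functions on indices replace matrices, so that
  restricting to the first n indices costs nothing.\<close>

lemma pos_def_sum_of_squares:
  fixes p :: "nat \<Rightarrow> nat \<Rightarrow> complex"
  assumes "\<And>i j. i < n \<Longrightarrow> j < n \<Longrightarrow> p i j = cnj (p j i)"
    and "\<And>x. \<exists>i<n. x i \<noteq> 0 \<Longrightarrow> Re (\<Sum>i<n. \<Sum>j<n. p i j * x j * cnj (x i)) > 0"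
  shows "\<exists>v. \<forall>i<n. \<forall>j<n. p i j = (\<Sum>k<n. v k i * cnj (v k j))"
  using assms
proof (induction n arbitrary: p)
  case 0
  then show ?case by simp
next
  case (Suc n)
  define d where "d = Re (p n n)"
  have dd: "p n n = of_real d"
    using Suc.prems(1)[of n n] by (simp add: d_def complex_eq_iff)
  have "Re (\<Sum>i<Suc n. \<Sum>j<Suc n. p i j * (if j = n then 1 else 0) * cnj (if i = n then 1 else 0)) > 0"
    by (rule Suc.prems(2)[of "\<lambda>i. if i = n then 1 else 0"]) auto
  then have d0: "d > 0" by (simp add: d_def)
  \<comment> \<open>The Schur complement of the last diagonal entry \<open>d\<close>.\<close>
  define p' where "p' i j = p i j - p i n * p n j / d" for i j
  have "\<exists>v. \<forall>i<n. \<forall>j<n. p' i j = (\<Sum>k<n. v k i * cnj (v k j))"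
  proof (rule Suc.IH)
    fix i j assume "i < n" "j < n"
    then show "p' i j = cnj (p' j i)"
      using Suc.prems(1)[of i j] Suc.prems(1)[of i n] Suc.prems(1)[of n j] by (simp add: p'_def)
  next
    fix x :: "nat \<Rightarrow> complex" assume x: "\<exists>i<n. x i \<noteq> 0"
    \<comment> \<open>Completing the square: this choice of the last coordinate minimises the form.\<close>
    define S where "S = (\<Sum>j<n. p n j * x j)"
    define y where "y i = (if i = n then - S / d else x i)" for i
    have cS: "(\<Sum>i<n. p i n * cnj (x i)) = cnj S"
    proof -
      have "(\<Sum>i<n. p i n * cnj (x i)) = (\<Sum>i<n. cnj (p n i) * cnj (x i))"
        by (intro sum.cong refl arg_cong2[of _ _ _ _ "(*)"] Suc.prems(1)) auto
      then show ?thesis by (simp add: S_def)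
    qed
    have row: "(\<Sum>j<Suc n. p i j * y j * cnj (y i))
        = (\<Sum>j<n. p' i j * x j * cnj (x i))" if "i < n" for i
    proof -
      have "(\<Sum>j<Suc n. p i j * y j * cnj (y i))
          = (\<Sum>j<n. p i j * x j * cnj (x i)) - p i n * cnj (x i) * S / d"
        using that by (simp add: y_def)
      also have "p i n * cnj (x i) * S / d = (\<Sum>j<n. p i n * p n j / d * x j * cnj (x i))"
        by (simp add: S_def sum_distrib_left sum_divide_distrib mult_ac)
      also have "(\<Sum>j<n. p i j * x j * cnj (x i)) - \<dots> = (\<Sum>j<n. p' i j * x j * cnj (x i))"
        by (simp add: p'_def sum_subtractf[symmetric] left_diff_distrib)
      finally show ?thesis .
    qed
    have last: "(\<Sum>j<Suc n. p n j * y j * cnj (y n)) = 0"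
    proof -
      have "(\<Sum>j<n. p n j * y j) = S"
        unfolding S_def by (rule sum.cong) (auto simp: y_def)
      then have "(\<Sum>j<Suc n. p n j * y j) = 0"
        using d0 by (simp add: dd y_def)
      then show ?thesis unfolding sum_distrib_right[symmetric] by simp
    qed
    have "(\<Sum>i<Suc n. \<Sum>j<Suc n. p i j * y j * cnj (y i))
       = (\<Sum>i<n. \<Sum>j<n. p' i j * x j * cnj (x i))"
      using last row by simp
    moreover have "\<exists>i<Suc n. y i \<noteq> 0" using x by (auto simp: y_def intro!: less_SucI)
    ultimately show "Re (\<Sum>i<n. \<Sum>j<n. p' i j * x j * cnj (x i)) > 0"
      using Suc.prems(2)[of y] by simp
  qed
  then obtain v where v: "\<And>i j. i < n \<Longrightarrow> j < n \<Longrightarrow> p' i j = (\<Sum>k<n. v k i * cnj (v k j))" by blast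
  \<comment> \<open>The last column divided by the root of \<open>d\<close> restores the subtracted
    rank-one term and the last row and column; the earlier vectors are extended by 0 in the new
    coordinate.\<close>
  define w where "w k i = (if k = n then p i n / sqrt d else if i = n then 0 else v k i)" for k i
  have sd: "complex_of_real (sqrt d) * complex_of_real (sqrt d) = d"
    using d0 by (simp flip: of_real_mult)
  have "p i j = (\<Sum>k<Suc n. w k i * cnj (w k j))" if "i < Suc n" "j < Suc n" for i j
  proof -
    have "w n i * cnj (w n j) = p i n * p n j / d"
      using Suc.prems(1)[OF _ that(2), of n] by (simp add: w_def sd)
    moreover have "(\<Sum>k<n. w k i * cnj (w k j)) = p' i j"
    proof (cases "i = n \<or> j = n")
      case True
      then have "(\<Sum>k<n. w k i * cnj (w k j)) = 0" by (auto intro!: sum.neutral simp: w_def)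
      with True show ?thesis using d0 by (auto simp: p'_def dd)
    next
      case False
      then have "(\<Sum>k<n. w k i * cnj (w k j)) = (\<Sum>k<n. v k i * cnj (v k j))"
        by (intro sum.cong) (auto simp: w_def)
      with False v that show ?thesis by simp
    qed
    ultimately show ?thesis by (simp add: p'_def)
  qed
  then show ?case by blast
qed

text \<open>The vectors of \<open>pos_def_sum_of_squares\<close> become the columns of
  \<open>R\<close>. A self-adjoint root, and with it the spectral theorem, is not called
  for.\<close>

lemma hermitian_pos_def_factor:
  assumes "hermitian_pos_def n P"
  shows "\<exists>R\<in>carrier_mat n n. P = R * mat_adjoint R"
proof -
  note P = hermitian_pos_defD[OF assms]
  have "\<exists>v. \<forall>i<n. \<forall>j<n. P $$ (i, j) = (\<Sum>k<n. v k i * cnj (v k j))"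
  proof (rule pos_def_sum_of_squares)
    fix x :: "nat \<Rightarrow> complex" assume "\<exists>i<n. x i \<noteq> 0"
    then have "Matrix.vec n x \<noteq> 0\<^sub>v n" by (metis index_vec index_zero_vec(1))
    then have "Re (herm_form P (Matrix.vec n x) (Matrix.vec n x)) > 0" using P(3) by simp
    then show "Re (\<Sum>i<n. \<Sum>j<n. P $$ (i, j) * x j * cnj (x i)) > 0"
      by (simp add: herm_form_sum[OF P(1)])
  qed (rule hermitian_pos_def_index[OF assms])
  then obtain v where v: "\<And>i j. i < n \<Longrightarrow> j < n \<Longrightarrow> P $$ (i, j) = (\<Sum>k<n. v k i * cnj (v k j))"
    by blast
  define R where "R = Matrix.mat n n (\<lambda>(i, k). v k i)"
  have R: "R \<in> carrier_mat n n" by (simp add: R_def)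
  have "P = R * mat_adjoint R"
  proof (rule eq_matI)
    fix i j assume "i < dim_row (R * mat_adjoint R)" "j < dim_col (R * mat_adjoint R)"
    then have "i < n" "j < n" using R by auto
    then show "P $$ (i, j) = (R * mat_adjoint R) $$ (i, j)"
      using v R index_mult_mat_sum[OF R, of "mat_adjoint R" n i j] by (simp add: R_def)
  qed (use P R in auto)
  with R show ?thesis by blast
qed

text \<open>Moving \<open>Y\<close> cyclically to the right leaves the Gram matrix of the columns of
  \<open>Y\<close> under \<open>H\<close>, whose diagonal entries are summed.\<close>

lemma mtrace_sandwich:
  assumes Y: "Y \<in> carrier_mat n n" and H: "H \<in> carrier_mat n n"
  shows "mtrace (Y * mat_adjoint Y * H) = (\<Sum>k<n. herm_form H (col Y k) (col Y k))"
proof -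
  have "mtrace (Y * mat_adjoint Y * H) = mtrace (Y * (mat_adjoint Y * H))"
    using Y H by (simp add: assoc_mult_mat[of _ n n _ n _ n])
  also have "\<dots> = mtrace (mat_adjoint Y * H * Y)"
    using Y H by (intro mtrace_comm[of _ n n]) auto
  also have "\<dots> = mtrace (mat_adjoint Y * (H * Y))"
    using Y H by (simp add: assoc_mult_mat[of _ n n _ n _ n])
  also have "\<dots> = (\<Sum>k<n. \<Sum>i<n. cnj (Y $$ (i, k)) * (H * Y) $$ (i, k))"
    using Y H by (subst mtrace_mult[of _ n n]) auto
  also have "\<dots> = (\<Sum>k<n. \<Sum>i<n. \<Sum>j<n. cnj (Y $$ (i, k)) * (H $$ (i, j) * Y $$ (j, k)))"
    using Y H by (simp add: index_mult_mat_sum[of _ n n _ n] sum_distrib_left del: index_mult_mat(1))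
  also have "\<dots> = (\<Sum>k<n. herm_form H (col Y k) (col Y k))"
  proof (rule sum.cong[OF refl])
    fix k assume "k \<in> {..<n}"
    then show "(\<Sum>i<n. \<Sum>j<n. cnj (Y $$ (i, k)) * (H $$ (i, j) * Y $$ (j, k)))
        = herm_form H (col Y k) (col Y k)"
      using Y by (subst herm_form_sum[OF H]) (auto simp: mult_ac)
  qed
  finally show ?thesis .
qed

text \<open>The trace is the squared norm of \<open>X\<close> with respect to \<open>P\<close> and
  \<open>H\<close>: writing \<open>P\<close> as \<open>R * mat_adjoint R\<close>, it is the sum of
  the \<open>H\<close>-norms squared of the columns of \<open>X * R\<close>. If it vanishes then
  \<open>X * R = 0\<close>, hence \<open>X * P = 0\<close>, and \<open>P\<close> is
  invertible.\<close>

lemma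
  assumes P: "hermitian_pos_def n P" and H: "hermitian_pos_def n H" and X: "X \<in> carrier_mat n n"
  shows mtrace_sandwich_nonneg: "Re (mtrace (X * P * mat_adjoint X * H)) \<ge> 0"
    and mtrace_sandwich_zero: "Re (mtrace (X * P * mat_adjoint X * H)) = 0 \<Longrightarrow> X = 0\<^sub>m n n"
proof -
  note Hc = hermitian_pos_defD[OF H] and Pc = hermitian_pos_defD[OF P]
  obtain R where R: "R \<in> carrier_mat n n" "P = R * mat_adjoint R"
    using hermitian_pos_def_factor[OF P] by blast
  let ?Y = "X * R"
  have Y: "?Y \<in> carrier_mat n n" using X R by simp
  have eq: "mtrace (X * P * mat_adjoint X * H) = (\<Sum>k<n. herm_form H (col ?Y k) (col ?Y k))"
    unfolding mtrace_sandwich[OF Y Hc(1), symmetric] R(2)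
    using X R Hc(1)
    by (simp add: mat_adjoint_mult[OF X R(1)] square_mult_carrier[of _ n] square_mult_assoc[of _ n])
  have nonneg: "Re (herm_form H (col ?Y k) (col ?Y k)) \<ge> 0" if "k < n" for k
  proof (cases "col ?Y k = 0\<^sub>v n")
    case True
    then show ?thesis using Hc(1) by (simp add: herm_form_sum[OF Hc(1)])
  next
    case False
    then show ?thesis using Hc(3)[of "col ?Y k"] Y that by (simp add: less_imp_le)
  qed
  then show "Re (mtrace (X * P * mat_adjoint X * H)) \<ge> 0"
    unfolding eq by (auto intro!: sum_nonneg)
  assume "Re (mtrace (X * P * mat_adjoint X * H)) = 0"
  then have "(\<Sum>k<n. Re (herm_form H (col ?Y k) (col ?Y k))) = 0" unfolding eq by simp
  then have "Re (herm_form H (col ?Y k) (col ?Y k)) = 0" if "k < n" for k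
    using nonneg that sum_nonneg_eq_0_iff[of "{..<n}" "\<lambda>k. Re (herm_form H (col ?Y k) (col ?Y k))"]
    by auto
  then have cols: "col ?Y k = 0\<^sub>v n" if "k < n" for k
    using Hc(3)[of "col ?Y k"] Y that by force
  have "?Y = 0\<^sub>m n n"
  proof (rule eq_matI)
    fix i j assume "i < dim_row (0\<^sub>m n n)" "j < dim_col (0\<^sub>m n n)"
    then have ij: "i < n" "j < n" by auto
    have "?Y $$ (i, j) = col ?Y j $ i" using ij X R by simp
    then show "?Y $$ (i, j) = 0\<^sub>m n n $$ (i, j)"
      unfolding cols[OF ij(2)] using ij by simp
  qed (use Y in auto)
  then have "X * P = 0\<^sub>m n n"
    using R X assoc_mult_mat[of X n n R n "mat_adjoint R" n] by simp
  then have "X * (P * mat_inv P) = 0\<^sub>m n n"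
    using X Pc hermitian_pos_def_inv[OF P] assoc_mult_mat[of X n n P n "mat_inv P" n] by simp
  then show "X = 0\<^sub>m n n" using hermitian_pos_def_inv[OF P] X by simp
qed

section \<open>Wirtinger calculus for matrix-valued functions\<close>

text \<open>The parameter treats both Wirtinger derivatives at once: \<open>- \<i>\<close> gives
  \<open>d_z\<close> and \<open>\<i>\<close> gives \<open>d_zbar\<close>. Conjugating a function
  conjugates the parameter.\<close>

definition wirtinger :: "complex \<Rightarrow> (complex \<Rightarrow> complex) \<Rightarrow> complex \<Rightarrow> complex" where
  "wirtinger c f z = (frechet_derivative f (at z) 1 + c * frechet_derivative f (at z) \<i>) / 2"

definition mat_wirtinger :: "complex \<Rightarrow> nat \<Rightarrow> (complex \<Rightarrow> complex mat) \<Rightarrow> complex \<Rightarrow> complex mat" where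
  "mat_wirtinger c n M z = Matrix.mat n n (\<lambda>(a, b). wirtinger c (\<lambda>w. M w $$ (a, b)) z)"

lemma d_z_wirtinger: "d_z = wirtinger (- \<i>)" "d_zbar = wirtinger \<i>"
  "mat_d_z = mat_wirtinger (- \<i>)" "mat_d_zbar = mat_wirtinger \<i>"
  by (auto simp: fun_eq_iff d_z_def d_zbar_def wirtinger_def mat_d_z_def mat_d_zbar_def mat_wirtinger_def)

lemma wirtinger_eq:
  assumes "(f has_derivative f') (at z)"
  shows "wirtinger c f z = (f' 1 + c * f' \<i>) / 2"
  using frechet_derivative_at[OF assms] by (simp add: wirtinger_def)

text \<open>Matrix identities are available only on the coordinate domain, outside of which the
  matrices are arbitrary. Openness makes agreement on \<open>U\<close> sufficient both for the
  derivative and for differentiability.\<close>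

lemma wirtinger_cong:
  assumes "open U" "z \<in> U" "\<And>w. w \<in> U \<Longrightarrow> f w = g w" "f differentiable (at z)"
  shows "wirtinger c f z = wirtinger c g z" "g differentiable (at z)"
proof -
  have f: "(f has_derivative frechet_derivative f (at z)) (at z)"
    using assms(4) by (simp add: frechet_derivative_works)
  have g: "(g has_derivative frechet_derivative f (at z)) (at z)"
    by (rule has_derivative_transform_within_open[OF f assms(1,2,3)])
  show "wirtinger c f z = wirtinger c g z" "g differentiable (at z)"
    using g by (simp_all only: wirtinger_eq[OF f] wirtinger_eq[OF g]) (auto simp: differentiable_def)
qed

lemma wirtinger_mult:
  assumes "f differentiable (at z)" "g differentiable (at z)"
  shows "wirtinger c (\<lambda>w. f w * g w) z = wirtinger c f z * g z + f z * wirtinger c g z"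
proof -
  have "((\<lambda>w. f w * g w) has_derivative
      (\<lambda>v. f z * frechet_derivative g (at z) v + frechet_derivative f (at z) v * g z)) (at z)"
    using assms by (intro has_derivative_mult) (simp_all add: frechet_derivative_works)
  from wirtinger_eq[OF this, of c] show ?thesis
    unfolding wirtinger_def[of c f] wirtinger_def[of c g]
    by (simp add: algebra_simps add_divide_distrib)
qed

lemma wirtinger_sum:
  assumes "finite I" "\<And>i. i \<in> I \<Longrightarrow> f i differentiable (at z)"
  shows "wirtinger c (\<lambda>w. \<Sum>i\<in>I. f i w) z = (\<Sum>i\<in>I. wirtinger c (f i) z)"
proof -
  have "((\<lambda>w. \<Sum>i\<in>I. f i w) has_derivative (\<lambda>v. \<Sum>i\<in>I. frechet_derivative (f i) (at z) v)) (at z)"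
    using assms by (intro has_derivative_sum) (simp add: frechet_derivative_works)
  from wirtinger_eq[OF this, of c] show ?thesis
    unfolding wirtinger_def[of c "f _"]
    by (simp add: sum_distrib_left sum.distrib sum_divide_distrib add_divide_distrib)
qed

lemma wirtinger_diff:
  assumes "f differentiable (at z)" "g differentiable (at z)"
  shows "wirtinger c (\<lambda>w. f w - g w) z = wirtinger c f z - wirtinger c g z"
proof -
  have "((\<lambda>w. f w - g w) has_derivative
      (\<lambda>v. frechet_derivative f (at z) v - frechet_derivative g (at z) v)) (at z)"
    using assms by (intro has_derivative_diff) (simp_all add: frechet_derivative_works)
  from wirtinger_eq[OF this, of c] show ?thesis
    unfolding wirtinger_def[of c f] wirtinger_def[of c g]
    by (simp add: algebra_simps diff_divide_distrib add_divide_distrib)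
qed

lemma wirtinger_cnj:
  assumes "f differentiable (at z)"
  shows "wirtinger c (\<lambda>w. cnj (f w)) z = cnj (wirtinger (cnj c) f z)"
proof -
  have "((\<lambda>w. cnj (f w)) has_derivative (\<lambda>v. cnj (frechet_derivative f (at z) v))) (at z)"
    using assms by (intro has_derivative_cnj) (simp add: frechet_derivative_works)
  from wirtinger_eq[OF this, of c] show ?thesis by (simp add: wirtinger_def)
qed

text \<open>The Cauchy-Riemann equation says that the real derivative sends \<open>\<i>\<close> to
  \<open>\<i>\<close> times its value at 1; a real-linear map with this property is multiplication
  by a complex number.\<close>

lemma holomorphic_if_d_zbar_zero:
  assumes "f differentiable (at z)" "d_zbar f z = 0"
  shows "f field_differentiable (at z)"
proof -
  let ?D = "frechet_derivative f (at z)"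
  have D: "(f has_derivative ?D) (at z)" using assms(1) by (simp add: frechet_derivative_works)
  then interpret D: bounded_linear ?D by (rule has_derivative_bounded_linear)
  have "?D 1 + \<i> * ?D \<i> = 0" using assms(2) by (simp add: d_zbar_def)
  then have "\<i> * (?D 1 + \<i> * ?D \<i>) = 0" by simp
  then have i: "?D \<i> = \<i> * ?D 1" by (simp add: algebra_simps)
  have "?D v = ?D 1 * v" for v
  proof -
    have "v = Re v *\<^sub>R 1 + Im v *\<^sub>R \<i>" by (simp add: complex_eq_iff)
    then have "?D v = Re v *\<^sub>R ?D 1 + Im v *\<^sub>R ?D \<i>" by (metis D.add D.scaleR)
    then show ?thesis by (simp add: i complex_eq_iff algebra_simps)
  qed
  then have "?D = (*) (?D 1)" by (rule ext)
  with D have "(f has_field_derivative ?D 1) (at z)" by (simp add: has_field_derivative_def)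
  then show ?thesis by (auto simp: field_differentiable_def)
qed

text \<open>The imaginary part is constant near the point, so the derivative takes real values and
  is determined by \<open>d_z f\<close>. The gradient of a real function is thereby stored in one
  complex function, whose \<open>d_zbar\<close> is a quarter of the Laplacian.\<close>

lemma has_derivative_of_real_valued:
  assumes "f differentiable (at z)" "open U" "z \<in> U" "\<And>w. w \<in> U \<Longrightarrow> Im (f w) = 0"
  shows "((\<lambda>w. Re (f w)) has_derivative (\<lambda>v. 2 * Re (d_z f z * v))) (at z)"
proof -
  let ?D = "frechet_derivative f (at z)"
  have D: "(f has_derivative ?D) (at z)" using assms(1) by (simp add: frechet_derivative_works)
  then interpret D: bounded_linear ?D by (rule has_derivative_bounded_linear)
  have "((\<lambda>w. Im (f w)) has_derivative (\<lambda>v. Im (?D v))) (at z)"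
    by (intro has_derivative_Im D)
  then have "((\<lambda>w. 0) has_derivative (\<lambda>v. Im (?D v))) (at z)"
    using has_derivative_transform_within_open[OF _ assms(2,3)] assms(4) by metis
  then have im: "Im (?D v) = 0" for v
    using has_derivative_unique[of "\<lambda>w. 0::real" "\<lambda>v. Im (?D v)" z "\<lambda>v. 0"] by (metis has_derivative_const)
  have "2 * Re (d_z f z * v) = Re (?D v)" for v
  proof -
    have "v = Re v *\<^sub>R 1 + Im v *\<^sub>R \<i>" by (simp add: complex_eq_iff)
    then have "?D v = Re v *\<^sub>R ?D 1 + Im v *\<^sub>R ?D \<i>" by (metis D.add D.scaleR)
    then have "Re (?D v) = Re v * Re (?D 1) + Im v * Re (?D \<i>)" by simp
    then show ?thesis using im[of 1] im[of \<i>]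
      by (simp add: d_z_def algebra_simps)
  qed
  moreover have "((\<lambda>w. Re (f w)) has_derivative (\<lambda>v. Re (?D v))) (at z)"
    by (intro has_derivative_Re D)
  ultimately show ?thesis by simp
qed

section \<open>Differentiable matrix-valued functions\<close>

definition differentiable_mat_on :: "nat \<Rightarrow> (complex \<Rightarrow> complex mat) \<Rightarrow> complex set \<Rightarrow> bool" where
  "differentiable_mat_on n M U \<longleftrightarrow> open U \<and> (\<forall>z\<in>U. M z \<in> carrier_mat n n \<and>
     (\<forall>a<n. \<forall>b<n. (\<lambda>w. M w $$ (a, b)) differentiable (at z)))"

lemma differentiable_mat_onD:
  assumes "differentiable_mat_on n M U"
  shows "open U" "\<And>z. z \<in> U \<Longrightarrow> M z \<in> carrier_mat n n"
    "\<And>z a b. z \<in> U \<Longrightarrow> a < n \<Longrightarrow> b < n \<Longrightarrow> (\<lambda>w. M w $$ (a, b)) differentiable (at z)"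
  using assms by (auto simp: differentiable_mat_on_def)

lemma mat_wirtinger_carrier [simp]: "mat_wirtinger c n M z \<in> carrier_mat n n"
  by (simp add: mat_wirtinger_def)

lemma mat_wirtinger_index [simp]:
  "a < n \<Longrightarrow> b < n \<Longrightarrow> mat_wirtinger c n M z $$ (a, b) = wirtinger c (\<lambda>w. M w $$ (a, b)) z"
  by (simp add: mat_wirtinger_def)

lemma mat_wirtinger_dim [simp]:
  "dim_row (mat_wirtinger c n M z) = n" "dim_col (mat_wirtinger c n M z) = n"
  by (simp_all add: mat_wirtinger_def)

lemma mat_wirtinger_cong:
  assumes M: "differentiable_mat_on n M U" and z: "z \<in> U" and eq: "\<And>w. w \<in> U \<Longrightarrow> M w = N w"
  shows "mat_wirtinger c n M z = mat_wirtinger c n N z"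
proof (rule eq_matI)
  fix a b assume "a < dim_row (mat_wirtinger c n N z)" "b < dim_col (mat_wirtinger c n N z)"
  then have ab: "a < n" "b < n" by auto
  have "wirtinger c (\<lambda>w. M w $$ (a, b)) z = wirtinger c (\<lambda>w. N w $$ (a, b)) z"
    by (rule wirtinger_cong(1)[OF differentiable_mat_onD(1)[OF M] z _ differentiable_mat_onD(3)[OF M z ab]])
      (simp add: eq)
  then show "mat_wirtinger c n M z $$ (a, b) = mat_wirtinger c n N z $$ (a, b)"
    using ab by simp
qed auto

lemma differentiable_mat_on_cong:
  assumes M: "differentiable_mat_on n M U" and eq: "\<And>w. w \<in> U \<Longrightarrow> M w = N w"
  shows "differentiable_mat_on n N U"
  unfolding differentiable_mat_on_def
proof (intro conjI ballI allI impI)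
  fix z a b assume *: "z \<in> U" "a < n" "b < n"
  show "(\<lambda>w. N w $$ (a, b)) differentiable (at z)"
    by (rule wirtinger_cong(2)[OF differentiable_mat_onD(1)[OF M] *(1) _ differentiable_mat_onD(3)[OF M *]])
      (simp add: eq)
qed (use differentiable_mat_onD[OF M] eq in force)+

lemma
  assumes M: "differentiable_mat_on n M U" and N: "differentiable_mat_on n N U"
  shows differentiable_mat_on_mult: "differentiable_mat_on n (\<lambda>z. M z * N z) U"
    and mat_wirtinger_mult: "z \<in> U \<Longrightarrow> mat_wirtinger c n (\<lambda>z. M z * N z) z =
      mat_wirtinger c n M z * N z + M z * mat_wirtinger c n N z"
proof -
  note Md = differentiable_mat_onD[OF M] and Nd = differentiable_mat_onD[OF N]
  let ?S = "\<lambda>a b w. \<Sum>k<n. M w $$ (a, k) * N w $$ (k, b)"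
  have S: "?S a b w = (M w * N w) $$ (a, b)" if "a < n" "b < n" "w \<in> U" for a b w
    using index_mult_mat_sum[OF Md(2) Nd(2)] that by simp
  have Sd: "?S a b differentiable (at z)" if "a < n" "b < n" "z \<in> U" for a b z
    using that Md Nd by (intro differentiable_sum differentiable_mult) auto
  note SU = wirtinger_cong[OF Md(1) _ S Sd]
  show "differentiable_mat_on n (\<lambda>z. M z * N z) U"
    unfolding differentiable_mat_on_def
    using Md Nd SU(2) by (auto intro: square_mult_carrier)
  assume z: "z \<in> U"
  show "mat_wirtinger c n (\<lambda>z. M z * N z) z =
      mat_wirtinger c n M z * N z + M z * mat_wirtinger c n N z"
  proof (rule eq_matI)
    fix a b assume "a < dim_row (mat_wirtinger c n M z * N z + M z * mat_wirtinger c n N z)"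
      "b < dim_col (mat_wirtinger c n M z * N z + M z * mat_wirtinger c n N z)"
    then have ab: "a < n" "b < n" using Md(2)[OF z] Nd(2)[OF z] by auto
    have "wirtinger c (?S a b) z = (\<Sum>k<n. wirtinger c (\<lambda>w. M w $$ (a, k) * N w $$ (k, b)) z)"
      using ab z Md Nd by (intro wirtinger_sum differentiable_mult) auto
    also have "\<dots> = (\<Sum>k<n. wirtinger c (\<lambda>w. M w $$ (a, k)) z * N z $$ (k, b)
        + M z $$ (a, k) * wirtinger c (\<lambda>w. N w $$ (k, b)) z)"
      using ab z Md Nd by (intro sum.cong refl wirtinger_mult) auto
    also have "\<dots> = (mat_wirtinger c n M z * N z) $$ (a, b) + (M z * mat_wirtinger c n N z) $$ (a, b)"
      using index_mult_mat_sum[OF mat_wirtinger_carrier Nd(2)[OF z] ab, of c M z]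
        index_mult_mat_sum[OF Md(2)[OF z] mat_wirtinger_carrier ab, of c N z] ab
      by (simp add: sum.distrib del: index_mult_mat(1))
    finally show "mat_wirtinger c n (\<lambda>z. M z * N z) z $$ (a, b) =
       (mat_wirtinger c n M z * N z + M z * mat_wirtinger c n N z) $$ (a, b)"
      using SU(1)[OF z ab _ ab z, of c] ab Md(2)[OF z] Nd(2)[OF z] by simp
  qed (use Md(2)[OF z] Nd(2)[OF z] in auto)
qed

lemma
  assumes M: "differentiable_mat_on n M U" and N: "differentiable_mat_on n N U"
  shows differentiable_mat_on_diff: "differentiable_mat_on n (\<lambda>z. M z - N z) U"
    and mat_wirtinger_diff: "z \<in> U \<Longrightarrow> mat_wirtinger c n (\<lambda>z. M z - N z) z =
      mat_wirtinger c n M z - mat_wirtinger c n N z"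
proof -
  note Md = differentiable_mat_onD[OF M] and Nd = differentiable_mat_onD[OF N]
  let ?S = "\<lambda>a b w. M w $$ (a, b) - N w $$ (a, b)"
  have S: "?S a b w = (M w - N w) $$ (a, b)" if "a < n" "b < n" "w \<in> U" for a b w
    using Md(2)[of w] Nd(2)[of w] that by auto
  have Sd: "?S a b differentiable (at z)" if "a < n" "b < n" "z \<in> U" for a b z
    using that Md Nd by (intro differentiable_diff) auto
  note SU = wirtinger_cong[OF Md(1) _ S Sd]
  show "differentiable_mat_on n (\<lambda>z. M z - N z) U"
    unfolding differentiable_mat_on_def
    using Md Nd SU(2) by (auto intro!: minus_carrier_mat)
  assume z: "z \<in> U"
  show "mat_wirtinger c n (\<lambda>z. M z - N z) z = mat_wirtinger c n M z - mat_wirtinger c n N z"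
    using SU(1)[OF z, of _ _ c] wirtinger_diff[OF Md(3) Nd(3)] z
    by (intro eq_matI) auto
qed

lemma mat_wirtinger_adjoint:
  assumes M: "differentiable_mat_on n M U" and z: "z \<in> U"
  shows "mat_wirtinger c n (\<lambda>z. mat_adjoint (M z)) z = mat_adjoint (mat_wirtinger (cnj c) n M z)"
proof -
  note Md = differentiable_mat_onD[OF M]
  show ?thesis
  proof (rule eq_matI)
    fix a b assume "a < dim_row (mat_adjoint (mat_wirtinger (cnj c) n M z))"
      "b < dim_col (mat_adjoint (mat_wirtinger (cnj c) n M z))"
    then have ab: "a < n" "b < n" by auto
    have "wirtinger c (\<lambda>w. cnj (M w $$ (b, a))) z = wirtinger c (\<lambda>w. mat_adjoint (M w) $$ (a, b)) z"
    proof (rule wirtinger_cong(1)[OF Md(1) z])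
      show "(\<lambda>w. cnj (M w $$ (b, a))) differentiable (at z)"
        using Md(3)[OF z ab(2,1)] has_derivative_cnj unfolding differentiable_def by blast
      show "cnj (M w $$ (b, a)) = mat_adjoint (M w) $$ (a, b)" if "w \<in> U" for w
        using Md(2)[OF that] ab by simp
    qed
    then show "mat_wirtinger c n (\<lambda>z. mat_adjoint (M z)) z $$ (a, b) =
        mat_adjoint (mat_wirtinger (cnj c) n M z) $$ (a, b)"
      using ab wirtinger_cnj[OF Md(3)[OF z ab(2,1)], of c] by simp
  qed auto
qed

lemma
  assumes M: "differentiable_mat_on n M U" and z: "z \<in> U"
  shows differentiable_mtrace: "(\<lambda>w. mtrace (M w)) differentiable (at z)"
    and wirtinger_mtrace: "wirtinger c (\<lambda>w. mtrace (M w)) z = mtrace (mat_wirtinger c n M z)"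
proof -
  note Md = differentiable_mat_onD[OF M]
  have eq: "(\<Sum>a<n. M w $$ (a, a)) = mtrace (M w)" if "w \<in> U" for w
    using Md(2)[OF that] by (simp add: mtrace_def)
  have d: "(\<lambda>w. \<Sum>a<n. M w $$ (a, a)) differentiable (at z)"
    using Md(3)[OF z] by (intro differentiable_sum) auto
  note * = wirtinger_cong[OF Md(1) z eq d]
  show "(\<lambda>w. mtrace (M w)) differentiable (at z)" by (rule *(2))
  have "wirtinger c (\<lambda>w. mtrace (M w)) z = wirtinger c (\<lambda>w. \<Sum>a<n. M w $$ (a, a)) z"
    using *(1) by simp
  also have "\<dots> = mtrace (mat_wirtinger c n M z)"
    using Md(3)[OF z] by (subst wirtinger_sum) (auto simp: mtrace_def)
  finally show "wirtinger c (\<lambda>w. mtrace (M w)) z = mtrace (mat_wirtinger c n M z)" .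
qed

lemma differentiable_prod:
  fixes f :: "'i \<Rightarrow> complex \<Rightarrow> complex"
  assumes "\<And>i. i \<in> I \<Longrightarrow> f i differentiable (at z)"
  shows "(\<lambda>w. \<Prod>i\<in>I. f i w) differentiable (at z)"
  using assms by (induction I rule: infinite_finite_induct) (auto intro!: differentiable_mult)

lemma differentiable_det:
  assumes "differentiable_mat_on n M U" "z \<in> U"
  shows "(\<lambda>w. Determinant.det (M w)) differentiable (at z)"
proof (rule wirtinger_cong(2)[OF differentiable_mat_onD(1)[OF assms(1)] assms(2)])
  note Md = differentiable_mat_onD[OF assms(1)]
  show "(\<Sum>p\<in>{p. p permutes {0..<n}}. signof p * (\<Prod>i=0..<n. M w $$ (i, p i))) = Determinant.det (M w)"
    if "w \<in> U" for w
    using det_def'[OF Md(2)[OF that]] by simp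
  show "(\<lambda>w. \<Sum>p\<in>{p. p permutes {0..<n}}. signof p * (\<Prod>i=0..<n. M w $$ (i, p i))) differentiable (at z)"
    by (intro differentiable_sum differentiable_mult differentiable_prod differentiable_const
          ballI finite_permutations finite_atLeastLessThan Md(3)[OF assms(2)])
      (auto dest: permutes_in_image)
qed

text \<open>By Cramer's rule every entry is a cofactor divided by the determinant, and a cofactor is
  up to sign the determinant of a differentiable submatrix.\<close>

lemma differentiable_mat_on_inverse:
  assumes M: "differentiable_mat_on n M U" and det: "\<And>z. z \<in> U \<Longrightarrow> Determinant.det (M z) \<noteq> 0"
  shows "differentiable_mat_on n (\<lambda>z. mat_inv (M z)) U"
proof (rule differentiable_mat_on_cong)
  note Md = differentiable_mat_onD[OF M]
  show "(1 / Determinant.det (M z)) \<cdot>\<^sub>m adj_mat (M z) = mat_inv (M z)" if "z \<in> U" for z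
    using mat_inv_adj_mat[OF Md(2) det] that by simp
  have cof: "(\<lambda>w. cofactor (M w) b a) differentiable (at z)" if z: "z \<in> U" and ab: "a < n" "b < n" for z a b
  proof -
    have "differentiable_mat_on (n - 1) (\<lambda>w. mat_delete (M w) b a) U"
      unfolding differentiable_mat_on_def
    proof (intro conjI ballI allI impI)
      fix y i j assume y: "y \<in> U" and ij: "i < n - 1" "j < n - 1"
      show "(\<lambda>w. mat_delete (M w) b a $$ (i, j)) differentiable (at y)"
      proof (rule wirtinger_cong(2)[OF Md(1) y])
        show "M w $$ (if i < b then i else Suc i, if j < a then j else Suc j)
            = mat_delete (M w) b a $$ (i, j)" if "w \<in> U" for w
          using Md(2)[OF that] ij by (simp add: mat_delete_def)
        show "(\<lambda>w. M w $$ (if i < b then i else Suc i, if j < a then j else Suc j)) differentiable (at y)"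
          using ij by (intro Md(3)[OF y]) auto
      qed
    next
      fix y assume "y \<in> U"
      show "mat_delete (M y) b a \<in> carrier_mat (n - 1) (n - 1)"
        using mat_delete_carrier[OF Md(2)[OF \<open>y \<in> U\<close>]] .
    qed (rule Md(1))
    then show ?thesis
      unfolding cofactor_def using z
      by (intro differentiable_mult differentiable_const differentiable_det)
  qed
  show "differentiable_mat_on n (\<lambda>z. (1 / Determinant.det (M z)) \<cdot>\<^sub>m adj_mat (M z)) U"
    unfolding differentiable_mat_on_def
  proof (intro conjI ballI allI impI)
    fix z a b assume z: "z \<in> U" and ab: "a < n" "b < n"
    show "(\<lambda>w. ((1 / Determinant.det (M w)) \<cdot>\<^sub>m adj_mat (M w)) $$ (a, b)) differentiable (at z)"
    proof (rule wirtinger_cong(2)[OF Md(1) z])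
      show "inverse (Determinant.det (M w)) * cofactor (M w) b a
          = ((1 / Determinant.det (M w)) \<cdot>\<^sub>m adj_mat (M w)) $$ (a, b)" if "w \<in> U" for w
        using Md(2)[OF that] ab by (simp add: adj_mat_def field_simps)
      show "(\<lambda>w. inverse (Determinant.det (M w)) * cofactor (M w) b a) differentiable (at z)"
        using cof[OF z ab] det[OF z] differentiable_det[OF M z]
        by (intro differentiable_mult differentiable_inverse)
    qed
  next
    fix z assume "z \<in> U"
    then show "(1 / Determinant.det (M z)) \<cdot>\<^sub>m adj_mat (M z) \<in> carrier_mat n n"
      using adj_mat(1)[OF Md(2)] by simp
  qed (rule Md(1))
qed

lemma smooth_on_mat:
  assumes "open U" "\<And>z. z \<in> U \<Longrightarrow> M z \<in> carrier_mat n n"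
    and "\<And>a b. a < n \<Longrightarrow> b < n \<Longrightarrow> smooth_on (\<lambda>z. M z $$ (a, b)) U"
  shows "differentiable_mat_on n M U" "differentiable_mat_on n (mat_wirtinger c n M) U"
proof -
  \<comment> \<open>Two derivatives of the metric occur below: one in the Chern connection, one in
    its curvature.\<close>
  have C: "Ck_on (Suc (Suc 0)) (\<lambda>z. M z $$ (a, b)) U" if "a < n" "b < n" for a b
    using assms(3)[OF that] unfolding smooth_on_def by blast
  then show "differentiable_mat_on n M U"
    using assms(1,2) by (auto simp: differentiable_mat_on_def)
  have "(\<lambda>z. mat_wirtinger c n M z $$ (a, b)) differentiable (at z)"
    if ab: "a < n" "b < n" and z: "z \<in> U" for a b z
  proof -
    have "(\<lambda>w. (frechet_derivative (\<lambda>z. M z $$ (a, b)) (at w) 1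
        + c * frechet_derivative (\<lambda>z. M z $$ (a, b)) (at w) \<i>) * (1 / 2)) differentiable (at z)"
      using C[OF ab] z by (intro differentiable_add differentiable_mult differentiable_const) auto
    then show ?thesis using ab by (simp add: wirtinger_def)
  qed
  then show "differentiable_mat_on n (mat_wirtinger c n M) U"
    using assms(1) by (auto simp: differentiable_mat_on_def)
qed

section \<open>The strong maximum principle\<close>

text \<open>If \<open>D\<close> were positive, \<open>g'\<close> would be positive just to the right
  of its zero at 0, and the mean value theorem would make \<open>g\<close> exceed \<open>g 0\<close>
  there. Only differentiability of \<open>g'\<close> at the single point 0 enters.\<close>

lemma second_derivative_at_local_max:
  fixes g :: "real \<Rightarrow> real"
  assumes e: "e > 0" and g: "\<And>t. \<bar>t\<bar> < e \<Longrightarrow> (g has_real_derivative g' t) (at t)"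
    and g': "(g' has_real_derivative D) (at 0)"
    and max: "\<And>t. \<bar>t\<bar> < e \<Longrightarrow> g t \<le> g 0"
  shows "D \<le> 0"
proof (rule ccontr)
  assume "\<not> D \<le> 0"
  have "g' 0 = 0"
    using DERIV_local_max[OF g[of 0] e] max e by auto
  moreover obtain d where d: "d > 0" "\<And>h. 0 < h \<Longrightarrow> h < d \<Longrightarrow> g' 0 < g' h"
    using DERIV_pos_inc_right[OF g'] \<open>\<not> D \<le> 0\<close> by auto
  define t where "t = min d e / 2"
  have t: "t > 0" "t < d" "t < e" using d e by (auto simp: t_def)
  have "\<exists>s. 0 < s \<and> s < t \<and> g t - g 0 = (t - 0) * g' s"
    using t by (intro MVT2 g) auto
  then obtain s where s: "0 < s" "s < t" "g t - g 0 = t * g' s" by auto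
  ultimately have "g' s > 0" using d(2)[of s] t by auto
  then have "t * g' s > 0" using t(1) by simp
  with s(3) max[of t] t show False by auto
qed

text \<open>The derivative of \<open>u\<close> says that \<open>f\<close> is \<open>d_z u\<close>,
  so four times \<open>Re (d_zbar f z)\<close> is the Laplacian of \<open>u\<close>. It is the sum
  of the second derivatives along the directions 1 and \<open>\<i>\<close>, neither of which is
  positive at a maximum.\<close>

lemma d_zbar_nonpos_at_local_max:
  assumes r: "r > 0"
    and u: "\<And>w. w \<in> ball z r \<Longrightarrow> (u has_derivative (\<lambda>v. 2 * Re (f w * v))) (at w)"
    and f: "f differentiable (at z)"
    and max: "\<And>w. w \<in> ball z r \<Longrightarrow> u w \<le> u z"
  shows "Re (d_zbar f z) \<le> 0"
proof -
  let ?D = "frechet_derivative f (at z)"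
  have D: "(f has_derivative ?D) (at z)" using f by (simp add: frechet_derivative_works)
  then interpret D: bounded_linear ?D by (rule has_derivative_bounded_linear)
  have "2 * Re (?D v * v) \<le> 0" if v: "norm v = 1" for v
  proof (rule second_derivative_at_local_max[OF r])
    have line: "((\<lambda>t. z + of_real t * v) has_derivative (\<lambda>h. of_real h * v)) (at t)" for t
      by (auto intro!: derivative_eq_intros)
    have b: "z + of_real t * v \<in> ball z r" if "\<bar>t\<bar> < r" for t
      using that v by (simp add: dist_norm norm_mult)
    show "((\<lambda>t. u (z + of_real t * v)) has_real_derivative 2 * Re (f (z + of_real t * v) * v)) (at t)"
      if "\<bar>t\<bar> < r" for t
    proof -
      have "(\<lambda>h. 2 * Re (f (z + of_real t * v) * (of_real h * v))) =
          (*) (2 * Re (f (z + of_real t * v) * v))"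
        by (rule ext) (simp add: algebra_simps)
      then show ?thesis
        using has_derivative_compose[OF line u[OF b[OF that]]] unfolding has_field_derivative_def by simp
    qed
    have "((\<lambda>t. f (z + of_real t * v)) has_derivative (\<lambda>h. ?D (of_real h * v))) (at 0)"
      using has_derivative_compose[OF line, of f ?D 0] D by simp
    then have "((\<lambda>t. 2 * Re (f (z + of_real t * v) * v)) has_derivative
        (\<lambda>h. 2 * Re (?D (of_real h * v) * v))) (at 0)"
      by (intro derivative_eq_intros | assumption | simp)+
    moreover have "?D (of_real h * v) = of_real h * ?D v" for h
      using D.scaleR[of h v] by (simp add: scaleR_conv_of_real)
    moreover have "(\<lambda>h. 2 * Re (of_real h * ?D v * v)) = (*) (2 * Re (?D v * v))"
      by (rule ext) (simp add: algebra_simps)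
    ultimately show "((\<lambda>t. 2 * Re (f (z + of_real t * v) * v)) has_real_derivative
        2 * Re (?D v * v)) (at 0)"
      unfolding has_field_derivative_def by simp
    show "u (z + of_real t * v) \<le> u (z + of_real 0 * v)" if "\<bar>t\<bar> < r" for t
      using max[OF b[OF that]] by simp
  qed
  from this[of 1] this[of \<i>] show ?thesis
    by (simp add: d_zbar_def mult.commute)
qed

text \<open>
  The barrier \<open>x + 2 x\<^sup>2 - y\<^sup>2\<close> is strictly subharmonic, and near the origin it is negative outside
  the disc \<open>ball 1 1\<close>. Adding a small multiple of it to \<open>u\<close> moves the maximum off the boundary
  of a small disc.
\<close>

lemma no_touching_maximum:
  assumes u: "\<And>w. w \<in> cball 0 (1/16) \<Longrightarrow> (u has_derivative (\<lambda>v. 2 * Re (f w * v))) (at w)"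
    and f: "\<And>w. w \<in> cball 0 (1/16) \<Longrightarrow> f differentiable (at w)"
    and sub: "\<And>w. w \<in> cball 0 (1/16) \<Longrightarrow> Re (d_zbar f w) \<ge> 0"
    and le: "\<And>w. w \<in> cball 0 (1/16) \<Longrightarrow> u w \<le> u 0"
    and less: "\<And>w. w \<in> cball 0 (1/16) \<Longrightarrow> w \<in> ball 1 1 \<Longrightarrow> u w < u 0"
  shows False
proof -
  let ?K = "cball (0::complex) (1/16)"
  define b where "b z = Re z + 2 * (Re z)\<^sup>2 - (Im z)\<^sup>2" for z
  \<comment> \<open>This is \<open>d_z b\<close>. Its \<open>d_zbar\<close> is 1/2, which makes the
    barrier strictly subharmonic.\<close>
  define \<beta> where "\<beta> z = 1/2 + cnj z / 2 + 3/2 * z" for z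
  have b: "(b has_derivative (\<lambda>v. 2 * Re (\<beta> z * v))) (at z)" for z
    unfolding b_def \<beta>_def
    by (rule derivative_eq_intros refl | simp)+
      (auto simp: fun_eq_iff algebra_simps power2_eq_square)
  have bc: "continuous_on A b" for A
    by (intro continuous_at_imp_continuous_on ballI has_derivative_continuous[OF b])
  have uc: "continuous_on ?K u"
    by (intro continuous_at_imp_continuous_on ballI has_derivative_continuous[OF u])
  \<comment> \<open>With z = x + iy, b z \<ge> 0 means y^2 \<le> x + 2 x^2, so (x - 1)^2 + y^2 \<le>
    1 - x + 3 x^2. The radius 1/16 is small enough to force x > 0 and 3 x^2 < x.\<close>
  have inside: "z \<in> ball 1 1" if z: "norm z = 1/16" and "b z \<ge> 0" for z
  proof -
    let ?x = "Re z" and ?y = "Im z"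
    have eq: "?x\<^sup>2 + ?y\<^sup>2 = (1/16)\<^sup>2" using cmod_power2[of z] z by simp
    have small: "\<bar>?x\<bar> \<le> 1/16" using z abs_Re_le_cmod[of z] by simp
    have bz: "?y\<^sup>2 \<le> ?x * (1 + 2 * ?x)" using that(2) by (simp add: b_def power2_eq_square algebra_simps)
    have x: "?x > 0"
    proof (rule ccontr)
      assume "\<not> ?x > 0"
      then have "?x * (1 + 2 * ?x) \<le> ?x * (1/2)"
        using small by (intro mult_left_mono_neg) auto
      then have "?y\<^sup>2 \<le> 0" "?x \<ge> 0" using bz \<open>\<not> ?x > 0\<close> zero_le_power2[of ?y] by linarith+
      then show False using eq \<open>\<not> ?x > 0\<close> by (simp add: power2_eq_square)
    qed
    have "?x * ?x \<le> ?x * (1/16)" using small x by (intro mult_left_mono) auto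
    moreover have "(?x - 1)\<^sup>2 = ?x * ?x - 2 * ?x + 1" "?x * (1 + 2 * ?x) = ?x + 2 * (?x * ?x)"
      by (simp_all add: power2_eq_square algebra_simps)
    ultimately have "(?x - 1)\<^sup>2 + ?y\<^sup>2 < 1" using bz x by linarith
    then have "(norm (z - 1))\<^sup>2 < 1" by (simp add: cmod_power2)
    then show ?thesis by (simp add: abs_square_less_1 dist_norm norm_minus_commute)
  qed
  \<comment> \<open>On the boundary circle \<open>T\<close> is the part where the barrier could
    raise \<open>u\<close>. It is compact and lies in \<open>ball 1 1\<close>, so there
    \<open>u\<close> stays below \<open>u 0\<close> by a uniform gap \<open>d\<close>.\<close>
  define T where "T = {z \<in> sphere 0 (1/16). b z \<ge> 0}"
  have "\<exists>d>0. \<forall>z\<in>T. u z + d \<le> u 0"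
  proof (cases "T = {}")
    case True
    then show ?thesis by (auto intro: exI[of _ 1])
  next
    case False
    have "closed {z. b z \<ge> 0}"
      using bc by (intro closed_Collect_le continuous_on_const)
    then have "compact T"
      unfolding T_def Collect_conj_eq Collect_mem_eq by (intro compact_Int_closed compact_sphere)
    moreover have "continuous_on T u"
      by (rule continuous_on_subset[OF uc]) (auto simp: T_def)
    ultimately obtain m where m: "m \<in> T" "\<And>z. z \<in> T \<Longrightarrow> u z \<le> u m"
      using continuous_attains_sup[of T u] False by blast
    have "u m < u 0" using m(1) inside less by (auto simp: T_def)
    then show ?thesis using m(2) by (intro exI[of _ "u 0 - u m"]) auto
  qed
  then obtain d where d: "d > 0" "\<And>z. z \<in> T \<Longrightarrow> u z + d \<le> u 0" by blast
  \<comment> \<open>Since \<open>b\<close> is at most 3 on the disc, the perturbation is at most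
    3d/4 and cannot close the gap \<open>d\<close> on \<open>T\<close>; on the rest of the circle it
    is negative. As \<open>w 0 = u 0\<close>, the maximum of \<open>w\<close> is interior.\<close>
  define w where "w z = u z + d / 4 * b z" for z
  have wc: "continuous_on ?K w" unfolding w_def by (intro continuous_intros uc bc)
  obtain m where m: "m \<in> ?K" "\<And>z. z \<in> ?K \<Longrightarrow> w z \<le> w m"
    using continuous_attains_sup[OF _ _ wc] by auto
  have "w 0 = u 0" by (simp add: w_def b_def)
  then have wm: "w m \<ge> u 0" using m(2)[of 0] by simp
  have bbound: "b z \<le> 3" if "z \<in> ?K" for z
  proof -
    have "\<bar>Re z\<bar> \<le> 1" using that abs_Re_le_cmod[of z] by simp
    then have "(Re z)\<^sup>2 \<le> 1" by (simp add: abs_square_le_1)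
    then show ?thesis using \<open>\<bar>Re z\<bar> \<le> 1\<close> zero_le_power2[of "Im z"] unfolding b_def by linarith
  qed
  have "m \<notin> sphere 0 (1/16)"
  proof
    assume s: "m \<in> sphere 0 (1/16)"
    show False
    proof (cases "m \<in> T")
      case True
      have "d / 4 * b m \<le> d / 4 * 3" using bbound[OF m(1)] d(1) by (intro mult_left_mono) auto
      then show False using d(2)[OF True] d(1) wm unfolding w_def by linarith
    next
      case False
      then have "b m < 0" using s by (simp add: T_def)
      then have "d / 4 * b m < 0" using d(1) by (simp add: mult_less_0_iff)
      then show False using le[OF m(1)] wm unfolding w_def by linarith
    qed
  qed
  with m(1) have mb: "m \<in> ball 0 (1/16)" by (auto simp: less_le)
  then obtain r where r: "r > 0" "ball m r \<subseteq> ball 0 (1/16)"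
    using open_contains_ball[of "ball (0::complex) (1/16)"] open_ball by blast
  have sub': "ball m r \<subseteq> ?K" using r(2) ball_subset_cball by blast
  have \<beta>D: "(\<beta> has_derivative (\<lambda>v. cnj v / 2 + 3/2 * v)) (at m)"
    unfolding \<beta>_def by (rule derivative_eq_intros refl | simp)+
  then have \<beta>d: "\<beta> differentiable (at m)" by (auto simp: differentiable_def)
  have "Re (d_zbar (\<lambda>z. f z + d / 4 * \<beta> z) m) \<le> 0"
  proof (rule d_zbar_nonpos_at_local_max[OF r(1)])
    show "(w has_derivative (\<lambda>v. 2 * Re ((f z + d / 4 * \<beta> z) * v))) (at z)" if "z \<in> ball m r" for z
    proof -
      have "(u has_derivative (\<lambda>v. 2 * Re (f z * v))) (at z)" using u sub' that by blast
      then have "(w has_derivative (\<lambda>v. 2 * Re (f z * v) + d / 4 * (2 * Re (\<beta> z * v)))) (at z)"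
        unfolding w_def by (intro has_derivative_add has_derivative_mult_right b)
      moreover have "2 * Re (f z * v) + d / 4 * (2 * Re (\<beta> z * v)) = 2 * Re ((f z + d / 4 * \<beta> z) * v)" for v
        by (simp add: field_simps)
      ultimately show ?thesis by (simp only:)
    qed
    show "(\<lambda>z. f z + d / 4 * \<beta> z) differentiable (at m)"
      using f[OF m(1)] \<beta>d by (intro differentiable_add differentiable_mult differentiable_const)
    show "w z \<le> w m" if "z \<in> ball m r" for z using m(2) sub' that by blast
  qed
  moreover have "d_zbar (\<lambda>z. f z + d / 4 * \<beta> z) m = d_zbar f m + d / 8"
  proof -
    have "((\<lambda>z. f z + d / 4 * \<beta> z) has_derivative
        (\<lambda>v. frechet_derivative f (at m) v + d / 4 * (cnj v / 2 + 3/2 * v))) (at m)"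
      using f[OF m(1)]
      by (intro has_derivative_add has_derivative_mult_right \<beta>D) (simp add: frechet_derivative_works)
    from wirtinger_eq[OF this, of \<i>] show ?thesis
      by (simp add: d_z_wirtinger wirtinger_def[of _ f] algebra_simps add_divide_distrib)
  qed
  ultimately show False using sub[OF m(1)] d(1) by simp
qed

text \<open>Hopf's argument: if \<open>u c\<close> differs from the maximum for some
  \<open>c\<close> near \<open>p\<close>, take the point \<open>y\<close> nearest to
  \<open>c\<close> where the maximum is attained. The open disc about \<open>c\<close> through
  \<open>y\<close> avoids the maximum set, and an affine map brings this configuration to the one
  excluded by \<open>no_touching_maximum\<close>.\<close>

lemma strong_maximum_principle:
  assumes "open U" "p \<in> U"
    and u: "\<And>w. w \<in> U \<Longrightarrow> (u has_derivative (\<lambda>v. 2 * Re (f w * v))) (at w)"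
    and f: "\<And>w. w \<in> U \<Longrightarrow> f differentiable (at w)"
    and sub: "\<And>w. w \<in> U \<Longrightarrow> Re (d_zbar f w) \<ge> 0"
    and le: "\<And>w. w \<in> U \<Longrightarrow> u w \<le> u p"
  shows "\<exists>r>0. \<forall>w\<in>ball p r. u w = u p"
proof -
  obtain R' where R': "R' > 0" "ball p R' \<subseteq> U" using assms(1,2) open_contains_ball by blast
  define R where "R = R' / 3"
  have R: "R > 0" "ball p (3 * R) \<subseteq> U" using R' by (auto simp: R_def)
  have "u c = u p" if c: "c \<in> ball p R" for c
  proof (rule ccontr)
    assume "u c \<noteq> u p"
    have uc: "continuous_on U u"
      by (intro continuous_at_imp_continuous_on ballI has_derivative_continuous[OF u])
    have cU: "cball p (2 * R) \<subseteq> U" using R by (auto intro!: subsetD[OF R(2)])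
    \<comment> \<open>The radii fit together: \<open>p\<close> lies in \<open>Z\<close> and
      \<open>c\<close> within \<open>R\<close> of \<open>p\<close>, so the nearest point
      \<open>y\<close> is closer to \<open>c\<close> than \<open>R\<close>. The disc about
      \<open>c\<close> through \<open>y\<close> then stays within 2R of \<open>p\<close>, and a
      small disc about \<open>y\<close> within 3R.\<close>
    define Z where "Z = {y \<in> cball p (2 * R). u y = u p}"
    have "closed Z"
      unfolding Z_def
      using continuous_closed_preimage_constant[OF continuous_on_subset[OF uc cU], of "u p"] by simp
    moreover have "bounded Z" by (rule bounded_subset[OF bounded_cball[of p "2 * R"]]) (auto simp: Z_def)
    ultimately have "compact Z" by (simp add: compact_eq_bounded_closed)
    moreover have "p \<in> Z" using R by (simp add: Z_def)
    ultimately obtain y where y: "y \<in> Z" "\<And>x. x \<in> Z \<Longrightarrow> dist c y \<le> dist c x"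
      using continuous_attains_inf[of Z "dist c"] continuous_on_dist[OF continuous_on_const continuous_on_id]
      by blast
    \<comment> \<open>The map sending z to \<open>y + k * z\<close> takes 0 to the touching point
      and \<open>ball 1 1\<close> to the disc about \<open>c\<close> through it.\<close>
    define k where "k = c - y"
    have "c \<noteq> y" using y(1) \<open>u c \<noteq> u p\<close> by (auto simp: Z_def)
    then have k0: "norm k > 0" by (simp add: k_def)
    have nk: "dist c y = norm k" by (simp add: k_def dist_norm)
    have kR: "norm k < R" using y(2)[OF \<open>p \<in> Z\<close>] c by (simp add: nk dist_commute)
    have yp: "dist p y \<le> 2 * R" "u y = u p" using y(1) by (auto simp: Z_def)
    have inU: "y + k * z \<in> U" if "z \<in> cball 0 (1/16)" for z
    proof -
      have "norm (k * z) \<le> norm k * 1"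
        unfolding norm_mult using that by (intro mult_left_mono) auto
      then have "dist p (y + k * z) < 3 * R"
        using yp(1) kR dist_triangle[of p "y + k * z" y] by (simp add: dist_norm)
      then show ?thesis using R(2) by auto
    qed
    show False
    proof (rule no_touching_maximum[of "\<lambda>z. u (y + k * z)" "\<lambda>z. k * f (y + k * z)"])
      fix z :: complex assume z: "z \<in> cball 0 (1/16)"
      note zU = inU[OF z]
      have line: "((\<lambda>z. y + k * z) has_derivative (\<lambda>h. k * h)) (at z)"
        by (auto intro!: derivative_eq_intros)
      show "((\<lambda>z. u (y + k * z)) has_derivative (\<lambda>v. 2 * Re (k * f (y + k * z) * v))) (at z)"
        using has_derivative_compose[OF line u[OF zU]] by (simp add: mult_ac)
      let ?D = "frechet_derivative f (at (y + k * z))"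
      have D: "(f has_derivative ?D) (at (y + k * z))"
        using f[OF zU] by (simp add: frechet_derivative_works)
      then interpret D: bounded_linear ?D by (rule has_derivative_bounded_linear)
      have fk: "((\<lambda>z. k * f (y + k * z)) has_derivative (\<lambda>v. k * ?D (k * v))) (at z)"
        by (intro has_derivative_mult_right has_derivative_compose[OF line D])
      then show "(\<lambda>z. k * f (y + k * z)) differentiable (at z)" by (auto simp: differentiable_def)
      have k1: "?D k = Re k * ?D 1 + Im k * ?D \<i>"
      proof -
        have "k = Re k *\<^sub>R 1 + Im k *\<^sub>R \<i>" by (simp add: complex_eq_iff)
        then show ?thesis by (metis D.add D.scaleR scaleR_conv_of_real)
      qed
      have k2: "?D (k * \<i>) = Re k * ?D \<i> - Im k * ?D 1"
      proof -
        have "k * \<i> = Re k *\<^sub>R \<i> - Im k *\<^sub>R 1" by (simp add: complex_eq_iff)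
        then show ?thesis by (metis D.diff D.scaleR scaleR_conv_of_real)
      qed
      have "d_zbar (\<lambda>z. k * f (y + k * z)) z = k * (?D k + \<i> * ?D (k * \<i>)) / 2"
        using wirtinger_eq[OF fk, of \<i>] by (simp add: d_z_wirtinger algebra_simps)
      \<comment> \<open>A complex affine change of variable multiplies \<open>d_zbar\<close> by
        \<open>cnj k\<close>; with the factor \<open>k\<close> of the new gradient function the
        Laplacian scales by the positive number |k|^2 and keeps its sign.\<close>
      also have "?D k + \<i> * ?D (k * \<i>) = cnj k * (?D 1 + \<i> * ?D \<i>)"
        unfolding k1 k2 by (simp add: complex_eq_iff algebra_simps)
      also have "k * (cnj k * (?D 1 + \<i> * ?D \<i>)) / 2 = of_real ((norm k)\<^sup>2) * d_zbar f (y + k * z)"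
        by (simp only: d_zbar_def complex_norm_square) simp
      finally show "Re (d_zbar (\<lambda>z. k * f (y + k * z)) z) \<ge> 0"
        using sub[OF zU] by simp
      show "u (y + k * z) \<le> u (y + k * 0)" using le[OF zU] yp by simp
      assume "z \<in> ball 1 1"
      have "c - (y + k * z) = k * (1 - z)" by (simp add: k_def algebra_simps)
      then have "dist c (y + k * z) < norm k"
        using \<open>z \<in> ball 1 1\<close> k0 by (simp add: dist_norm norm_mult)
      then have "y + k * z \<notin> Z" using y(2) nk by fastforce
      moreover have "dist p (y + k * z) \<le> 2 * R"
        using \<open>dist c (y + k * z) < norm k\<close> kR c dist_triangle[of p "y + k * z" c] by simp
      ultimately have "u (y + k * z) \<noteq> u p" by (simp add: Z_def)
      then show "u (y + k * z) < u (y + k * 0)" using le[OF zU] yp by simp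
    qed
  qed
  then show ?thesis using R(1) by blast
qed

section \<open>Two solutions of the Hitchin equation over a coordinate domain\<close>

text \<open>The equation in a single coordinate domain, so that the local computation is free of
  charts.\<close>

definition hitchin_equation_on ::
    "complex set \<Rightarrow> nat \<Rightarrow> (complex \<Rightarrow> complex mat) \<Rightarrow> (complex \<Rightarrow> complex mat) \<Rightarrow> bool" where
  "hitchin_equation_on U n \<Phi> H \<longleftrightarrow> (\<forall>z\<in>U.
     chern_curvature n H z +
       (\<Phi> z * herm_adjoint (H z) (\<Phi> z) - herm_adjoint (H z) (\<Phi> z) * \<Phi> z) = 0\<^sub>m n n)"

locale two_solutions =
  fixes n :: nat and U :: "complex set" and H H' \<Phi> :: "complex \<Rightarrow> complex mat"
  assumes open_U: "open U"
    and pos: "\<And>z. z \<in> U \<Longrightarrow> hermitian_pos_def n (H z)"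
    and pos': "\<And>z. z \<in> U \<Longrightarrow> hermitian_pos_def n (H' z)"
    and smooth: "\<And>a b. a < n \<Longrightarrow> b < n \<Longrightarrow> smooth_on (\<lambda>z. H z $$ (a, b)) U"
    and smooth': "\<And>a b. a < n \<Longrightarrow> b < n \<Longrightarrow> smooth_on (\<lambda>z. H' z $$ (a, b)) U"
    and Phi: "\<And>z. z \<in> U \<Longrightarrow> \<Phi> z \<in> carrier_mat n n"
    and hitchin: "hitchin_equation_on U n \<Phi> H"
    and hitchin': "hitchin_equation_on U n \<Phi> H'"
begin

definition s :: "complex \<Rightarrow> complex mat" where
  "s z = mat_inv (H z) * H' z"

abbreviation A :: "complex \<Rightarrow> complex mat" where "A \<equiv> chern_connection n H"
abbreviation A' :: "complex \<Rightarrow> complex mat" where "A' \<equiv> chern_connection n H'"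
abbreviation S :: "complex \<Rightarrow> complex mat" where "S z \<equiv> herm_adjoint (H z) (\<Phi> z)"
abbreviation S' :: "complex \<Rightarrow> complex mat" where "S' z \<equiv> herm_adjoint (H' z) (\<Phi> z)"

lemmas H = hermitian_pos_defD(1)[OF pos] and H' = hermitian_pos_defD(1)[OF pos']
lemmas Hadj = hermitian_pos_defD(2)[OF pos] and Hadj' = hermitian_pos_defD(2)[OF pos']
lemmas G = hermitian_pos_def_inv[OF pos] and G' = hermitian_pos_def_inv[OF pos']
lemmas Gadj = hermitian_pos_defD(2)[OF hermitian_pos_def_inverse[OF pos]]

lemmas sq = square_mult_carrier[of _ n] square_mult_assoc[of _ n]
  mult_add_distrib_mat[of _ n n _ n] add_mult_distrib_mat[of _ n n _ _ n]
  mult_minus_distrib_mat[of _ n n _ n] minus_mult_distrib_mat[of _ n n _ _ n]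

lemma inverse_cancel:
  assumes "z \<in> U" "M \<in> carrier_mat n n"
  shows "mat_inv (H z) * (H z * M) = M" "H z * (mat_inv (H z) * M) = M"
    "mat_inv (H' z) * (H' z * M) = M" "H' z * (mat_inv (H' z) * M) = M"
  using assms G[of z] G'[of z] H[of z] H'[of z] by (simp_all flip: square_mult_assoc[of _ n])

lemma diff_H: "differentiable_mat_on n H U" "differentiable_mat_on n (mat_wirtinger c n H) U"
  using smooth_on_mat[OF open_U H smooth] by auto

lemma diff_H': "differentiable_mat_on n H' U" "differentiable_mat_on n (mat_wirtinger c n H') U"
  using smooth_on_mat[OF open_U H' smooth'] by auto

lemma diff_s: "differentiable_mat_on n s U"
  unfolding s_def[abs_def]
  by (intro differentiable_mat_on_mult differentiable_mat_on_inverse diff_H diff_H'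
      hermitian_pos_def_det[OF pos])

lemma diff_A: "differentiable_mat_on n A U" "differentiable_mat_on n A' U"
  unfolding chern_connection_def[abs_def] d_z_wirtinger
  by (intro differentiable_mat_on_mult differentiable_mat_on_inverse diff_H diff_H'
      hermitian_pos_def_det[OF pos] hermitian_pos_def_det[OF pos']; assumption)+

lemmas s_carrier = differentiable_mat_onD(2)[OF diff_s]
lemmas A_carrier = differentiable_mat_onD(2)[OF diff_A(1)] differentiable_mat_onD(2)[OF diff_A(2)]

lemma H_s: "z \<in> U \<Longrightarrow> H z * s z = H' z"
  using inverse_cancel(2) H' by (simp add: s_def)

lemma H_A:
  assumes "z \<in> U"
  shows "H z * A z = mat_wirtinger (- \<i>) n H z" "H' z * A' z = mat_wirtinger (- \<i>) n H' z"
  using inverse_cancel[OF assms] by (simp_all add: chern_connection_def d_z_wirtinger)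

lemma wirtinger_H_s:
  assumes "z \<in> U"
  shows "mat_wirtinger c n H z * s z + H z * mat_wirtinger c n s z = mat_wirtinger c n H' z"
  using mat_wirtinger_mult[OF diff_H(1) diff_s assms, of c]
    mat_wirtinger_cong[OF differentiable_mat_on_mult[OF diff_H(1) diff_s] assms H_s, of c] by simp

lemma H_cancel:
  assumes "z \<in> U" "M \<in> carrier_mat n n" "N \<in> carrier_mat n n" "H z * M = H z * N"
  shows "M = N"
  using inverse_cancel(1)[OF assms(1,2)] inverse_cancel(1)[OF assms(1,3)] assms(4) by metis

lemma H'_cancel:
  assumes "z \<in> U" "M \<in> carrier_mat n n" "N \<in> carrier_mat n n" "H' z * M = H' z * N"
  shows "M = N"
  using inverse_cancel(3)[OF assms(1,2)] inverse_cancel(3)[OF assms(1,3)] assms(4) by metis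

lemma mat_add_diff_cancel:
  fixes X Y Z :: "complex mat"
  assumes "X \<in> carrier_mat n n" "Y \<in> carrier_mat n n" "Z \<in> carrier_mat n n" "X + Y = Z"
  shows "Y = Z - X"
  using assms by (auto intro!: eq_matI)

text \<open>Differentiating \<open>H s = H'\<close> by the product rule and cancelling
  \<open>H\<close> avoids any derivative of an inverse matrix.\<close>

lemma d_z_s: "z \<in> U \<Longrightarrow> mat_wirtinger (- \<i>) n s z = s z * A' z - A z * s z"
proof (rule H_cancel)
  assume z: "z \<in> U"
  note c = H[OF z] s_carrier[OF z] A_carrier[OF z]
  have "H z * mat_wirtinger (- \<i>) n s z =
      mat_wirtinger (- \<i>) n H' z - mat_wirtinger (- \<i>) n H z * s z"
    using wirtinger_H_s[OF z, of "- \<i>"] c by (intro mat_add_diff_cancel) (simp_all add: sq)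
  also have "\<dots> = H z * s z * A' z - H z * A z * s z"
    using H_A[OF z] H_s[OF z] by simp
  also have "\<dots> = H z * (s z * A' z - A z * s z)"
    using c by (simp add: sq)
  finally show "H z * mat_wirtinger (- \<i>) n s z = H z * (s z * A' z - A z * s z)" .
qed (use s_carrier A_carrier in \<open>auto intro!: minus_carrier_mat square_mult_carrier\<close>)

text \<open>This is the z-derivative of \<open>tr s\<close> (\<open>d_z_trace\<close>). In this form
  it is visibly differentiable, so the Laplacian of \<open>tr s\<close> can be computed as
  \<open>d_zbar f\<close>.\<close>

definition f :: "complex \<Rightarrow> complex" where
  "f z = mtrace (s z * (A' z - A z))"

lemma diff_f:
  assumes "z \<in> U" shows "f differentiable (at z)"
  unfolding f_def[abs_def]
  by (rule differentiable_mtrace[of n, OF _ assms])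
    (intro differentiable_mat_on_mult differentiable_mat_on_diff diff_s diff_A)

lemma d_z_trace: "z \<in> U \<Longrightarrow> d_z (\<lambda>w. mtrace (s w)) z = f z"
proof -
  assume z: "z \<in> U"
  note c = s_carrier[OF z] A_carrier[OF z]
  have "d_z (\<lambda>w. mtrace (s w)) z = mtrace (s z * A' z) - mtrace (A z * s z)"
    using c by (simp add: d_z_wirtinger wirtinger_mtrace[OF diff_s z] d_z_s[OF z] mtrace_diff[of _ n] sq)
  also have "mtrace (A z * s z) = mtrace (s z * A z)" using c by (intro mtrace_comm[of _ n n])
  finally show ?thesis using c by (simp add: f_def mtrace_diff[of _ n] sq)
qed

lemma s_adjoint:
  assumes z: "z \<in> U"
  shows "mat_adjoint (s z) = H' z * mat_inv (H z)"
  unfolding s_def by (simp add: mat_adjoint_mult[OF G(1)[OF z] H'[OF z]] Gadj[OF z] Hadj'[OF z])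

lemma trace_real:
  assumes z: "z \<in> U"
  shows "Im (mtrace (s z)) = 0"
proof -
  have "cnj (mtrace (s z)) = mtrace (mat_adjoint (s z))"
    using s_carrier[OF z] by (simp add: mtrace_def)
  also have "\<dots> = mtrace (H' z * mat_inv (H z))" by (simp only: s_adjoint[OF z])
  also have "\<dots> = mtrace (s z)"
    unfolding s_def by (intro mtrace_comm[of _ n n] H' G z)
  finally show ?thesis by (simp add: complex_eq_iff)
qed

lemma trace_derivative:
  assumes z: "z \<in> U"
  shows "((\<lambda>w. Re (mtrace (s w))) has_derivative (\<lambda>v. 2 * Re (f z * v))) (at z)"
  using has_derivative_of_real_valued[OF differentiable_mtrace[OF diff_s z] open_U z trace_real]
  by (simp add: d_z_trace[OF z])

text \<open>Taking adjoints exchanges the two Wirtinger derivatives: the adjoint of the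
  zbar-derivative of \<open>H s = H'\<close> expresses the z-derivatives of the metrics, hence the
  connections, through the zbar-derivative of \<open>s\<close>.\<close>

lemma connection_difference:
  assumes z: "z \<in> U"
  shows "A' z - A z = mat_inv (H' z) * mat_adjoint (mat_wirtinger \<i> n s z) * H z"
proof (rule H'_cancel[OF z])
  let ?B = "mat_wirtinger \<i> n s z"
  note c = H[OF z] H'[OF z] s_carrier[OF z] A_carrier[OF z] G(1)[OF z] G'(1)[OF z]
  have adjH: "mat_adjoint (mat_wirtinger \<i> n H z) = mat_wirtinger (- \<i>) n H z"
    using mat_wirtinger_adjoint[OF diff_H(1) z, of "- \<i>"]
      mat_wirtinger_cong[OF diff_H(1) z, of "\<lambda>z. mat_adjoint (H z)"] Hadj by simp
  have adjH': "mat_adjoint (mat_wirtinger \<i> n H' z) = mat_wirtinger (- \<i>) n H' z"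
    using mat_wirtinger_adjoint[OF diff_H'(1) z, of "- \<i>"]
      mat_wirtinger_cong[OF diff_H'(1) z, of "\<lambda>z. mat_adjoint (H' z)"] Hadj' by simp
  have "H z * ?B = mat_wirtinger \<i> n H' z - mat_wirtinger \<i> n H z * s z"
    using wirtinger_H_s[OF z, of \<i>] c by (intro mat_add_diff_cancel) (simp_all add: sq)
  then have "mat_adjoint (H z * ?B) =
      mat_adjoint (mat_wirtinger \<i> n H' z) - mat_adjoint (mat_wirtinger \<i> n H z * s z)"
    using c by (simp add: mat_adjoint_diff[of _ n n] sq)
  then have "mat_adjoint ?B * H z = H' z * A' z - mat_adjoint (s z) * (H z * A z)"
    using c by (simp add: mat_adjoint_mult[of _ n n _ n] Hadj[OF z] adjH adjH' H_A[OF z])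
  also have "\<dots> = H' z * (A' z - A z)"
    using c inverse_cancel(1)[OF z, of "A z"] by (simp add: s_adjoint[OF z] sq)
  finally have "mat_adjoint ?B * H z = H' z * (A' z - A z)" .
  moreover have "mat_adjoint ?B * H z \<in> carrier_mat n n" using c by (simp add: sq)
  ultimately have "H' z * (A' z - A z) = H' z * (mat_inv (H' z) * (mat_adjoint ?B * H z))"
    using inverse_cancel(4)[OF z] by metis
  then show "H' z * (A' z - A z) = H' z * (mat_inv (H' z) * mat_adjoint ?B * H z)"
    using c by (simp add: sq)
qed (use H[OF z] A_carrier[OF z] G'(1)[OF z] in \<open>auto intro!: minus_carrier_mat square_mult_carrier\<close>)

lemma S_carrier: "z \<in> U \<Longrightarrow> S z \<in> carrier_mat n n" "z \<in> U \<Longrightarrow> S' z \<in> carrier_mat n n"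
  unfolding herm_adjoint_def
  by (intro square_mult_carrier mat_adjoint_carrier G(1) G'(1) H H' Phi; assumption)+

text \<open>The counterpart of \<open>connection_difference\<close> with the commutator of
  \<open>s\<close> and \<Phi> in place of the zbar-derivative of \<open>s\<close>. Both differences
  have the shape needed to complete a squared norm.\<close>

lemma adjoint_difference:
  assumes z: "z \<in> U"
  shows "S' z - S z = mat_inv (H' z) * mat_adjoint (s z * \<Phi> z - \<Phi> z * s z) * H z"
proof -
  note c = H[OF z] H'[OF z] s_carrier[OF z] Phi[OF z] G(1)[OF z] G'(1)[OF z]
  have P: "mat_adjoint (\<Phi> z) \<in> carrier_mat n n" using Phi[OF z] by simp
  have "mat_adjoint (s z * \<Phi> z - \<Phi> z * s z)
      = mat_adjoint (\<Phi> z) * (H' z * mat_inv (H z)) - H' z * mat_inv (H z) * mat_adjoint (\<Phi> z)"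
    using c by (simp add: mat_adjoint_diff[of _ n n] mat_adjoint_mult[of _ n n _ n] s_adjoint[OF z] sq(1))
  then show ?thesis
    using c P inverse_cancel(3)[OF z] G(3)[OF z] by (simp add: herm_adjoint_def sq)
qed

text \<open>The curvature is minus the zbar-derivative of the connection matrix, so the Hitchin
  equation equates that derivative with the commutator.\<close>

lemma d_zbar_connection:
  assumes z: "z \<in> U"
  shows "mat_wirtinger \<i> n A z = \<Phi> z * S z - S z * \<Phi> z"
    "mat_wirtinger \<i> n A' z = \<Phi> z * S' z - S' z * \<Phi> z"
proof -
  have eqI: "X = Y" if "- X + Y = 0\<^sub>m n n" "X \<in> carrier_mat n n" "Y \<in> carrier_mat n n" for X Y :: "complex mat"
  proof (rule eq_matI)
    fix a b assume "a < dim_row Y" "b < dim_col Y"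
    then have ab: "a < n" "b < n" using that by auto
    have "- (X $$ (a, b)) + Y $$ (a, b) = (- X + Y) $$ (a, b)" using ab that(2,3) by simp
    then show "X $$ (a, b) = Y $$ (a, b)" using ab unfolding that(1) by simp
  qed (use that in auto)
  have c: "mat_wirtinger \<i> n A z \<in> carrier_mat n n" "mat_wirtinger \<i> n A' z \<in> carrier_mat n n"
    "\<Phi> z * S z - S z * \<Phi> z \<in> carrier_mat n n" "\<Phi> z * S' z - S' z * \<Phi> z \<in> carrier_mat n n"
    using Phi[OF z] S_carrier[OF z] by (auto intro!: minus_carrier_mat square_mult_carrier)
  note eqs = hitchin hitchin'
  note eqs = eqs[unfolded hitchin_equation_on_def chern_curvature_def d_z_wirtinger, rule_format, OF z]
  show "mat_wirtinger \<i> n A z = \<Phi> z * S z - S z * \<Phi> z"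
    by (rule eqI[OF eqs(1) c(1,3)])
  show "mat_wirtinger \<i> n A' z = \<Phi> z * S' z - S' z * \<Phi> z"
    by (rule eqI[OF eqs(2) c(2,4)])
qed

text \<open>
  The Bochner formula for \<open>tr s\<close>: by positivity of \<open>H\<close> and \<open>H'\<close> both summands are squared norms.
\<close>

lemma d_zbar_f:
  assumes z: "z \<in> U"
  defines "B \<equiv> mat_wirtinger \<i> n s z" and "C \<equiv> s z * \<Phi> z - \<Phi> z * s z"
  shows "d_zbar f z = mtrace (B * mat_inv (H' z) * mat_adjoint B * H z)
     + mtrace (C * mat_inv (H' z) * mat_adjoint C * H z)"
proof -
  note c = H[OF z] H'[OF z] s_carrier[OF z] Phi[OF z] G(1)[OF z] G'(1)[OF z] A_carrier[OF z] S_carrier[OF z]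
  have B: "B \<in> carrier_mat n n" by (simp add: B_def)
  have C: "C \<in> carrier_mat n n" using c by (auto simp: C_def intro!: minus_carrier_mat square_mult_carrier)
  have DA: "differentiable_mat_on n (\<lambda>z. A' z - A z) U"
    by (intro differentiable_mat_on_diff diff_A)
  let ?K = "mat_wirtinger \<i> n A' z - mat_wirtinger \<i> n A z"
  have "d_zbar f z = mtrace (mat_wirtinger \<i> n (\<lambda>z. s z * (A' z - A z)) z)"
    unfolding d_z_wirtinger f_def[abs_def]
    by (rule wirtinger_mtrace[OF differentiable_mat_on_mult[OF diff_s DA] z])
  also have "\<dots> = mtrace (B * (A' z - A z) + s z * ?K)"
    by (simp add: mat_wirtinger_mult[OF diff_s DA z] mat_wirtinger_diff[OF diff_A(2,1) z] B_def)
  also have "\<dots> = mtrace (B * (A' z - A z)) + mtrace (s z * ?K)"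
    using B c by (intro mtrace_add[of _ n]) (auto intro!: minus_carrier_mat square_mult_carrier)
  \<comment> \<open>Cyclicity of the trace moves the commutator with \<Phi> from the adjoint onto
    \<open>s\<close>: tr (s [\<Phi>, X]) = tr ([s, \<Phi>] X).\<close>
  also have "mtrace (s z * ?K) = mtrace (C * (S' z - S z))"
  proof -
    have "mtrace (s z * ?K) = (mtrace (s z * (\<Phi> z * S' z)) - mtrace (s z * (S' z * \<Phi> z)))
        - (mtrace (s z * (\<Phi> z * S z)) - mtrace (s z * (S z * \<Phi> z)))"
      using c by (simp add: d_zbar_connection[OF z] sq mtrace_diff[of _ n] minus_carrier_mat)
    moreover have "mtrace (s z * (X * \<Phi> z)) = mtrace (\<Phi> z * (s z * X))" if "X \<in> carrier_mat n n" for X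
      using mtrace_comm[of "s z * X" n n "\<Phi> z"] c that by (simp add: sq)
    moreover have "mtrace (C * (S' z - S z)) = (mtrace (s z * (\<Phi> z * S' z)) - mtrace (\<Phi> z * (s z * S' z)))
        - (mtrace (s z * (\<Phi> z * S z)) - mtrace (\<Phi> z * (s z * S z)))"
      using c by (simp add: C_def sq mtrace_diff[of _ n] minus_carrier_mat)
    ultimately show ?thesis using c by simp
  qed
  finally show ?thesis
    using B C c
    by (simp add: connection_difference[OF z, folded B_def] adjoint_difference[OF z, folded C_def] sq)
qed

lemma
  assumes z: "z \<in> U"
  shows d_zbar_f_nonneg: "Re (d_zbar f z) \<ge> 0"
    and d_zbar_f_zero: "d_zbar f z = 0 \<Longrightarrow> mat_d_zbar n s z = 0\<^sub>m n n \<and> s z * \<Phi> z = \<Phi> z * s z"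
proof -
  let ?B = "mat_wirtinger \<i> n s z" and ?C = "s z * \<Phi> z - \<Phi> z * s z"
  let ?q = "\<lambda>X. Re (mtrace (X * mat_inv (H' z) * mat_adjoint X * H z))"
  have C: "?C \<in> carrier_mat n n"
    using s_carrier[OF z] Phi[OF z] by (auto intro!: minus_carrier_mat square_mult_carrier)
  note P = hermitian_pos_def_inverse[OF pos'[OF z]] pos[OF z]
  have nB: "?q ?B \<ge> 0" and nC: "?q ?C \<ge> 0"
    using mtrace_sandwich_nonneg[OF P] C by auto
  have eq: "Re (d_zbar f z) = ?q ?B + ?q ?C" by (simp add: d_zbar_f[OF z])
  show "Re (d_zbar f z) \<ge> 0" using eq nB nC by simp
  assume "d_zbar f z = 0"
  then have "?q ?B = 0" "?q ?C = 0" using eq nB nC by simp_all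
  then have B0: "?B = 0\<^sub>m n n" and C0: "?C = 0\<^sub>m n n"
    using mtrace_sandwich_zero[OF P, of ?B] mtrace_sandwich_zero[OF P C] by auto
  have "s z * \<Phi> z = \<Phi> z * s z"
  proof (rule eq_matI)
    fix a b assume "a < dim_row (\<Phi> z * s z)" "b < dim_col (\<Phi> z * s z)"
    then have ab: "a < n" "b < n" using s_carrier[OF z] Phi[OF z] by auto
    have "?C $$ (a, b) = 0" using C0 ab by simp
    then show "(s z * \<Phi> z) $$ (a, b) = (\<Phi> z * s z) $$ (a, b)"
      using ab s_carrier[OF z] Phi[OF z] by simp
  qed (use s_carrier[OF z] Phi[OF z] in auto)
  with B0 show "mat_d_zbar n s z = 0\<^sub>m n n \<and> s z * \<Phi> z = \<Phi> z * s z"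
    by (simp add: d_z_wirtinger)
qed

end

section \<open>Maximum principle and vanishing theorem on a closed Riemann surface\<close>

locale closed_surface =
  fixes \<A> :: "'a::t2_space chart set"
  assumes surface: "closed_riemann_surface \<A>"
begin

lemma compact_surface: "compact (UNIV :: 'a set)"
  and connected_surface: "connected (UNIV :: 'a set)"
  and chart_cover: "(\<Union>\<alpha>\<in>\<A>. fst \<alpha>) = UNIV"
  and open_domain: "\<alpha> \<in> \<A> \<Longrightarrow> open (fst \<alpha>)"
  and open_coord_image: "\<alpha> \<in> \<A> \<Longrightarrow> open (coord_image \<alpha>)"
  and chart_homeomorphism: "\<alpha> \<in> \<A> \<Longrightarrow> homeomorphism (fst \<alpha>) (coord_image \<alpha>) (snd \<alpha>) (chart_inv \<alpha>)"
  using surface unfolding closed_riemann_surface_def by blast+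

lemma chart_at: obtains \<alpha> where "\<alpha> \<in> \<A>" "p \<in> fst \<alpha>"
  using chart_cover by blast

lemma chart_point: "p \<in> fst \<alpha> \<Longrightarrow> snd \<alpha> p \<in> coord_image \<alpha>"
  by (simp add: coord_image_def)

lemma chart_inv_point:
  assumes "\<alpha> \<in> \<A>" "z \<in> coord_image \<alpha>"
  shows "chart_inv \<alpha> z \<in> fst \<alpha>" "snd \<alpha> (chart_inv \<alpha> z) = z"
  using chart_homeomorphism[OF assms(1)] assms(2) unfolding homeomorphism_def by auto

lemma chart_inv_chart:
  assumes "\<alpha> \<in> \<A>" "p \<in> fst \<alpha>"
  shows "chart_inv \<alpha> (snd \<alpha> p) = p"
  using chart_homeomorphism[OF assms(1)] assms(2) unfolding homeomorphism_def by auto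

lemma open_chart_vimage:
  assumes "\<alpha> \<in> \<A>" "open V"
  shows "open {p \<in> fst \<alpha>. snd \<alpha> p \<in> V}"
proof -
  have "continuous_on (fst \<alpha>) (snd \<alpha>)"
    using chart_homeomorphism[OF assms(1)] by (simp add: homeomorphism_def)
  then have "open (snd \<alpha> -` V \<inter> fst \<alpha>)"
    using continuous_on_open_vimage[OF open_domain[OF assms(1)]] assms(2) by blast
  then show ?thesis by (simp add: vimage_def Int_def conj_commute)
qed

lemma open_chart_image:
  assumes "\<alpha> \<in> \<A>" "open W"
  shows "open {z \<in> coord_image \<alpha>. chart_inv \<alpha> z \<in> W}"
proof -
  have "continuous_on (coord_image \<alpha>) (chart_inv \<alpha>)"
    using chart_homeomorphism[OF assms(1)] by (simp add: homeomorphism_def)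
  then have "open (chart_inv \<alpha> -` W \<inter> coord_image \<alpha>)"
    using continuous_on_open_vimage[OF open_coord_image[OF assms(1)]] assms(2) by blast
  then show ?thesis by (simp add: vimage_def Int_def conj_commute)
qed

lemma clopen_UNIV:
  assumes "open (W :: 'a set)" "closed W" "W \<noteq> {}"
  shows "W = UNIV"
  using connected_surface assms unfolding connected_clopen
  by (auto simp: open_openin[symmetric] closed_closedin[symmetric])

text \<open>Compactness provides a maximum of \<nu> composed with the glued function, and
  connectedness spreads its value. Separating \<open>u\<close> from the real quantity \<nu> covers
  both uses: \<nu> is the identity for the real trace and the norm for holomorphic
  functions.\<close>

lemma constant_if_locally_constant_at_maxima:
  fixes u :: "'a chart \<Rightarrow> complex \<Rightarrow> 'b::t2_space" and \<nu> :: "'b \<Rightarrow> real"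
  assumes cont: "\<And>\<alpha>. \<alpha> \<in> \<A> \<Longrightarrow> continuous_on (coord_image \<alpha>) (u \<alpha>)"
    and compat: "\<And>\<alpha> \<beta> p. \<alpha> \<in> \<A> \<Longrightarrow> \<beta> \<in> \<A> \<Longrightarrow> p \<in> fst \<alpha> \<inter> fst \<beta> \<Longrightarrow> u \<alpha> (snd \<alpha> p) = u \<beta> (snd \<beta> p)"
    and \<nu>: "continuous_on UNIV \<nu>"
    and loc: "\<And>\<alpha> z. \<alpha> \<in> \<A> \<Longrightarrow> z \<in> coord_image \<alpha> \<Longrightarrow>
      (\<And>w. w \<in> coord_image \<alpha> \<Longrightarrow> \<nu> (u \<alpha> w) \<le> \<nu> (u \<alpha> z)) \<Longrightarrow> \<exists>r>0. \<forall>w\<in>ball z r. u \<alpha> w = u \<alpha> z"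
  obtains C where "\<And>\<alpha> z. \<alpha> \<in> \<A> \<Longrightarrow> z \<in> coord_image \<alpha> \<Longrightarrow> u \<alpha> z = C"
proof -
  define F where "F p = (let \<alpha> = SOME \<alpha>. \<alpha> \<in> \<A> \<and> p \<in> fst \<alpha> in u \<alpha> (snd \<alpha> p))" for p
  have F: "F p = u \<alpha> (snd \<alpha> p)" if "\<alpha> \<in> \<A>" "p \<in> fst \<alpha>" for \<alpha> p
  proof -
    have "(SOME \<alpha>. \<alpha> \<in> \<A> \<and> p \<in> fst \<alpha>) \<in> \<A> \<and> p \<in> fst (SOME \<alpha>. \<alpha> \<in> \<A> \<and> p \<in> fst \<alpha>)"
      using that by (intro someI[of "\<lambda>\<alpha>. \<alpha> \<in> \<A> \<and> p \<in> fst \<alpha>"]) auto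
    then show ?thesis unfolding F_def Let_def using that compat by blast
  qed
  have "continuous_on (fst \<alpha>) F" if a: "\<alpha> \<in> \<A>" for \<alpha>
  proof -
    have "continuous_on (fst \<alpha>) (\<lambda>p. u \<alpha> (snd \<alpha> p))"
      using chart_homeomorphism[OF a]
      by (intro continuous_on_compose2[OF cont[OF a]]) (auto simp: homeomorphism_def)
    then show ?thesis using F[OF a] by (simp cong: continuous_on_cong)
  qed
  then have Fc: "continuous_on UNIV F"
    using continuous_on_open_UN[of \<A> fst F] open_domain chart_cover by auto
  have "continuous_on UNIV (\<lambda>p. \<nu> (F p))"
    by (rule continuous_on_compose2[OF \<nu> Fc]) auto
  then obtain p0 where p0: "\<And>p. \<nu> (F p) \<le> \<nu> (F p0)"
    using continuous_attains_sup[OF compact_surface, of "\<lambda>p. \<nu> (F p)"] by auto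
  \<comment> \<open>Every point of this set is again a global maximum, in particular one within its
    chart; hence \<open>loc\<close> applies there and the set is open.\<close>
  have "{p. F p = F p0} = UNIV"
  proof (rule clopen_UNIV)
    show "closed {p. F p = F p0}"
      using Fc by (intro closed_Collect_eq) auto
    show "{p. F p = F p0} \<noteq> {}" by auto
    show "open {p. F p = F p0}"
    proof (subst open_subopen, intro ballI)
      fix p assume "p \<in> {p. F p = F p0}"
      then have p: "F p = F p0" by simp
      obtain \<alpha> where a: "\<alpha> \<in> \<A>" "p \<in> fst \<alpha>" by (rule chart_at)
      have "\<exists>r>0. \<forall>w\<in>ball (snd \<alpha> p) r. u \<alpha> w = u \<alpha> (snd \<alpha> p)"
      proof (rule loc[OF a(1) chart_point[OF a(2)]])
        fix w assume w: "w \<in> coord_image \<alpha>"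
        show "\<nu> (u \<alpha> w) \<le> \<nu> (u \<alpha> (snd \<alpha> p))"
          using p0[of "chart_inv \<alpha> w"] F[OF a(1) chart_inv_point(1)[OF a(1) w]]
            chart_inv_point(2)[OF a(1) w] F[OF a] p by simp
      qed
      then obtain r where r: "r > 0" "\<And>w. w \<in> ball (snd \<alpha> p) r \<Longrightarrow> u \<alpha> w = u \<alpha> (snd \<alpha> p)" by blast
      let ?T = "{q \<in> fst \<alpha>. snd \<alpha> q \<in> ball (snd \<alpha> p) r}"
      have "open ?T" by (rule open_chart_vimage[OF a(1)]) simp
      moreover have "p \<in> ?T" using a r by simp
      moreover have "?T \<subseteq> {p. F p = F p0}"
        using r(2) F[OF a(1)] a(2) p by auto
      ultimately show "\<exists>T. open T \<and> p \<in> T \<and> T \<subseteq> {p. F p = F p0}" by blast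
    qed
  qed
  then have const: "F p = F p0" for p by auto
  show ?thesis
  proof
    fix \<alpha> z assume az: "\<alpha> \<in> \<A>" "z \<in> coord_image \<alpha>"
    show "u \<alpha> z = F p0"
      using F[OF az(1) chart_inv_point(1)[OF az]] const[of "chart_inv \<alpha> z"] chart_inv_point(2)[OF az]
      by simp
  qed
qed

lemma holomorphic_function_constant:
  fixes u :: "'a chart \<Rightarrow> complex \<Rightarrow> complex"
  assumes hol: "\<And>\<alpha>. \<alpha> \<in> \<A> \<Longrightarrow> u \<alpha> holomorphic_on coord_image \<alpha>"
    and compat: "\<And>\<alpha> \<beta> p. \<alpha> \<in> \<A> \<Longrightarrow> \<beta> \<in> \<A> \<Longrightarrow> p \<in> fst \<alpha> \<inter> fst \<beta> \<Longrightarrow> u \<alpha> (snd \<alpha> p) = u \<beta> (snd \<beta> p)"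
  obtains C where "\<And>\<alpha> z. \<alpha> \<in> \<A> \<Longrightarrow> z \<in> coord_image \<alpha> \<Longrightarrow> u \<alpha> z = C"
proof (rule constant_if_locally_constant_at_maxima[where u = u and \<nu> = "norm :: complex \<Rightarrow> real"])
  show "continuous_on (coord_image \<alpha>) (u \<alpha>)" if "\<alpha> \<in> \<A>" for \<alpha>
    using hol[OF that] by (rule holomorphic_on_imp_continuous_on)
  show "continuous_on UNIV (norm :: complex \<Rightarrow> real)" by (intro continuous_intros)
  fix \<alpha> z assume a: "\<alpha> \<in> \<A>" "z \<in> coord_image \<alpha>"
    and max: "\<And>w. w \<in> coord_image \<alpha> \<Longrightarrow> norm (u \<alpha> w) \<le> norm (u \<alpha> z)"
  obtain r where r: "r > 0" "ball z r \<subseteq> coord_image \<alpha>"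
    using open_coord_image[OF a(1)] a(2) open_contains_ball by blast
  have "u \<alpha> constant_on ball z r"
    using r max holomorphic_on_subset[OF hol[OF a(1)] r(2)]
    by (intro maximum_modulus_principle[where U = "ball z r" and \<xi> = z]) auto
  then show "\<exists>r>0. \<forall>w\<in>ball z r. u \<alpha> w = u \<alpha> z"
    using r(1) by (auto simp: constant_on_def)
qed (rule compat that; assumption)+

section \<open>Holomorphic differentials and their zeros\<close>

lemma holomorphic_differentialsD:
  assumes "\<omega> \<in> holomorphic_differentials \<A> j"
  shows "\<And>\<alpha>. \<alpha> \<in> \<A> \<Longrightarrow> \<omega> \<alpha> holomorphic_on coord_image \<alpha>"
    and "\<And>\<alpha> \<beta> p. \<alpha> \<in> \<A> \<Longrightarrow> \<beta> \<in> \<A> \<Longrightarrow> p \<in> fst \<alpha> \<inter> fst \<beta> \<Longrightarrow>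
      \<omega> \<alpha> (snd \<alpha> p) = \<omega> \<beta> (snd \<beta> p) * coord_deriv \<alpha> \<beta> p ^ j"
    and "\<And>\<alpha> z. \<alpha> \<notin> \<A> \<or> z \<notin> coord_image \<alpha> \<Longrightarrow> \<omega> \<alpha> z = 0"
  using assms unfolding holomorphic_differentials_def by blast+

text \<open>Otherwise evaluation at \<open>p\<close> would be injective and all differentials would
  lie in the span of at most one of them. The bound on the dimension comes from this explicit
  spanning set, so finiteness of the dimension need not be known beforehand.\<close>

lemma differential_with_zero:
  assumes genus: "genus \<A> \<ge> 2" and a: "\<alpha> \<in> \<A>" "p \<in> fst \<alpha>"
  shows "\<exists>\<omega>\<in>holomorphic_differentials \<A> 1. \<omega> \<noteq> (\<lambda>\<alpha> z. 0) \<and> \<omega> \<alpha> (snd \<alpha> p) = 0"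
proof (rule ccontr)
  let ?S = "\<lambda>(c::complex) (q :: 'a chart \<Rightarrow> complex \<Rightarrow> complex). (\<lambda>\<alpha> z. c * q \<alpha> z)"
  interpret V: vector_space ?S
    by unfold_locales (auto simp: fun_eq_iff algebra_simps)
  assume none: "\<not> ?thesis"
  then have zero: "\<omega> = (\<lambda>\<alpha> z. 0)" if "\<omega> \<in> holomorphic_differentials \<A> 1" "\<omega> \<alpha> (snd \<alpha> p) = 0" for \<omega>
    using that none by blast
  show False
  proof (cases "\<exists>\<omega>\<in>holomorphic_differentials \<A> 1. \<omega> \<noteq> (\<lambda>\<alpha> z. 0)")
    case True
    then obtain \<omega> where w: "\<omega> \<in> holomorphic_differentials \<A> 1" "\<omega> \<noteq> (\<lambda>\<alpha> z. 0)" by blast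
    then have w0: "\<omega> \<alpha> (snd \<alpha> p) \<noteq> 0" using zero by blast
    have "holomorphic_differentials \<A> 1 \<subseteq> V.span {\<omega>}"
    proof
      fix \<eta> assume e: "\<eta> \<in> holomorphic_differentials \<A> 1"
      \<comment> \<open>The multiple of \<omega> that has the same value as \<eta> at
        \<open>p\<close>.\<close>
      define c where "c = \<eta> \<alpha> (snd \<alpha> p) / \<omega> \<alpha> (snd \<alpha> p)"
      have "(\<lambda>\<alpha> z. \<eta> \<alpha> z - c * \<omega> \<alpha> z) = (\<lambda>\<alpha> z. 0)"
      proof (rule zero)
        show "(\<lambda>\<alpha> z. \<eta> \<alpha> z - c * \<omega> \<alpha> z) \<in> holomorphic_differentials \<A> 1"
          unfolding holomorphic_differentials_def mem_Collect_eq
        proof (intro conjI ballI allI impI)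
          fix \<beta> assume "\<beta> \<in> \<A>"
          then show "(\<lambda>z. \<eta> \<beta> z - c * \<omega> \<beta> z) holomorphic_on coord_image \<beta>"
            using holomorphic_differentialsD(1)[OF e] holomorphic_differentialsD(1)[OF w(1)]
            by (intro holomorphic_intros) auto
        next
          fix \<beta> \<gamma> p assume *: "\<beta> \<in> \<A>" "\<gamma> \<in> \<A>" "p \<in> fst \<beta> \<inter> fst \<gamma>"
          show "\<eta> \<beta> (snd \<beta> p) - c * \<omega> \<beta> (snd \<beta> p)
              = (\<eta> \<gamma> (snd \<gamma> p) - c * \<omega> \<gamma> (snd \<gamma> p)) * coord_deriv \<beta> \<gamma> p ^ 1"
            using holomorphic_differentialsD(2)[OF e *] holomorphic_differentialsD(2)[OF w(1) *]
            by (simp add: algebra_simps)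
        next
          fix \<beta> z assume "\<beta> \<notin> \<A> \<or> z \<notin> coord_image \<beta>"
          then show "\<eta> \<beta> z - c * \<omega> \<beta> z = 0"
            using holomorphic_differentialsD(3)[OF e] holomorphic_differentialsD(3)[OF w(1)] by simp
        qed
      qed (use w0 in \<open>simp add: c_def\<close>)
      then have "\<eta> = ?S c \<omega>" by (simp add: fun_eq_iff)
      then show "\<eta> \<in> V.span {\<omega>}" unfolding V.span_singleton by blast
    qed
    then have "V.dim (holomorphic_differentials \<A> 1) \<le> card {\<omega>}"
      by (intro V.dim_le_card) auto
    then show False using genus by (simp add: genus_def)
  next
    case False
    then have "holomorphic_differentials \<A> 1 \<subseteq> V.span {}"
      by (auto simp: V.span_empty fun_eq_iff zero_fun_def)
    then have "V.dim (holomorphic_differentials \<A> 1) \<le> card ({} :: ('a chart \<Rightarrow> complex \<Rightarrow> complex) set)"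
      by (intro V.dim_le_card) auto
    then show False using genus by (simp add: genus_def)
  qed
qed

text \<open>The identity theorem on a connected surface: the interior of the zero set is nonempty,
  open and closed.\<close>

lemma differential_zero_if_locally_zero:
  assumes w: "\<omega> \<in> holomorphic_differentials \<A> 1" and a: "\<alpha> \<in> \<A>" "p \<in> fst \<alpha>"
    and r: "r > 0" "ball (snd \<alpha> p) r \<subseteq> coord_image \<alpha>" "\<And>z. z \<in> ball (snd \<alpha> p) r \<Longrightarrow> \<omega> \<alpha> z = 0"
  shows "\<omega> = (\<lambda>\<alpha> z. 0)"
proof -
  note wD = holomorphic_differentialsD[OF w]
  define N where "N = {p. \<forall>\<alpha>\<in>\<A>. p \<in> fst \<alpha> \<longrightarrow> \<omega> \<alpha> (snd \<alpha> p) = 0}"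
  have N: "q \<in> N" if "\<beta> \<in> \<A>" "q \<in> fst \<beta>" "\<omega> \<beta> (snd \<beta> q) = 0" for \<beta> q
    unfolding N_def mem_Collect_eq
  proof (intro ballI impI)
    fix \<gamma> assume "\<gamma> \<in> \<A>" "q \<in> fst \<gamma>"
    then show "\<omega> \<gamma> (snd \<gamma> q) = 0" using wD(2)[of \<gamma> \<beta> q] that by simp
  qed
  have "interior N = UNIV"
  proof (rule clopen_UNIV)
    let ?V = "{q \<in> fst \<alpha>. snd \<alpha> q \<in> ball (snd \<alpha> p) r}"
    have "open ?V" by (rule open_chart_vimage[OF a(1)]) simp
    moreover have "?V \<subseteq> N" using r(3) N[OF a(1)] by auto
    moreover have "p \<in> ?V" using a r(1) by simp
    ultimately show "interior N \<noteq> {}" using interior_maximal by blast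
    have "closure (interior N) \<subseteq> interior N"
    proof
      fix q assume q: "q \<in> closure (interior N)"
      obtain \<beta> where b: "\<beta> \<in> \<A>" "q \<in> fst \<beta>" by (rule chart_at)
      obtain e where e: "e > 0" "ball (snd \<beta> q) e \<subseteq> coord_image \<beta>"
        using open_coord_image[OF b(1)] chart_point[OF b(2)] open_contains_ball by blast
      let ?W = "{q' \<in> fst \<beta>. snd \<beta> q' \<in> ball (snd \<beta> q) e}"
      have W: "open ?W" "q \<in> ?W"
        using open_chart_vimage[OF b(1) open_ball] b e(1) by simp_all
      then have "?W \<inter> interior N \<noteq> {}" using q closure_iff_nhds_not_empty[of q] by blast
      then obtain q' where q': "q' \<in> fst \<beta>" "snd \<beta> q' \<in> ball (snd \<beta> q) e" "q' \<in> interior N" by blast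
      \<comment> \<open>A disc about a limit point meets the interior of the zero set in a nonempty
        open set, from which analytic continuation carries the vanishing to the whole disc.\<close>
      let ?O = "{z \<in> coord_image \<beta>. chart_inv \<beta> z \<in> interior N} \<inter> ball (snd \<beta> q) e"
      have O: "open ?O" by (intro open_Int open_chart_image[OF b(1)]) auto
      have O0: "?O \<noteq> {}" using q' chart_point[OF q'(1)] chart_inv_chart[OF b(1) q'(1)] by fastforce
      have Oz: "\<omega> \<beta> z = 0" if "z \<in> ?O" for z
        using that interior_subset[of N] chart_inv_point[OF b(1)] b(1) unfolding N_def by fastforce
      have "\<omega> \<beta> z = 0" if "z \<in> ball (snd \<beta> q) e" for z
        using analytic_continuation_open[OF O _ O0, of "ball (snd \<beta> q) e" "\<omega> \<beta>" "\<lambda>_. 0" z]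
          holomorphic_on_subset[OF wD(1)[OF b(1)] e(2)] Oz that by auto
      then have "?W \<subseteq> N" using N[OF b(1)] by auto
      then show "q \<in> interior N" using W interior_maximal by blast
    qed
    then show "closed (interior N)" using closure_subset_eq by blast
  qed simp
  then have "N = UNIV" using interior_subset by blast
  show ?thesis
  proof (intro ext)
    fix \<beta> z
    show "\<omega> \<beta> z = 0"
    proof (cases "\<beta> \<in> \<A> \<and> z \<in> coord_image \<beta>")
      case True
      then have "chart_inv \<beta> z \<in> N" using \<open>N = UNIV\<close> by simp
      then show ?thesis using True chart_inv_point[of \<beta> z] by (auto simp: N_def)
    qed (use wD(3) in auto)
  qed
qed

text \<open>
  \<open>H\<^sup>0(\<Sigma>, K\<^sup>-\<^sup>m) = 0\<close>: multiplying by the \<open>m\<close>-th power of a holomorphic differential with a zero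
  gives a holomorphic function with a zero.
\<close>

lemma negative_power_section_zero:
  assumes genus: "genus \<A> \<ge> 2" and m: "m > 0"
    and hol: "\<And>\<alpha>. \<alpha> \<in> \<A> \<Longrightarrow> f \<alpha> holomorphic_on coord_image \<alpha>"
    and trans: "\<And>\<alpha> \<beta> p. \<alpha> \<in> \<A> \<Longrightarrow> \<beta> \<in> \<A> \<Longrightarrow> p \<in> fst \<alpha> \<inter> fst \<beta> \<Longrightarrow>
      f \<beta> (snd \<beta> p) = f \<alpha> (snd \<alpha> p) * coord_deriv \<alpha> \<beta> p ^ m"
    and a: "\<alpha> \<in> \<A>" "z \<in> coord_image \<alpha>"
  shows "f \<alpha> z = 0"
proof (rule ccontr)
  assume f0: "f \<alpha> z \<noteq> 0"
  note p = chart_inv_point[OF a]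
  obtain \<omega> where w: "\<omega> \<in> holomorphic_differentials \<A> 1" "\<omega> \<noteq> (\<lambda>\<alpha> z. 0)"
    and w0: "\<omega> \<alpha> (snd \<alpha> (chart_inv \<alpha> z)) = 0"
    using differential_with_zero[OF genus a(1) p(1)] by auto
  note wD = holomorphic_differentialsD[OF w(1)]
  obtain C where C: "\<And>\<beta> w. \<beta> \<in> \<A> \<Longrightarrow> w \<in> coord_image \<beta> \<Longrightarrow> f \<beta> w * \<omega> \<beta> w ^ m = C"
  proof (rule holomorphic_function_constant[of "\<lambda>\<beta> w. f \<beta> w * \<omega> \<beta> w ^ m"])
    show "(\<lambda>w. f \<beta> w * \<omega> \<beta> w ^ m) holomorphic_on coord_image \<beta>" if "\<beta> \<in> \<A>" for \<beta>
      using hol[OF that] wD(1)[OF that] by (intro holomorphic_intros)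
    show "f \<beta> (snd \<beta> p) * \<omega> \<beta> (snd \<beta> p) ^ m = f \<gamma> (snd \<gamma> p) * \<omega> \<gamma> (snd \<gamma> p) ^ m"
      if "\<beta> \<in> \<A>" "\<gamma> \<in> \<A>" "p \<in> fst \<beta> \<inter> fst \<gamma>" for \<beta> \<gamma> p
      using trans[OF that] wD(2)[OF that] by (simp add: power_mult_distrib mult_ac)
  qed blast
  have "C = 0" using C[OF a] w0 p(2) zero_power[OF m] by auto
  have "continuous_on (coord_image \<alpha>) (f \<alpha>)" using hol[OF a(1)] by (rule holomorphic_on_imp_continuous_on)
  then have "isCont (f \<alpha>) z" using a open_coord_image continuous_on_eq_continuous_at by blast
  then obtain e where e: "e > 0" "\<And>w. dist w z < e \<Longrightarrow> f \<alpha> w \<noteq> 0"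
    using continuous_at_avoid[of z "f \<alpha>" 0] f0 by (metis dist_commute)
  obtain r where r: "r > 0" "ball z r \<subseteq> coord_image \<alpha>"
    using open_coord_image[OF a(1)] a(2) open_contains_ball by blast
  \<comment> \<open>The product with \<open>f\<close> is the constant 0 and \<open>f\<close> does
    not vanish near \<open>z\<close>, so \<omega> vanishes on a disc and therefore
    everywhere.\<close>
  have "\<omega> \<alpha> w = 0" if "w \<in> ball z (min e r)" for w
  proof -
    have "w \<in> coord_image \<alpha>" "f \<alpha> w \<noteq> 0" using that r e by (auto simp: dist_commute)
    then show ?thesis using C[OF a(1), of w] \<open>C = 0\<close> by simp
  qed
  then have "\<omega> = (\<lambda>\<alpha> z. 0)"
    using e(1) r p(2) by (intro differential_zero_if_locally_zero[OF w(1) a(1) p(1), of "min e r"]) auto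
  with w(2) show False by contradiction
qed

end

section \<open>Comparing two solutions globally\<close>

lemma hermitian_metricD:
  assumes "hermitian_metric \<A> n g h"
  shows "\<And>\<alpha> z. \<alpha> \<in> \<A> \<Longrightarrow> z \<in> coord_image \<alpha> \<Longrightarrow> hermitian_pos_def n (h \<alpha> z)"
    and "\<And>\<alpha> a b. \<alpha> \<in> \<A> \<Longrightarrow> a < n \<Longrightarrow> b < n \<Longrightarrow> smooth_on (\<lambda>z. h \<alpha> z $$ (a, b)) (coord_image \<alpha>)"
    and "\<And>\<alpha> \<beta> p. \<alpha> \<in> \<A> \<Longrightarrow> \<beta> \<in> \<A> \<Longrightarrow> p \<in> fst \<alpha> \<inter> fst \<beta> \<Longrightarrow>
      h \<beta> (snd \<beta> p) = mat_adjoint (g \<alpha> \<beta> p) * h \<alpha> (snd \<alpha> p) * g \<alpha> \<beta> p"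
  using assms unfolding hermitian_metric_def by blast+

text \<open>The endomorphism \<open>s\<close> with \<open>h'(v, w) = h(s v, w)\<close>.\<close>

definition metric_ratio ::
    "('a chart \<Rightarrow> complex \<Rightarrow> complex mat) \<Rightarrow> ('a chart \<Rightarrow> complex \<Rightarrow> complex mat) \<Rightarrow>
     'a chart \<Rightarrow> complex \<Rightarrow> complex mat" where
  "metric_ratio h h' \<alpha> z = mat_inv (h \<alpha> z) * h' \<alpha> z"

context closed_surface
begin

text \<open>The ratio of two metrics is an endomorphism of the bundle: under a change of frame it is
  conjugated, so its trace is a function on the surface.\<close>

lemma
  assumes h: "hermitian_metric \<A> n g h" and h': "hermitian_metric \<A> n g h'"
    and g: "g \<alpha> \<beta> p \<in> carrier_mat n n"
    and ab: "\<alpha> \<in> \<A>" "\<beta> \<in> \<A>" "p \<in> fst \<alpha> \<inter> fst \<beta>"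
  shows metric_ratio_transition:
      "g \<alpha> \<beta> p * metric_ratio h h' \<beta> (snd \<beta> p) = metric_ratio h h' \<alpha> (snd \<alpha> p) * g \<alpha> \<beta> p"
    and metric_ratio_trace:
      "mtrace (metric_ratio h h' \<alpha> (snd \<alpha> p)) = mtrace (metric_ratio h h' \<beta> (snd \<beta> p))"
proof -
  let ?g = "g \<alpha> \<beta> p" and ?H = "h \<alpha> (snd \<alpha> p)" and ?H' = "h' \<alpha> (snd \<alpha> p)"
    and ?K = "h \<beta> (snd \<beta> p)" and ?K' = "h' \<beta> (snd \<beta> p)"
  let ?s = "metric_ratio h h' \<alpha> (snd \<alpha> p)" and ?t = "metric_ratio h h' \<beta> (snd \<beta> p)"
  have pa: "snd \<alpha> p \<in> coord_image \<alpha>" and pb: "snd \<beta> p \<in> coord_image \<beta>"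
    using ab(3) chart_point[of p \<alpha>] chart_point[of p \<beta>] by auto
  note H = hermitian_metricD(1)[OF h ab(1) pa] and K = hermitian_metricD(1)[OF h ab(2) pb]
  note H' = hermitian_metricD(1)[OF h' ab(1) pa] and K' = hermitian_metricD(1)[OF h' ab(2) pb]
  note c = hermitian_pos_defD(1)[OF H] hermitian_pos_defD(1)[OF K]
    hermitian_pos_defD(1)[OF H'] hermitian_pos_defD(1)[OF K'] g
  note G = hermitian_pos_def_inv[OF H] and L = hermitian_pos_def_inv[OF K]
  have ga: "mat_adjoint ?g \<in> carrier_mat n n" using g by simp
  note sq = square_mult_carrier[of _ n] square_mult_assoc[of _ n]
  have K_eq: "?K = mat_adjoint ?g * (?H * ?g)"
    using hermitian_metricD(3)[OF h ab] c ga by (simp add: sq)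
  \<comment> \<open>Invertibility of the transition matrix is extracted from the nondegeneracy of
    the metric on the other chart.\<close>
  have "Determinant.det ?K = Determinant.det (mat_adjoint ?g) * (Determinant.det ?H * Determinant.det ?g)"
    unfolding K_eq using c ga by (simp add: det_mult[of _ n] sq)
  then have "Determinant.det ?g \<noteq> 0" using hermitian_pos_def_det[OF K] by auto
  note gi = mat_inv_props[OF g this]
  have s: "?s \<in> carrier_mat n n" using c G by (simp add: metric_ratio_def sq)
  have cancel: "?g * (mat_inv ?g * M) = M" "mat_inv ?K * (?K * M) = M" "?H * (mat_inv ?H * M) = M"
    if "M \<in> carrier_mat n n" for M
    using that gi L G c by (simp_all flip: square_mult_assoc[of _ n])
  have "?K * (mat_inv ?g * (?s * ?g)) = mat_adjoint ?g * (?H * (?s * ?g))"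
    unfolding K_eq using c ga gi s cancel(1)[of "?s * ?g"] by (simp add: sq)
  also have "?H * (?s * ?g) = ?H' * ?g"
    using c G cancel(3)[of "?H' * ?g"] by (simp add: metric_ratio_def sq)
  also have "mat_adjoint ?g * (?H' * ?g) = ?K'"
    using hermitian_metricD(3)[OF h' ab] c ga by (simp add: sq)
  finally have t: "?t = mat_inv ?g * (?s * ?g)"
    using cancel(2)[of "mat_inv ?g * (?s * ?g)"] gi s g by (simp add: metric_ratio_def sq)
  show "?g * ?t = ?s * ?g" unfolding t using cancel(1) s g by (simp add: sq)
  have "mtrace ?t = mtrace (?s * ?g * mat_inv ?g)"
    unfolding t using gi s g by (intro mtrace_comm[of _ n n]) (simp_all add: sq)
  then show "mtrace ?s = mtrace ?t" using gi s g by (simp add: sq)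
qed

lemma metric_ratio_holomorphic_commutes:
  assumes h: "hermitian_metric \<A> n g h" and h': "hermitian_metric \<A> n g h'"
    and eq: "hitchin_equation \<A> n \<phi> h" and eq': "hitchin_equation \<A> n \<phi> h'"
    and g: "\<And>\<alpha> \<beta> p. g \<alpha> \<beta> p \<in> carrier_mat n n"
    and \<phi>: "\<And>\<alpha> z. \<phi> \<alpha> z \<in> carrier_mat n n"
    and a: "\<alpha> \<in> \<A>"
  shows "\<And>i j. i < n \<Longrightarrow> j < n \<Longrightarrow> (\<lambda>z. metric_ratio h h' \<alpha> z $$ (i, j)) holomorphic_on coord_image \<alpha>"
    and "\<And>z. z \<in> coord_image \<alpha> \<Longrightarrow> metric_ratio h h' \<alpha> z * \<phi> \<alpha> z = \<phi> \<alpha> z * metric_ratio h h' \<alpha> z"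
proof -
  have sol: "two_solutions n (coord_image \<alpha>) (h \<alpha>) (h' \<alpha>) (\<phi> \<alpha>)" if "\<alpha> \<in> \<A>" for \<alpha>
    using that hermitian_metricD[OF h] hermitian_metricD[OF h'] eq eq' \<phi> open_coord_image
    by unfold_locales (auto simp: hitchin_equation_def hitchin_equation_on_def)
  have ratio: "two_solutions.s (h \<alpha>) (h' \<alpha>) = metric_ratio h h' \<alpha>" if "\<alpha> \<in> \<A>" for \<alpha>
    using two_solutions.s_def[OF sol[OF that]] by (simp add: fun_eq_iff metric_ratio_def)
  obtain C where C: "\<And>\<alpha> z. \<alpha> \<in> \<A> \<Longrightarrow> z \<in> coord_image \<alpha> \<Longrightarrow> Re (mtrace (metric_ratio h h' \<alpha> z)) = C"
  proof (rule constant_if_locally_constant_at_maxima[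
        where u = "\<lambda>\<alpha> z. Re (mtrace (metric_ratio h h' \<alpha> z))" and \<nu> = "\<lambda>x. x"])
    fix \<alpha> assume "\<alpha> \<in> \<A>"
    then interpret S: two_solutions n "coord_image \<alpha>" "h \<alpha>" "h' \<alpha>" "\<phi> \<alpha>" by (rule sol)
    note r = ratio[OF \<open>\<alpha> \<in> \<A>\<close>]
    show "continuous_on (coord_image \<alpha>) (\<lambda>z. Re (mtrace (metric_ratio h h' \<alpha> z)))"
      by (intro continuous_at_imp_continuous_on ballI
          has_derivative_continuous[OF S.trace_derivative[unfolded r]])
    show "\<exists>r>0. \<forall>w\<in>ball z r. Re (mtrace (metric_ratio h h' \<alpha> w)) = Re (mtrace (metric_ratio h h' \<alpha> z))"
      if "z \<in> coord_image \<alpha>" "\<And>w. w \<in> coord_image \<alpha> \<Longrightarrow>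
        Re (mtrace (metric_ratio h h' \<alpha> w)) \<le> Re (mtrace (metric_ratio h h' \<alpha> z))" for z
      by (rule strong_maximum_principle[OF S.open_U that(1) S.trace_derivative[unfolded r]
            S.diff_f S.d_zbar_f_nonneg that(2)])
  next
    show "Re (mtrace (metric_ratio h h' \<alpha> (snd \<alpha> p))) = Re (mtrace (metric_ratio h h' \<beta> (snd \<beta> p)))"
      if "\<alpha> \<in> \<A>" "\<beta> \<in> \<A>" "p \<in> fst \<alpha> \<inter> fst \<beta>" for \<alpha> \<beta> p
      using metric_ratio_trace[OF h h' g that] by simp
  qed (rule that continuous_on_id; assumption?)+
  interpret S: two_solutions n "coord_image \<alpha>" "h \<alpha>" "h' \<alpha>" "\<phi> \<alpha>" by (rule sol[OF a])
  note r = ratio[OF a]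
  have tr: "mtrace (S.s z) = of_real C" if "z \<in> coord_image \<alpha>" for z
    using C[OF a that] S.trace_real[OF that] by (simp add: r complex_eq_iff)
  have const: "wirtinger c k z = 0" if "z \<in> coord_image \<alpha>" "\<And>w. w \<in> coord_image \<alpha> \<Longrightarrow> k w = x" for c k z x
    using wirtinger_cong(1)[OF S.open_U that(1), of "\<lambda>_. x" k c] that(2)
      wirtinger_eq[OF has_derivative_const, of c x z] by simp
  \<comment> \<open>Constancy is used twice: \<open>tr s\<close> is constant, so its derivative
    \<open>f\<close> is zero; \<open>f\<close> is then itself constant, so \<open>d_zbar f\<close>
    is zero and the equality case of the Bochner formula applies.\<close>
  have "S.f z = 0" if "z \<in> coord_image \<alpha>" for z
    using S.d_z_trace[OF that] const[where c = "- \<i>", OF that tr] by (simp add: d_z_wirtinger)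
  then have "d_zbar S.f z = 0" if "z \<in> coord_image \<alpha>" for z
    using const[where c = \<i> and k = S.f and x = 0, OF that] by (simp add: d_z_wirtinger)
  note zero = S.d_zbar_f_zero[OF _ this, unfolded r]
  show "metric_ratio h h' \<alpha> z * \<phi> \<alpha> z = \<phi> \<alpha> z * metric_ratio h h' \<alpha> z" if "z \<in> coord_image \<alpha>" for z
    using zero[OF that that] by simp
  fix i j assume ij: "i < n" "j < n"
  have "(\<lambda>z. metric_ratio h h' \<alpha> z $$ (i, j)) field_differentiable (at z)" if z: "z \<in> coord_image \<alpha>" for z
  proof (rule holomorphic_if_d_zbar_zero)
    show "(\<lambda>z. metric_ratio h h' \<alpha> z $$ (i, j)) differentiable (at z)"
      using differentiable_mat_onD(3)[OF S.diff_s[unfolded r] z ij] .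
    have "mat_d_zbar n (metric_ratio h h' \<alpha>) z $$ (i, j) = 0" using zero[OF z z] ij by simp
    then show "d_zbar (\<lambda>z. metric_ratio h h' \<alpha> z $$ (i, j)) z = 0" using ij by (simp add: mat_d_zbar_def)
  qed
  then show "(\<lambda>z. metric_ratio h h' \<alpha> z $$ (i, j)) holomorphic_on coord_image \<alpha>"
    by (auto simp: holomorphic_on_def intro: field_differentiable_at_within)
qed

end

section \<open>Metrics on the bundle of the Hitchin component\<close>

lemma hitchin_bundle_carrier [simp]: "hitchin_bundle n c \<alpha> \<beta> p \<in> carrier_mat n n"
  by (simp add: hitchin_bundle_def)

lemma hitchin_higgs_field_carrier [simp]: "hitchin_higgs_field n J q \<alpha> z \<in> carrier_mat n n"
  by (simp add: hitchin_higgs_field_def)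

lemma index_diag_mult:
  assumes "M \<in> carrier_mat n n" "a < n" "b < n"
  shows "(Matrix.mat n n (\<lambda>(a, b). if a = b then d a else 0) * M) $$ (a, b) = d a * (M $$ (a, b) :: complex)"
    and "(M * Matrix.mat n n (\<lambda>(a, b). if a = b then d a else 0)) $$ (a, b) = M $$ (a, b) * d b"
proof -
  let ?D = "Matrix.mat n n (\<lambda>(a, b). if a = b then d a else 0)"
  have D: "?D \<in> carrier_mat n n" by simp
  have "(?D * M) $$ (a, b) = (\<Sum>k<n. if k = a then d a * M $$ (a, b) else 0)"
    unfolding index_mult_mat_sum[OF D assms] using assms(2) by (intro sum.cong) auto
  then show "(?D * M) $$ (a, b) = d a * M $$ (a, b)" using assms by simp
  have "(M * ?D) $$ (a, b) = (\<Sum>k<n. if k = b then M $$ (a, b) * d b else 0)"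
    unfolding index_mult_mat_sum[OF assms(1) D assms(2,3)] using assms(3) by (intro sum.cong) auto
  then show "(M * ?D) $$ (a, b) = M $$ (a, b) * d b" using assms by simp
qed

text \<open>The cocycle condition along \<alpha>, \<beta>, \<alpha> makes
  \<open>c \<alpha> \<beta> p\<close> a factor of \<open>c \<alpha> \<alpha> p\<close>, whose square
  is the derivative of the identity.\<close>

lemma square_root_nonzero:
  assumes "closed_riemann_surface \<A>" "canonical_square_root \<A> c"
    and ab: "\<alpha> \<in> \<A>" "\<beta> \<in> \<A>" "p \<in> fst \<alpha> \<inter> fst \<beta>"
  shows "c \<alpha> \<beta> p \<noteq> 0"
proof -
  interpret closed_surface \<A> by unfold_locales (rule assms(1))
  have "deriv (snd \<alpha> \<circ> chart_inv \<alpha>) (snd \<alpha> p) = deriv (\<lambda>z. z) (snd \<alpha> p)"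
  proof (rule deriv_cong_ev)
    show "\<forall>\<^sub>F z in nhds (snd \<alpha> p). (snd \<alpha> \<circ> chart_inv \<alpha>) z = z"
      using ab chart_point[of p \<alpha>] open_coord_image[OF ab(1)] chart_inv_point(2)[OF ab(1)]
      unfolding eventually_nhds by (intro exI[of _ "coord_image \<alpha>"]) auto
  qed simp
  then have "coord_deriv \<alpha> \<alpha> p = 1" by (simp add: coord_deriv_def)
  moreover have "(c \<alpha> \<alpha> p)\<^sup>2 = coord_deriv \<alpha> \<alpha> p"
    using assms(2) ab unfolding canonical_square_root_def by blast
  moreover have "c \<alpha> \<alpha> p = c \<alpha> \<beta> p * c \<beta> \<alpha> p"
    using assms(2) ab unfolding canonical_square_root_def by blast
  ultimately show ?thesis by auto
qed

text \<open>In the entry (b + 1, b) triangularity leaves one term on each side: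
  \<open>s $$ (b + 1, b + 1)\<close> in the product with \<open>s\<close> on the left, and
  \<open>s $$ (b, b)\<close> in the other.\<close>

lemma upper_triangular_commutant_diagonal:
  fixes s \<Phi> :: "complex mat"
  assumes s: "s \<in> carrier_mat n n" "\<And>a b. a < n \<Longrightarrow> b < a \<Longrightarrow> s $$ (a, b) = 0"
    and \<Phi>: "\<Phi> \<in> carrier_mat n n" "\<And>a b. a < n \<Longrightarrow> b + 1 < a \<Longrightarrow> \<Phi> $$ (a, b) = 0"
      "\<And>b. b + 1 < n \<Longrightarrow> \<Phi> $$ (b + 1, b) = 1"
    and comm: "s * \<Phi> = \<Phi> * s" and "a < n"
  shows "s $$ (a, a) = s $$ (0, 0)"
  using \<open>a < n\<close>
proof (induction a)
  case (Suc b)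
  then have b: "b + 1 < n" "b < n" by auto
  have "(s * \<Phi>) $$ (b + 1, b) = (\<Sum>k<n. if k = b + 1 then s $$ (b + 1, b + 1) else 0)"
    unfolding index_mult_mat_sum[OF s(1) \<Phi>(1) b]
  proof (rule sum.cong[OF refl])
    fix k assume "k \<in> {..<n}"
    then show "s $$ (b + 1, k) * \<Phi> $$ (k, b) = (if k = b + 1 then s $$ (b + 1, b + 1) else 0)"
      using s(2)[OF b(1), of k] \<Phi>(2)[of k b] \<Phi>(3)[OF b(1)] by (cases k "b + 1" rule: linorder_cases) auto
  qed
  moreover have "(\<Phi> * s) $$ (b + 1, b) = (\<Sum>k<n. if k = b then s $$ (b, b) else 0)"
    unfolding index_mult_mat_sum[OF \<Phi>(1) s(1) b]
  proof (rule sum.cong[OF refl])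
    fix k assume "k \<in> {..<n}"
    then show "\<Phi> $$ (b + 1, k) * s $$ (k, b) = (if k = b then s $$ (b, b) else 0)"
      using s(2)[of k b] \<Phi>(2)[OF b(1), of k] \<Phi>(3)[OF b(1)] by (cases k b rule: linorder_cases) auto
  qed
  ultimately show ?case using comm b Suc by simp
qed simp

text \<open>
  Relative to \<open>H\<close> the nilpotent part \<open>N\<close> of \<open>H\<^sup>-\<^sup>1 H'\<close> is self-adjoint, so \<open>|N|\<^sup>2 = tr (N\<^sup>2) = 0\<close>.
\<close>

lemma unipotent_metric_ratio:
  assumes H: "hermitian_pos_def n H" and H': "hermitian_pos_def n H'"
    and low: "\<And>a b. a < n \<Longrightarrow> b < a \<Longrightarrow> (mat_inv H * H') $$ (a, b) = 0"
    and diag: "\<And>a. a < n \<Longrightarrow> (mat_inv H * H') $$ (a, a) = 1"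
  shows "H' = H"
proof -
  note Hc = hermitian_pos_defD(1,2)[OF H] and Hc' = hermitian_pos_defD(1,2)[OF H']
  note G = hermitian_pos_def_inv[OF H]
  define N where "N = mat_inv H * H' - 1\<^sub>m n"
  have s: "mat_inv H * H' \<in> carrier_mat n n" using G(1) Hc'(1) by (rule square_mult_carrier)
  have N: "N \<in> carrier_mat n n" using s by (simp add: N_def minus_carrier_mat)
  have "H * (mat_inv H * H') = H'"
    using Hc Hc' G by (simp flip: square_mult_assoc[of _ n])
  then have HN: "H * N = H' - H"
    unfolding N_def using Hc s by (simp add: mult_minus_distrib_mat[of _ n n _ n])
  have "mat_adjoint (H * N) = H * N"
    unfolding HN using Hc Hc' by (simp add: mat_adjoint_diff[of _ n n])
  then have adj: "mat_adjoint N * H = H * N"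
    using mat_adjoint_mult[OF Hc(1) N] Hc(2) by simp
  have N0: "N $$ (a, b) = 0" if "a < n" "b \<le> a" for a b
    using low[of a b] diag[of a] that s by (cases "a = b") (auto simp: N_def simp del: index_mult_mat)
  \<comment> \<open>Self-adjointness, in the form \<open>mat_adjoint N * H = H * N\<close>, lets
    \<open>mat_inv H\<close> cancel.\<close>
  have "mtrace (N * mat_inv H * mat_adjoint N * H) = mtrace (N * N)"
    using Hc N G adj by (simp add: square_mult_carrier[of _ n] square_mult_assoc[of _ n])
      (simp flip: square_mult_assoc[of _ n])
  also have "\<dots> = 0"
    unfolding mtrace_mult[OF N N]
  proof (intro sum.neutral ballI)
    fix a b assume "a \<in> {..<n}" "b \<in> {..<n}"
    then show "N $$ (a, b) * N $$ (b, a) = 0"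
      using N0[of a b] N0[of b a] by (cases "b \<le> a") auto
  qed
  finally have "N = 0\<^sub>m n n"
    using mtrace_sandwich_zero[OF hermitian_pos_def_inverse[OF H] H N] by simp
  then have "H' - H = 0\<^sub>m n n" using HN Hc by simp
  then have "(H' - H) $$ (a, b) = 0" if "a < n" "b < n" for a b using that by simp
  then show "H' = H" using Hc Hc' by (intro eq_matI) auto
qed

lemma higgs_field_subdiagonal:
  assumes "b + 1 < n" shows "hitchin_higgs_field n J q \<alpha> z $$ (b + 1, b) = 1"
  using assms by (simp add: hitchin_higgs_field_def e1_tilde_def e_mat_def)

lemma higgs_field_below_subdiagonal:
  assumes "a < n" "b + 1 < a" shows "hitchin_higgs_field n J q \<alpha> z $$ (a, b) = 0"
  using assms by (simp add: hitchin_higgs_field_def e1_tilde_def e_mat_def)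

text \<open>The differential q_j occupies the places with b + 1 = a + j, and k divides j; the
  remaining entries lie on the subdiagonal a = b + 1. Conjugation by the powers of a k-th root of
  unity therefore multiplies every entry by the same factor.\<close>

lemma higgs_field_weight:
  assumes "a < n" "b < n" "hitchin_higgs_field n {j\<in>{2..n}. j mod k = 0} q \<alpha> z $$ (a, b) \<noteq> 0"
  shows "a mod k = (b + 1) mod k"
proof (cases "a = b + 1")
  case False
  then have "(\<Sum>j\<in>{j\<in>{2..n}. j mod k = 0}. q j \<alpha> z * e_mat n (j - 1) $$ (a, b)) \<noteq> 0"
    using assms by (simp add: hitchin_higgs_field_def e1_tilde_def)
  then obtain j where "j \<in> {2..n}" "j mod k = 0" "e_mat n (j - 1) $$ (a, b) \<noteq> 0"
    by (auto elim: sum.not_neutral_contains_not_neutral)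
  moreover from this have "b = a + (j - 1)" using assms by (auto simp: e_mat_def split: if_splits)
  \<comment> \<open>The natural subtraction \<open>j - 1\<close> is not truncated because j is at
    least 2.\<close>
  ultimately have "b + 1 = a + j" "j mod k = 0" by auto
  then show ?thesis by (metis add.right_neutral mod_add_right_eq)
qed simp

text \<open>The argument on \<open>s\<close> determines a second solution only up to a scalar;
  \<open>diag\<close> fixes this scalar at the given point.\<close>

lemma solutions_on_hitchin_bundle_equal:
  assumes surf: "closed_riemann_surface \<A>" and genus: "genus \<A> \<ge> 2" and c: "canonical_square_root \<A> c"
    and n: "n > 0"
    and h: "hermitian_metric \<A> n (hitchin_bundle n c) h" and h': "hermitian_metric \<A> n (hitchin_bundle n c) h'"
    and eq: "hitchin_equation \<A> n (hitchin_higgs_field n J q) h"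
    and eq': "hitchin_equation \<A> n (hitchin_higgs_field n J q) h'"
    and az: "\<alpha> \<in> \<A>" "z \<in> coord_image \<alpha>"
    and diag: "h' \<alpha> z $$ (0, 0) = h \<alpha> z $$ (0, 0)"
  shows "h' \<alpha> z = h \<alpha> z"
proof -
  interpret closed_surface \<A> by unfold_locales (rule surf)
  let ?s = "metric_ratio h h'"
  note hol = metric_ratio_holomorphic_commutes[OF h h' eq eq' hitchin_bundle_carrier hitchin_higgs_field_carrier]
  have s: "?s \<beta> w \<in> carrier_mat n n" if "\<beta> \<in> \<A>" "w \<in> coord_image \<beta>" for \<beta> w
    unfolding metric_ratio_def
    using hermitian_pos_def_inv(1)[OF hermitian_metricD(1)[OF h that]]
      hermitian_pos_defD(1)[OF hermitian_metricD(1)[OF h' that]]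
    by (rule square_mult_carrier)
  have low: "?s \<alpha> z $$ (a, b) = 0" if ab: "a < n" "b < a" for a b
  proof (rule negative_power_section_zero[OF genus, of "a - b" "\<lambda>\<alpha> z. ?s \<alpha> z $$ (a, b)"])
    show "(\<lambda>z. ?s \<beta> z $$ (a, b)) holomorphic_on coord_image \<beta>" if "\<beta> \<in> \<A>" for \<beta>
      using ab by (intro hol(1)[OF that]) auto
    fix \<beta> \<gamma> p assume *: "\<beta> \<in> \<A>" "\<gamma> \<in> \<A>" "p \<in> fst \<beta> \<inter> fst \<gamma>"
    let ?c = "c \<beta> \<gamma> p" and ?e = "\<lambda>a. int n + 1 - 2 * int (a + 1)"
    have c0: "?c \<noteq> 0" using square_root_nonzero[OF surf c *] .
    have pts: "snd \<beta> p \<in> coord_image \<beta>" "snd \<gamma> p \<in> coord_image \<gamma>" using *(3) chart_point[of p \<beta>] chart_point[of p \<gamma>] by auto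
    have "(hitchin_bundle n c \<beta> \<gamma> p * ?s \<gamma> (snd \<gamma> p)) $$ (a, b)
        = (?s \<beta> (snd \<beta> p) * hitchin_bundle n c \<beta> \<gamma> p) $$ (a, b)"
      by (simp only: metric_ratio_transition[OF h h' hitchin_bundle_carrier *])
    then have "?c powi ?e a * ?s \<gamma> (snd \<gamma> p) $$ (a, b) = ?s \<beta> (snd \<beta> p) $$ (a, b) * ?c powi ?e b"
      unfolding hitchin_bundle_def
      using ab s * pts by (subst (asm) index_diag_mult(1), simp_all, subst (asm) index_diag_mult(2), simp_all)
    \<comment> \<open>The frame exponents of the summands drop by 2 from one to the next, so the
      entry (a, b) changes by an even power of the square root, that is, by the power a - b of the
      coordinate derivative.\<close>
    also have "?c powi ?e b = ?c powi ?e a * ?c powi (2 * int (a - b))"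
      using c0 ab by (simp add: power_int_add[symmetric] of_nat_diff algebra_simps)
    also have "?c powi (2 * int (a - b)) = (?c\<^sup>2) ^ (a - b)"
    proof -
      have "2 * int (a - b) = int (2 * (a - b))" by simp
      then show ?thesis by (simp only: power_int_of_nat power_mult)
    qed
    also have "?c\<^sup>2 = coord_deriv \<beta> \<gamma> p"
      using c * unfolding canonical_square_root_def by blast
    finally show "?s \<gamma> (snd \<gamma> p) $$ (a, b) = ?s \<beta> (snd \<beta> p) $$ (a, b) * coord_deriv \<beta> \<gamma> p ^ (a - b)"
      using c0 by simp
  qed (use ab az in auto)
  have const: "?s \<alpha> z $$ (a, a) = ?s \<alpha> z $$ (0, 0)" if "a < n" for a
    by (rule upper_triangular_commutant_diagonal[OF s[OF az] low hitchin_higgs_field_carrier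
          higgs_field_below_subdiagonal higgs_field_subdiagonal hol(2)[OF az] that])
  note H = hermitian_metricD(1)[OF h az] and H' = hermitian_metricD(1)[OF h' az]
  note Hc = hermitian_pos_defD(1)[OF H] and Hc' = hermitian_pos_defD(1)[OF H']
  have "h \<alpha> z * ?s \<alpha> z = h' \<alpha> z"
    unfolding metric_ratio_def using Hc Hc' hermitian_pos_def_inv[OF H]
    by (simp flip: square_mult_assoc[of _ n])
  then have "h' \<alpha> z $$ (0, 0) = (\<Sum>k<n. h \<alpha> z $$ (0, k) * ?s \<alpha> z $$ (k, 0))"
    using index_mult_mat_sum[OF Hc s[OF az] n n] by simp
  \<comment> \<open>In the first column of the triangular \<open>s\<close> only the top entry
    survives, so the two (0, 0) entries of the metrics differ by the scalar itself.\<close>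
  also have "\<dots> = (\<Sum>k<n. if k = 0 then h \<alpha> z $$ (0, 0) * ?s \<alpha> z $$ (0, 0) else 0)"
    by (intro sum.cong) (auto simp: low)
  also have "\<dots> = h \<alpha> z $$ (0, 0) * ?s \<alpha> z $$ (0, 0)" using n by simp
  finally have "?s \<alpha> z $$ (0, 0) = 1"
    using diag hermitian_pos_def_diag[OF H n] by auto
  then show ?thesis
    using low const by (intro unipotent_metric_ratio[OF H H']) (simp_all add: metric_ratio_def)
qed

section \<open>The cyclic symmetry\<close>

lemma Ck_on_cong:
  assumes "open U" "\<And>z. z \<in> U \<Longrightarrow> f z = g z" "Ck_on k f U"
  shows "Ck_on k g U"
  using assms(2,3)
proof (induction k arbitrary: f g)
  case 0
  then show ?case by (simp cong: continuous_on_cong)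
next
  case (Suc k)
  have d: "(g has_derivative frechet_derivative f (at z)) (at z)" if "z \<in> U" for z
  proof (rule has_derivative_transform_within_open[OF _ assms(1) that Suc.prems(1)])
    show "(f has_derivative frechet_derivative f (at z)) (at z)"
      using Suc.prems(2) that by (simp flip: frechet_derivative_works)
  qed
  have eq: "frechet_derivative f (at z) = frechet_derivative g (at z)" if "z \<in> U" for z
    by (rule frechet_derivative_at[OF d[OF that]])
  have "Ck_on k (\<lambda>z. frechet_derivative g (at z) v) U" for v
  proof (rule Suc.IH)
    show "frechet_derivative f (at z) v = frechet_derivative g (at z) v" if "z \<in> U" for z
      by (simp only: eq[OF that])
    show "Ck_on k (\<lambda>z. frechet_derivative f (at z) v) U" using Suc.prems(2) by simp
  qed
  moreover have "g differentiable (at z)" if "z \<in> U" for z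
    using d[OF that] unfolding differentiable_def by blast
  ultimately show ?case by simp
qed

lemma smooth_on_cong:
  assumes "open U" "\<And>z. z \<in> U \<Longrightarrow> f z = g z" "smooth_on f U"
  shows "smooth_on g U"
  using Ck_on_cong[OF assms(1,2)] assms(3) by (auto simp: smooth_on_def)

lemma smooth_on_cmult:
  assumes "open U" "smooth_on f U"
  shows "smooth_on (\<lambda>z. x * f z) U"
proof -
  have "Ck_on k f U \<Longrightarrow> Ck_on k (\<lambda>z. x * f z) U" for k
  proof (induction k arbitrary: f)
    case 0
    then show ?case by (auto intro: continuous_intros)
  next
    case (Suc k)
    have d: "((\<lambda>z. x * f z) has_derivative (\<lambda>v. x * frechet_derivative f (at z) v)) (at z)" if "z \<in> U" for z
      using Suc.prems that by (intro has_derivative_mult_right) (auto simp: frechet_derivative_works)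
    have "Ck_on k (\<lambda>z. frechet_derivative (\<lambda>z. x * f z) (at z) v) U" for v
    proof (rule Ck_on_cong[OF assms(1)])
      show "x * frechet_derivative f (at z) v = frechet_derivative (\<lambda>z. x * f z) (at z) v" if "z \<in> U" for z
        using frechet_derivative_at[OF d[OF that]] by metis
      show "Ck_on k (\<lambda>z. x * frechet_derivative f (at z) v) U"
        using Suc.prems by (intro Suc.IH) auto
    qed
    with d show ?case by (auto simp: differentiable_def)
  qed
  then show ?thesis using assms(2) by (simp add: smooth_on_def)
qed

lemma mat_wirtinger_const_sandwich:
  assumes "differentiable_mat_on n M U" "z \<in> U" "K \<in> carrier_mat n n" "L \<in> carrier_mat n n"
  shows "differentiable_mat_on n (\<lambda>z. K * M z * L) U"
    and "mat_wirtinger c n (\<lambda>z. K * M z * L) z = K * mat_wirtinger c n M z * L"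
proof -
  have const: "differentiable_mat_on n (\<lambda>_. X) U" "mat_wirtinger c n (\<lambda>_. X) z = 0\<^sub>m n n"
    if "X \<in> carrier_mat n n" for X
    using that differentiable_mat_onD(1)[OF assms(1)] wirtinger_eq[OF has_derivative_const]
    by (auto simp: differentiable_mat_on_def mat_wirtinger_def intro!: eq_matI)
  note K = const[OF assms(3)] and L = const[OF assms(4)]
  note KM = differentiable_mat_on_mult[OF K(1) assms(1)]
  show "differentiable_mat_on n (\<lambda>z. K * M z * L) U" by (rule differentiable_mat_on_mult[OF KM L(1)])
  show "mat_wirtinger c n (\<lambda>z. K * M z * L) z = K * mat_wirtinger c n M z * L"
    using assms(3,4) differentiable_mat_onD(2)[OF assms(1,2)]
    by (simp add: mat_wirtinger_mult[OF KM L(1) assms(2)] mat_wirtinger_mult[OF K(1) assms(1,2)] K(2) L(2)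
        square_mult_carrier[of _ n])
qed

lemma smult_smult_mat: "x \<cdot>\<^sub>m (y \<cdot>\<^sub>m M) = (x * y :: complex) \<cdot>\<^sub>m M"
  by (rule eq_matI) auto

lemma one_smult_mat: "(1 :: complex) \<cdot>\<^sub>m M = M"
  by (rule eq_matI) auto

lemma mat_adjoint_smult: "mat_adjoint (x \<cdot>\<^sub>m M) = cnj x \<cdot>\<^sub>m mat_adjoint M"
  by (rule eq_matI) auto

lemma herm_form_congruence:
  assumes H: "H \<in> carrier_mat n n" and D: "D \<in> carrier_mat n n" and v: "v \<in> carrier_vec n"
  shows "herm_form (mat_adjoint D * H * D) v v = herm_form H (D *\<^sub>v v) (D *\<^sub>v v)"
proof -
  have adj: "(mat_adjoint D *\<^sub>v x) \<bullet>c y = x \<bullet>c (D *\<^sub>v y)" if "x \<in> carrier_vec n" "y \<in> carrier_vec n" for x y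
  proof -
    have "(mat_adjoint D *\<^sub>v x) \<bullet>c y = (\<Sum>i<n. \<Sum>j<n. cnj (D $$ (j, i)) * x $ j * cnj (y $ i))"
      using that D by (auto simp: scalar_prod_def lessThan_atLeast0 sum_distrib_right intro!: sum.cong)
    also have "\<dots> = (\<Sum>j<n. \<Sum>i<n. cnj (D $$ (j, i)) * x $ j * cnj (y $ i))" by (rule sum.swap)
    also have "\<dots> = x \<bullet>c (D *\<^sub>v y)"
      using that D by (auto simp: scalar_prod_def lessThan_atLeast0 sum_distrib_left mult_ac intro!: sum.cong)
    finally show ?thesis .
  qed
  have Dv: "D *\<^sub>v v \<in> carrier_vec n" using D v by (rule mult_mat_vec_carrier)
  have "(mat_adjoint D * H * D) *\<^sub>v v = mat_adjoint D *\<^sub>v (H *\<^sub>v (D *\<^sub>v v))"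
    using H D v Dv by (simp add: assoc_mult_mat_vec[of _ n n _ n] square_mult_carrier[of _ n])
  then show ?thesis
    using adj[of "H *\<^sub>v (D *\<^sub>v v)" v] mult_mat_vec_carrier[OF H Dv] v by (simp add: herm_form_def)
qed

text \<open>
  A constant unitary gauge transformation \<open>D\<close> with \<open>D \<Phi> D\<^sup>-\<^sup>1 = \<zeta> \<Phi>\<close> and \<open>|\<zeta>| = 1\<close> maps solutions to
  solutions, since \<open>[\<phi>, \<phi>\<^sup>*]\<close> does not see the phase \<open>\<zeta>\<close>.
\<close>

locale twisting_gauge =
  fixes n :: nat and D :: "complex mat" and \<zeta> :: complex
  assumes D: "D \<in> carrier_mat n n"
    and unitary: "mat_adjoint D * D = 1\<^sub>m n"
    and phase: "\<zeta> * cnj \<zeta> = 1"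
begin

abbreviation E :: "complex mat" where "E \<equiv> mat_adjoint D"

abbreviation tw :: "complex mat \<Rightarrow> complex mat" where "tw M \<equiv> E * M * D"

lemma E: "E \<in> carrier_mat n n" using D by simp

lemma unitary': "D * E = 1\<^sub>m n"
  using mat_inv_props(2)[OF D det_nonzero_of_inverse[OF D E unitary]] mat_inv_eqI[OF D E unitary] by simp

lemmas sq = square_mult_carrier[of _ n] square_mult_assoc[of _ n]

lemma cancel: "M \<in> carrier_mat n n \<Longrightarrow> D * (E * M) = M" "M \<in> carrier_mat n n \<Longrightarrow> E * (D * M) = M"
  using D E unitary unitary' by (simp_all flip: square_mult_assoc[of _ n])

text \<open>As \<open>E\<close> is the inverse of \<open>D\<close>, one expression is both the
  congruence acting on metrics and the conjugation acting on endomorphisms; in the latter role it is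
  multiplicative.\<close>

lemma tw_mult:
  assumes "M \<in> carrier_mat n n" "N \<in> carrier_mat n n"
  shows "tw M * tw N = tw (M * N)"
  using assms D E cancel(1)[of "N * D"] by (simp add: sq)

lemma pos_def_tw:
  assumes "hermitian_pos_def n H"
  shows "hermitian_pos_def n (tw H)" "mat_inv (tw H) = tw (mat_inv H)"
proof -
  note H = hermitian_pos_defD[OF assms] and G = hermitian_pos_def_inv[OF assms]
  have "mat_adjoint (E * H * D) = E * (H * D)"
    using H D E mat_adjoint_mult[of "E * H" n n D n] mat_adjoint_mult[of E n n H n] by (simp add: sq)
  then have "mat_adjoint (tw H) = tw H" using H D E by (simp add: sq)
  moreover have "Re (herm_form (tw H) v v) > 0" if v: "v \<in> carrier_vec n" "v \<noteq> 0\<^sub>v n" for v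
    unfolding herm_form_congruence[OF H(1) D v(1)]
  proof (rule H(3))
    show "D *\<^sub>v v \<in> carrier_vec n" using D v(1) by (rule mult_mat_vec_carrier)
    have "E *\<^sub>v (D *\<^sub>v v) = v"
      using assoc_mult_mat_vec[OF E D v(1)] unitary v(1) by simp
    moreover have "E *\<^sub>v 0\<^sub>v n = 0\<^sub>v n" using D by (intro eq_vecI) (auto simp: scalar_prod_def)
    ultimately show "D *\<^sub>v v \<noteq> 0\<^sub>v n" using v(2) by auto
  qed
  ultimately show "hermitian_pos_def n (tw H)"
    using H(1) D E by (simp add: hermitian_pos_def_def sq)
  have "tw (mat_inv H) * tw H = 1\<^sub>m n"
    using tw_mult[OF G(1) H(1)] G(3) unitary right_mult_one_mat[OF E] by simp
  then show "mat_inv (tw H) = tw (mat_inv H)"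
    using H(1) D E G(1) by (intro mat_inv_eqI) (simp_all add: sq)
qed

text \<open>The gauge is constant, so it passes through both derivatives; connection matrix and
  curvature are simply conjugated.\<close>

lemma chern_curvature_tw:
  assumes U: "open U" "\<And>w. w \<in> U \<Longrightarrow> hermitian_pos_def n (H w)"
    and smooth: "\<And>a b. a < n \<Longrightarrow> b < n \<Longrightarrow> smooth_on (\<lambda>z. H z $$ (a, b)) U"
    and z: "z \<in> U"
  shows "chern_curvature n (\<lambda>z. tw (H z)) z = tw (chern_curvature n H z)"
proof -
  note dH = smooth_on_mat[OF U(1) hermitian_pos_defD(1)[OF U(2)] smooth]
  have A: "differentiable_mat_on n (chern_connection n H) U"
    unfolding chern_connection_def[abs_def] d_z_wirtinger
    using hermitian_pos_def_det[OF U(2)]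
    by (intro differentiable_mat_on_mult differentiable_mat_on_inverse dH) auto
  have conn: "tw (chern_connection n H w) = chern_connection n (\<lambda>z. tw (H z)) w" if w: "w \<in> U" for w
    using tw_mult[OF hermitian_pos_def_inv(1)[OF U(2)[OF w]], of "mat_d_z n H w"]
    by (simp add: chern_connection_def pos_def_tw(2)[OF U(2)[OF w]] d_z_wirtinger
        mat_wirtinger_const_sandwich(2)[OF dH(1) w E D])
  have "mat_d_zbar n (chern_connection n (\<lambda>z. tw (H z))) z = mat_wirtinger \<i> n (\<lambda>z. tw (chern_connection n H z)) z"
    unfolding d_z_wirtinger
    by (rule mat_wirtinger_cong[symmetric, OF mat_wirtinger_const_sandwich(1)[OF A z E D] z conn])
  also have "\<dots> = tw (mat_d_zbar n (chern_connection n H) z)"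
    unfolding d_z_wirtinger by (rule mat_wirtinger_const_sandwich(2)[OF A z E D])
  finally show ?thesis
    using D E by (simp add: chern_curvature_def d_z_wirtinger)
qed

text \<open>Conjugation multiplies \<Phi> by \<zeta> and its adjoint by \<open>cnj \<zeta>\<close>.
  Each product in the commutator contains one of either, and the two phases cancel.\<close>

lemma commutator_tw:
  assumes H: "hermitian_pos_def n H" and \<Phi>: "\<Phi> \<in> carrier_mat n n"
    and twist: "D * \<Phi> = \<zeta> \<cdot>\<^sub>m (\<Phi> * D)"
  shows "\<Phi> * herm_adjoint (tw H) \<Phi> - herm_adjoint (tw H) \<Phi> * \<Phi> =
    tw (\<Phi> * herm_adjoint H \<Phi> - herm_adjoint H \<Phi> * \<Phi>)"
proof -
  note Hc = hermitian_pos_defD(1)[OF H] and G = hermitian_pos_def_inv(1)[OF H]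
  let ?P = "mat_adjoint \<Phi>" and ?S = "herm_adjoint H \<Phi>"
  have P: "?P \<in> carrier_mat n n" using \<Phi> by simp
  have S: "?S \<in> carrier_mat n n" unfolding herm_adjoint_def using Hc G P by (simp add: sq)
  have smult: "(x \<cdot>\<^sub>m M) * N = x \<cdot>\<^sub>m (M * N)" "M * (x \<cdot>\<^sub>m N) = x \<cdot>\<^sub>m (M * N)"
    if "M \<in> carrier_mat n n" "N \<in> carrier_mat n n" for M N and x :: complex
    using that mult_smult_assoc_mat[of M n n N n x] mult_smult_distrib[of M n n N n x] by auto
  have DPE: "D * (\<Phi> * E) = \<zeta> \<cdot>\<^sub>m \<Phi>"
  proof -
    have "D * (\<Phi> * E) = \<zeta> \<cdot>\<^sub>m (\<Phi> * D) * E"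
      using twist D E \<Phi> square_mult_assoc[OF D \<Phi> E] by simp
    then show ?thesis using D E \<Phi> unitary' by (simp add: smult sq)
  qed
  have "mat_adjoint (D * (\<Phi> * E)) = D * (?P * E)"
    using D E \<Phi> by (simp add: mat_adjoint_mult[of _ n n _ n] sq)
  then have adj: "D * (?P * E) = cnj \<zeta> \<cdot>\<^sub>m ?P"
    unfolding DPE using \<Phi> P by (simp only: mat_adjoint_smult)
  have PE: "\<Phi> * E = \<zeta> \<cdot>\<^sub>m (E * \<Phi>)"
    using cancel(2)[of "\<Phi> * E"] DPE smult(2)[OF E \<Phi>, of \<zeta>] E \<Phi> by (simp add: sq)
  have "herm_adjoint (tw H) \<Phi> = E * (mat_inv H * (D * (?P * E) * (H * D)))"
    unfolding herm_adjoint_def pos_def_tw(2)[OF H] using D E G Hc P by (simp add: sq)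
  also have "\<dots> = cnj \<zeta> \<cdot>\<^sub>m tw ?S"
    unfolding adj herm_adjoint_def using D E G Hc P by (simp add: smult sq)
  finally have S': "herm_adjoint (tw H) \<Phi> = cnj \<zeta> \<cdot>\<^sub>m tw ?S" .
  have 1: "\<Phi> * herm_adjoint (tw H) \<Phi> = tw (\<Phi> * ?S)"
  proof -
    have "\<Phi> * herm_adjoint (tw H) \<Phi> = cnj \<zeta> \<cdot>\<^sub>m (\<Phi> * E * (?S * D))"
      unfolding S' using D E S \<Phi> by (simp add: smult sq)
    also have "\<dots> = cnj \<zeta> \<cdot>\<^sub>m (\<zeta> \<cdot>\<^sub>m (E * \<Phi> * (?S * D)))"
      unfolding PE using D E S \<Phi> by (simp add: smult sq)
    also have "\<dots> = tw (\<Phi> * ?S)"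
      using D E S \<Phi> phase by (simp add: smult_smult_mat one_smult_mat mult.commute sq)
    finally show ?thesis .
  qed
  have 2: "herm_adjoint (tw H) \<Phi> * \<Phi> = tw (?S * \<Phi>)"
  proof -
    have "herm_adjoint (tw H) \<Phi> * \<Phi> = cnj \<zeta> \<cdot>\<^sub>m (E * (?S * (D * \<Phi>)))"
      unfolding S' using D E S \<Phi> by (simp add: smult sq)
    also have "\<dots> = cnj \<zeta> \<cdot>\<^sub>m (\<zeta> \<cdot>\<^sub>m (E * (?S * (\<Phi> * D))))"
      unfolding twist using D E S \<Phi> by (simp add: smult sq)
    also have "\<dots> = tw (?S * \<Phi>)"
      using D E S \<Phi> phase by (simp add: smult_smult_mat one_smult_mat mult.commute sq)
    finally show ?thesis .
  qed
  show ?thesis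
    unfolding 1 2 using D E S \<Phi>
    by (simp add: sq mult_minus_distrib_mat[of _ n n _ n] minus_mult_distrib_mat[of _ n n _ _ n] minus_carrier_mat)
qed


lemma hitchin_equation_tw:
  assumes "closed_riemann_surface \<A>" "hermitian_metric \<A> n g h" "hitchin_equation \<A> n \<phi> h"
    and \<phi>: "\<And>\<alpha> z. \<phi> \<alpha> z \<in> carrier_mat n n" "\<And>\<alpha> z. D * \<phi> \<alpha> z = \<zeta> \<cdot>\<^sub>m (\<phi> \<alpha> z * D)"
  shows "hitchin_equation \<A> n \<phi> (\<lambda>\<alpha> z. tw (h \<alpha> z))"
  unfolding hitchin_equation_def
proof (intro ballI)
  fix \<alpha> z assume az: "\<alpha> \<in> \<A>" "z \<in> coord_image \<alpha>"
  interpret closed_surface \<A> by unfold_locales (rule assms(1))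
  note hD = hermitian_metricD[OF assms(2) az(1)]
  note H = hD(1)[OF az(2)]
  let ?F = "chern_curvature n (h \<alpha>) z" and ?S = "herm_adjoint (h \<alpha> z) (\<phi> \<alpha> z)"
  let ?C = "\<phi> \<alpha> z * ?S - ?S * \<phi> \<alpha> z"
  have F: "?F \<in> carrier_mat n n" by (simp add: chern_curvature_def d_z_wirtinger)
  have "?S \<in> carrier_mat n n"
    unfolding herm_adjoint_def using hermitian_pos_defD(1)[OF H] hermitian_pos_def_inv(1)[OF H] \<phi>(1)
    by (simp add: sq)
  then have C: "?C \<in> carrier_mat n n" using \<phi>(1) by (simp add: minus_carrier_mat sq)
  have "tw ?F + tw ?C = tw (?F + ?C)"
    using D E F C by (simp add: sq mult_add_distrib_mat[of _ n n _ n] add_mult_distrib_mat[of _ n n _ _ n])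
  also have "?F + ?C = 0\<^sub>m n n" using assms(3) az by (simp add: hitchin_equation_def)
  finally have "tw ?F + tw ?C = 0\<^sub>m n n" using D E by simp
  then show "chern_curvature n (\<lambda>z. tw (h \<alpha> z)) z +
       (\<phi> \<alpha> z * herm_adjoint (tw (h \<alpha> z)) (\<phi> \<alpha> z) - herm_adjoint (tw (h \<alpha> z)) (\<phi> \<alpha> z) * \<phi> \<alpha> z) = 0\<^sub>m n n"
    by (simp only: chern_curvature_tw[OF open_coord_image[OF az(1)] hD(1,2) az(2)] commutator_tw[OF H \<phi>])
qed

end

section \<open>The gauge transformation by powers of a root of unity\<close>

definition cyclic_gauge :: "nat \<Rightarrow> complex \<Rightarrow> complex mat" where
  "cyclic_gauge n \<zeta> = Matrix.mat n n (\<lambda>(a, b). if a = b then \<zeta> ^ a else 0)"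

lemma cyclic_gauge_adjoint:
  "mat_adjoint (cyclic_gauge n \<zeta>) = Matrix.mat n n (\<lambda>(a, b). if a = b then cnj (\<zeta> ^ a) else 0)"
  by (rule eq_matI) (auto simp: cyclic_gauge_def)

lemma cyclic_gauge_congruence:
  assumes "M \<in> carrier_mat n n" "a < n" "b < n"
  shows "(mat_adjoint (cyclic_gauge n \<zeta>) * M * cyclic_gauge n \<zeta>) $$ (a, b) = cnj (\<zeta> ^ a) * \<zeta> ^ b * M $$ (a, b)"
proof -
  let ?E = "mat_adjoint (cyclic_gauge n \<zeta>)"
  have "?E * M \<in> carrier_mat n n" using assms(1) by (intro square_mult_carrier) (simp_all add: cyclic_gauge_def)
  then have "(?E * M * cyclic_gauge n \<zeta>) $$ (a, b) = (?E * M) $$ (a, b) * \<zeta> ^ b"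
    unfolding cyclic_gauge_def using assms(2,3) by (rule index_diag_mult(2))
  also have "(?E * M) $$ (a, b) = cnj (\<zeta> ^ a) * M $$ (a, b)"
    unfolding cyclic_gauge_adjoint using assms by (rule index_diag_mult(1))
  finally show ?thesis by simp
qed

text \<open>The gauge commutes with the transition matrices since both are diagonal. It is therefore
  a global automorphism of the bundle, given by the same matrix in every chart.\<close>

lemma hermitian_metric_cyclic_gauge:
  assumes surf: "closed_riemann_surface \<A>" and h: "hermitian_metric \<A> n (hitchin_bundle n c) h"
    and tg: "twisting_gauge n (cyclic_gauge n \<zeta>) \<zeta>"
  shows "hermitian_metric \<A> n (hitchin_bundle n c)
    (\<lambda>\<alpha> z. mat_adjoint (cyclic_gauge n \<zeta>) * h \<alpha> z * cyclic_gauge n \<zeta>)"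
proof -
  interpret closed_surface \<A> by unfold_locales (rule surf)
  interpret twisting_gauge n "cyclic_gauge n \<zeta>" \<zeta> by (rule tg)
  note hD = hermitian_metricD[OF h]
  let ?D = "cyclic_gauge n \<zeta>"
  show ?thesis
    unfolding hermitian_metric_def
  proof (intro conjI ballI allI impI)
    fix \<alpha> z assume "\<alpha> \<in> \<A>" "z \<in> coord_image \<alpha>"
    then show "hermitian_pos_def n (tw (h \<alpha> z))" by (intro pos_def_tw hD(1))
  next
    fix \<alpha> a b assume a: "\<alpha> \<in> \<A>" and ab: "a < n" "b < n"
    show "smooth_on (\<lambda>z. tw (h \<alpha> z) $$ (a, b)) (coord_image \<alpha>)"
    proof (rule smooth_on_cong[OF open_coord_image[OF a]])
      show "smooth_on (\<lambda>z. (cnj (\<zeta> ^ a) * \<zeta> ^ b) * h \<alpha> z $$ (a, b)) (coord_image \<alpha>)"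
        by (intro smooth_on_cmult open_coord_image hD(2) a ab)
      show "(cnj (\<zeta> ^ a) * \<zeta> ^ b) * h \<alpha> z $$ (a, b) = tw (h \<alpha> z) $$ (a, b)" if "z \<in> coord_image \<alpha>" for z
        using cyclic_gauge_congruence[OF hermitian_pos_defD(1)[OF hD(1)[OF a that]] ab] by simp
    qed
  next
    fix \<alpha> \<beta> p assume *: "\<alpha> \<in> \<A>" "\<beta> \<in> \<A>" "p \<in> fst \<alpha> \<inter> fst \<beta>"
    let ?g = "hitchin_bundle n c \<alpha> \<beta> p" and ?H = "h \<alpha> (snd \<alpha> p)"
    have pa: "snd \<alpha> p \<in> coord_image \<alpha>" using *(3) chart_point[of p \<alpha>] by auto
    note H = hermitian_pos_defD(1)[OF hD(1)[OF *(1) pa]]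
    have g: "?g \<in> carrier_mat n n" "mat_adjoint ?g \<in> carrier_mat n n" by auto
    have gD: "?g * ?D = ?D * ?g"
    proof (rule eq_matI)
      fix a b assume "a < dim_row (?D * ?g)" "b < dim_col (?D * ?g)"
      then have "a < n" "b < n" by (auto simp: cyclic_gauge_def hitchin_bundle_def)
      then show "(?g * ?D) $$ (a, b) = (?D * ?g) $$ (a, b)"
        unfolding cyclic_gauge_def index_diag_mult[OF g(1) \<open>a < n\<close> \<open>b < n\<close>]
        by (simp add: hitchin_bundle_def)
    qed (auto simp: cyclic_gauge_def hitchin_bundle_def)
    then have "mat_adjoint (?g * ?D) = mat_adjoint (?D * ?g)" by simp
    then have gE: "E * mat_adjoint ?g = mat_adjoint ?g * E"
      using mat_adjoint_mult[OF g(1) D] mat_adjoint_mult[OF D g(1)] by simp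
    have "tw (h \<beta> (snd \<beta> p)) = (E * mat_adjoint ?g) * (?H * (?g * ?D))"
      unfolding hD(3)[OF *] using g H D E by (simp add: sq)
    also have "\<dots> = mat_adjoint ?g * tw ?H * ?g"
      unfolding gE gD using g H D E by (simp add: sq)
    finally show "tw (h \<beta> (snd \<beta> p)) = mat_adjoint ?g * tw ?H * ?g" .
  qed
qed

text \<open>Invariance of the metric under the gauge reads, entry by entry,
  \<open>cnj (\<zeta> ^ a) * \<zeta> ^ b * h = h\<close>. A nonzero entry forces the powers of
  \<zeta> to agree, which for a primitive k-th root means that a and b are congruent.\<close>

lemma metric_entry_zero:
  assumes surf: "closed_riemann_surface \<A>" and genus: "genus \<A> \<ge> 2" and c: "canonical_square_root \<A> c"
    and n: "n > 0" and k: "k \<ge> 1"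
    and h: "hermitian_metric \<A> n (hitchin_bundle n c) h"
    and eq: "hitchin_equation \<A> n (hitchin_higgs_field n {j\<in>{2..n}. j mod k = 0} q) h"
    and az: "\<alpha> \<in> \<A>" "z \<in> coord_image \<alpha>"
    and ab: "a < n" "b < n" "a mod k \<noteq> b mod k"
  shows "h \<alpha> z $$ (a, b) = 0"
proof (rule ccontr)
  assume h0: "h \<alpha> z $$ (a, b) \<noteq> 0"
  \<comment> \<open>A primitive k-th root of unity: its powers distinguish all residues modulo k,
    and its modulus 1 makes the gauge unitary.\<close>
  define \<zeta> where "\<zeta> = exp (2 * of_real pi * \<i> / of_nat k)"
  have pow: "\<zeta> ^ m = exp (2 * of_real pi * \<i> * of_nat m / of_nat k)" for m
    by (simp add: \<zeta>_def mult_ac flip: exp_of_nat_mult)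
  have pow_eq: "\<zeta> ^ m = \<zeta> ^ l \<longleftrightarrow> m mod k = l mod k" for m l
    unfolding pow using complex_root_unity_eq[OF k] by simp
  have phase: "\<zeta> * cnj \<zeta> = 1"
  proof -
    have "norm \<zeta> = 1" by (simp add: \<zeta>_def)
    then show ?thesis using complex_norm_square[of \<zeta>] by simp
  qed
  then have phase_pow: "cnj (\<zeta> ^ m) * \<zeta> ^ m = 1" for m
    by (simp add: power_mult_distrib[symmetric] mult.commute)
  let ?D = "cyclic_gauge n \<zeta>" and ?\<phi> = "hitchin_higgs_field n {j\<in>{2..n}. j mod k = 0} q"
  have tg: "twisting_gauge n ?D \<zeta>"
  proof
    show "?D \<in> carrier_mat n n" by (simp add: cyclic_gauge_def)
    show "\<zeta> * cnj \<zeta> = 1" by (rule phase)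
    show "mat_adjoint ?D * ?D = 1\<^sub>m n"
    proof (rule eq_matI)
      fix a b assume "a < dim_row (1\<^sub>m n)" "b < dim_col (1\<^sub>m n)"
      then have ab: "a < n" "b < n" by auto
      have "(mat_adjoint ?D * 1\<^sub>m n * ?D) $$ (a, b) = cnj (\<zeta> ^ a) * \<zeta> ^ b * 1\<^sub>m n $$ (a, b)"
        by (rule cyclic_gauge_congruence[OF _ ab]) simp
      moreover have "mat_adjoint ?D * 1\<^sub>m n = mat_adjoint ?D"
        by (rule right_mult_one_mat[of _ n]) (simp add: cyclic_gauge_def)
      ultimately show "(mat_adjoint ?D * ?D) $$ (a, b) = 1\<^sub>m n $$ (a, b)"
        using ab phase_pow[of a] by auto
    qed (auto simp: cyclic_gauge_def)
  qed
  interpret twisting_gauge n ?D \<zeta> by (rule tg)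
  have twist: "?D * ?\<phi> \<beta> w = \<zeta> \<cdot>\<^sub>m (?\<phi> \<beta> w * ?D)" for \<beta> w
  proof (rule eq_matI)
    fix a b assume "a < dim_row (\<zeta> \<cdot>\<^sub>m (?\<phi> \<beta> w * ?D))" "b < dim_col (\<zeta> \<cdot>\<^sub>m (?\<phi> \<beta> w * ?D))"
    then have ab: "a < n" "b < n" by (auto simp: cyclic_gauge_def hitchin_higgs_field_def)
    have "(?D * ?\<phi> \<beta> w) $$ (a, b) = \<zeta> ^ a * ?\<phi> \<beta> w $$ (a, b)"
      unfolding cyclic_gauge_def by (rule index_diag_mult(1)[OF hitchin_higgs_field_carrier ab])
    moreover have "(?\<phi> \<beta> w * ?D) $$ (a, b) = ?\<phi> \<beta> w $$ (a, b) * \<zeta> ^ b"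
      unfolding cyclic_gauge_def by (rule index_diag_mult(2)[OF hitchin_higgs_field_carrier ab])
    moreover have "\<zeta> ^ a = \<zeta> * \<zeta> ^ b" if "?\<phi> \<beta> w $$ (a, b) \<noteq> 0"
      using pow_eq[of a "b + 1"] higgs_field_weight[OF ab that] by simp
    moreover have "(\<zeta> \<cdot>\<^sub>m (?\<phi> \<beta> w * ?D)) $$ (a, b) = \<zeta> * (?\<phi> \<beta> w * ?D) $$ (a, b)"
      by (rule index_smult_mat(1)) (use ab in \<open>auto simp: cyclic_gauge_def hitchin_higgs_field_def\<close>)
    ultimately show "(?D * ?\<phi> \<beta> w) $$ (a, b) = (\<zeta> \<cdot>\<^sub>m (?\<phi> \<beta> w * ?D)) $$ (a, b)"
      by (cases "?\<phi> \<beta> w $$ (a, b) = 0") simp_all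
  qed (auto simp: cyclic_gauge_def hitchin_higgs_field_def)
  note H = hermitian_pos_defD(1)[OF hermitian_metricD(1)[OF h az]]
  have "tw (h \<alpha> z) = h \<alpha> z"
  proof (rule solutions_on_hitchin_bundle_equal[
        where h' = "\<lambda>\<alpha> z. tw (h \<alpha> z)", OF surf genus c n h _ eq _ az])
    show "hermitian_metric \<A> n (hitchin_bundle n c) (\<lambda>\<alpha> z. tw (h \<alpha> z))"
      by (rule hermitian_metric_cyclic_gauge[OF surf h tg])
    show "hitchin_equation \<A> n ?\<phi> (\<lambda>\<alpha> z. tw (h \<alpha> z))"
      by (rule hitchin_equation_tw[OF surf h eq hitchin_higgs_field_carrier twist])
    show "tw (h \<alpha> z) $$ (0, 0) = h \<alpha> z $$ (0, 0)"
      using cyclic_gauge_congruence[OF H n n, of \<zeta>] by simp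
  qed
  then have one: "cnj (\<zeta> ^ a) * \<zeta> ^ b = 1"
    using cyclic_gauge_congruence[OF H ab(1,2), of \<zeta>] h0 by simp
  have "\<zeta> ^ b = (cnj (\<zeta> ^ a) * \<zeta> ^ a) * \<zeta> ^ b" by (simp only: phase_pow mult_1)
  also have "\<dots> = \<zeta> ^ a * (cnj (\<zeta> ^ a) * \<zeta> ^ b)" by (simp only: mult_ac)
  finally have "\<zeta> ^ b = \<zeta> ^ a" by (simp only: one mult_1_right)
  then show False using pow_eq ab(3) by auto
qed

text \<open>For j between 1 and k the progression from j with step k exhausts the positive members
  of its residue class, because j is the smallest of them.\<close>

lemma summand_indices_eq:
  assumes "1 \<le> j" "j \<le> k"
  shows "summand_indices n k j = {i \<in> {1..n}. i mod k = j mod k}"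
proof (intro equalityI subsetI)
  fix i assume "i \<in> {i \<in> {1..n}. i mod k = j mod k}"
  then have i: "1 \<le> i" "i \<le> n" "i mod k = j mod k" by auto
  \<comment> \<open>A smaller i would equal its own residue and hence that of j; for j < k this is j
    itself, and for j = k it is 0, whereas i is positive.\<close>
  have "j \<le> i"
  proof (rule ccontr)
    assume "\<not> j \<le> i"
    then have "i < k" "i < j" using assms by auto
    then have "i = j mod k" using i(3) by simp
    then show False using \<open>i < j\<close> assms i(1) by (cases "j = k") auto
  qed
  then obtain l where "i = j + k * l" using i(3) by (metis mod_eq_nat2E nat_le_iff_add)
  then show "i \<in> summand_indices n k j" using i(2) by (auto simp: summand_indices_def)
qed (use assms in \<open>auto simp: summand_indices_def\<close>)

theorem theorem2p10:
  fixes \<A> :: "'a::t2_space chart set"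
    and c :: "'a chart \<Rightarrow> 'a chart \<Rightarrow> 'a \<Rightarrow> complex"
    and n k :: nat
    and q :: "nat \<Rightarrow> 'a chart \<Rightarrow> complex \<Rightarrow> complex"
    and h :: "'a chart \<Rightarrow> complex \<Rightarrow> complex mat"
  assumes "closed_riemann_surface \<A>" and "genus \<A> \<ge> 2"
    and "canonical_square_root \<A> c"
    and "n \<ge> 2" and "1 \<le> k" and "k \<le> n"
    and "\<forall>j\<in>{2..n}. j mod k = 0 \<longrightarrow> q j \<in> holomorphic_differentials \<A> j"
    and "hermitian_metric \<A> n (hitchin_bundle n c) h" and "trivial_on_det \<A> h"
    and "hitchin_equation \<A> n (hitchin_higgs_field n {j\<in>{2..n}. j mod k = 0} q) h"
  shows "splits_orthogonally \<A> n h k (summand_indices n k)"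
  unfolding splits_orthogonally_def
proof (intro conjI ballI impI)
  have mod_inj: "i = j" if "i \<in> {1..k}" "j \<in> {1..k}" "i mod k = j mod k" for i j
    using that by (cases "i = k"; cases "j = k") auto
  \<comment> \<open>Summands are numbered from 1, so the residue 0 is represented by k.\<close>
  have res: "\<exists>j\<in>{1..k}. i mod k = j mod k" for i
  proof (cases "i mod k = 0")
    case True
    then show ?thesis using assms(5) by (intro bexI[of _ k]) auto
  next
    case False
    moreover have "i mod k < k" using assms(5) by simp
    ultimately show ?thesis by (intro bexI[of _ "i mod k"]) auto
  qed
  show "(\<Union>j\<in>{1..k}. summand_indices n k j) = {1..n}"
    using res by (auto simp: summand_indices_eq)
  show "disjoint_family_on (summand_indices n k) {1..k}"
    unfolding disjoint_family_on_def
  proof (intro ballI impI)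
    fix i j assume "i \<in> {1..k}" "j \<in> {1..k}" "i \<noteq> j"
    then show "summand_indices n k i \<inter> summand_indices n k j = {}"
      using mod_inj[of i j] by (auto simp: summand_indices_eq)
  qed
  fix \<alpha> z i j v w
  assume az: "\<alpha> \<in> \<A>" "z \<in> coord_image \<alpha>" and ij: "i \<in> {1..k}" "j \<in> {1..k}" "i \<noteq> j"
    and v: "v \<in> summand_fibre n (summand_indices n k i)"
    and w: "w \<in> summand_fibre n (summand_indices n k j)"
  have n: "n > 0" using assms(4) by simp
  have H: "h \<alpha> z \<in> carrier_mat n n"
    using hermitian_pos_defD(1)[OF hermitian_metricD(1)[OF assms(8) az]] .
  \<comment> \<open>The form is conjugate linear in its second argument, so the column index b
    belongs to \<open>v\<close> and the row index a to \<open>w\<close>.\<close>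
  have "h \<alpha> z $$ (a, b) * v $ b * cnj (w $ a) = 0" if ab: "a < n" "b < n" for a b
  proof (rule ccontr)
    assume nz: "h \<alpha> z $$ (a, b) * v $ b * cnj (w $ a) \<noteq> 0"
    then have "b + 1 \<in> summand_indices n k i" "a + 1 \<in> summand_indices n k j"
      using v w ab by (auto simp: summand_fibre_def)
    then have "(b + 1) mod k = i mod k" "(a + 1) mod k = j mod k"
      using ij by (auto simp: summand_indices_eq)
    moreover have "a mod k = b mod k"
      using metric_entry_zero[OF assms(1-3) n assms(5,8,10) az ab] nz by auto
    \<comment> \<open>The shift by one passes from matrix indices to the numbers of the summands and
      preserves congruence.\<close>
    then have "(a + 1) mod k = (b + 1) mod k" by (metis mod_add_left_eq)
    ultimately show False using mod_inj[OF ij(1,2)] ij(3) by simp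
  qed
  then show "herm_form (h \<alpha> z) v w = 0"
    using v w by (subst herm_form_sum[OF H]) (auto simp: summand_fibre_def intro!: sum.neutral)
qed

end
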